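(* For every $d\in\mathbb{N}$ and $i=1,2,3$, the polynomial $J_{d,i}:=\det B_{d,i}\in\mathbb{Q}[x_2,x_3,y_2,y_3]$ vanishes identically when restricted to $S_0(d)$ (that is, to the part of $S_0(d)$ in the affine chart $y_1=1$ with coordinates $(x_2,x_3,y_2,y_3)$).
   Context: $\mathbb{P}^w:=\mathbb{P}^{2,3,2,3,1}$ is the complex weighted projective space with coordinates $[x_2:x_3:y_2:y_3:y_1]$ of weights $2,3,2,3,1$; the affine chart $y_1=1$ is $\mathbb{C}^4$ with coordinates $(x_2,x_3,y_2,y_3)$. $\mathbb{N}=\{1,2,\dots\}$ and $\mathbb{N}_0=\mathbb{N}\cup\{0\}$. The vector field $$\mathsf{v}=\left(2x_2-6x_3+\tfrac16(x_2-y_2)x_2\right)\frac{\partial}{\partial x_2}+\left(3x_3-\tfrac13x_2^2+\tfrac14(x_2-y_2)x_3\right)\frac{\partial}{\partial x_3}-\left(2y_2-6y_3+\tfrac16(y_2-x_2)y_2\right)\frac{\partial}{\partial y_2}-\left(3y_3-\tfrac13y_2^2+\tfrac14(y_2-x_2)y_3\right)\frac{\partial}{\partial y_3}$$ is regarded as a derivation of $\mathbb{Q}[x_2,x_3,y_2,y_3]$ to itself. The Dedekind function is $\psi(d):=d\prod_{p\mid d}(1+\frac1p)$, the product being over primes $p$ dividing $d$. For $i=1,2,3$ let $\alpha_{i,j}$, $j=1,\dots,m_{d,i}$, be the set of all monomials $y_i^{a_1}x_2^{a_2}x_3^{a_3}$ with $a_1,a_2,a_3\in\mathbb{N}_0$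 and $i\cdot\psi(d)=ia_1+2a_2+3a_3$; for $i=1$ these monomials are considered with $y_1=1$. Then $B_{d,i}$ is the $m_{d,i}\times m_{d,i}$ matrix whose $(r,j)$ entry is $\mathsf{v}^{r-1}(\alpha_{i,j})$, $1\le r,j\le m_{d,i}$, with $\mathsf{v}^0(\alpha)=\alpha$. The algebraic curve $S_0(d)\subset\mathbb{P}^w$ is the closure of the image of the map from the upper half plane $$\tau\mapsto\left[g_2(\tau):g_3(\tau):d^2g_2(d\tau):-d^3g_3(d\tau):g_1(\tau)-d\,g_1(d\tau)\right],$$ where $(g_1,g_2,g_3)=\left(\frac{2\pi i}{12}E_2,\ 12\left(\frac{2\pi i}{12}\right)^2E_4,\ 8\left(\frac{2\pi i}{12}\right)^3E_6\right)$ and, with $q=e^{2\pi i\tau}$ and $\sigma_k(n)=\sum_{m\mid n}m^k$, $E_2=1-24\sum_{n\ge1}\sigma_1(n)q^n$, $E_4=1+240\sum_{n\ge1}\sigma_3(n)q^n$, $E_6=1-504\sum_{n\ge1}\sigma_5(n)q^n$. It is isomorphic, away from $\{27x_3^2=x_2^3\}\cup\{27y_3^2=y_2^3\}$, to the modular curve $X_0(d)$ minus cusps. (For $d=1$ it is contained in $\{y_1=0\}$.) *)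

theory Defs
  imports
    Complex_Main
    "HOL-Computational_Algebra.Primes"
    "HOL-Library.Poly_Mapping"
    "Jordan_Normal_Form.Determinant"
begin

text \<open>
  Polynomials in indeterminates of type \<open>'v\<close> with coefficients in \<open>'a\<close>: finitely supported
  functions from exponent vectors to coefficients.  The ring structure is the convolution
  product provided by the library.
\<close>

type_synonym ('v, 'a) mpoly = "('v \<Rightarrow>\<^sub>0 nat) \<Rightarrow>\<^sub>0 'a"

definition pvar :: "'v \<Rightarrow> ('v, 'a::zero_neq_one) mpoly" where
  "pvar v = Poly_Mapping.single (Poly_Mapping.single v 1) 1"

definition pconst :: "'a::zero \<Rightarrow> ('v, 'a) mpoly" where
  "pconst c = Poly_Mapping.single 0 c"

definition partial_deriv :: "'v \<Rightarrow> ('v, 'a::comm_semiring_1) mpoly \<Rightarrow> ('v, 'a) mpoly" where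
  "partial_deriv v p =
     (\<Sum>m\<in>Poly_Mapping.keys p.
        Poly_Mapping.single (m - Poly_Mapping.single v 1)
          (of_nat (Poly_Mapping.lookup m v) * Poly_Mapping.lookup p m))"

text \<open>Evaluation at \<open>z\<close>, with the coefficients mapped by \<open>h\<close>.\<close>

definition peval :: "('a::zero \<Rightarrow> 'b::comm_semiring_1) \<Rightarrow> ('v \<Rightarrow> 'b) \<Rightarrow> ('v, 'a) mpoly \<Rightarrow> 'b" where
  "peval h z p =
     (\<Sum>m\<in>Poly_Mapping.keys p.
        h (Poly_Mapping.lookup p m) * (\<Prod>v\<in>Poly_Mapping.keys m. z v ^ Poly_Mapping.lookup m v))"


section \<open>Coordinates and the weighted projective space\<close>

datatype coord = X2 | X3 | Y2 | Y3

datatype hcoord = Aff coord | Y1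

fun weight :: "hcoord \<Rightarrow> nat" where
  "weight (Aff X2) = 2"
| "weight (Aff X3) = 3"
| "weight (Aff Y2) = 2"
| "weight (Aff Y3) = 3"
| "weight Y1 = 1"

definition wscale :: "complex \<Rightarrow> (hcoord \<Rightarrow> complex) \<Rightarrow> (hcoord \<Rightarrow> complex)" where
  "wscale t z = (\<lambda>v. t ^ weight v * z v)"

definition punctured_space :: "(hcoord \<Rightarrow> complex) set" where
  "punctured_space = {z. \<exists>v. z v \<noteq> 0}"

definition wproj_rel :: "((hcoord \<Rightarrow> complex) \<times> (hcoord \<Rightarrow> complex)) set" where
  "wproj_rel = {(z, w). z \<in> punctured_space \<and> w \<in> punctured_space \<and> (\<exists>t. t \<noteq> 0 \<and> w = wscale t z)}"

definition wproj_space :: "(hcoord \<Rightarrow> complex) set set" where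
  "wproj_space = punctured_space // wproj_rel"

definition wproj_point :: "(hcoord \<Rightarrow> complex) \<Rightarrow> (hcoord \<Rightarrow> complex) set" where
  "wproj_point z = wproj_rel `` {z}"

definition weighted_homogeneous :: "nat \<Rightarrow> (hcoord, complex) mpoly \<Rightarrow> bool" where
  "weighted_homogeneous n f \<longleftrightarrow>
     (\<forall>m\<in>Poly_Mapping.keys f. (\<Sum>v\<in>Poly_Mapping.keys m. weight v * Poly_Mapping.lookup m v) = n)"

definition wproj_zeros :: "(hcoord, complex) mpoly set \<Rightarrow> (hcoord \<Rightarrow> complex) set set" where
  "wproj_zeros F = {P \<in> wproj_space. \<forall>f\<in>F. \<forall>z\<in>P. peval id z f = 0}"

definition wproj_closed :: "(hcoord \<Rightarrow> complex) set set \<Rightarrow> bool" where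
  "wproj_closed C \<longleftrightarrow> (\<exists>F. (\<forall>f\<in>F. \<exists>n. weighted_homogeneous n f) \<and> C = wproj_zeros F)"

text \<open>The chart \<open>y\<^sub>1 = 1\<close>.\<close>

definition chart :: "(coord \<Rightarrow> complex) \<Rightarrow> (hcoord \<Rightarrow> complex) set" where
  "chart a = wproj_point (case_hcoord a 1)"


section \<open>The curve\<close>

definition divisor_power_sum :: "nat \<Rightarrow> nat \<Rightarrow> nat" where
  "divisor_power_sum k n = (\<Sum>m | m dvd n. m ^ k)"

definition nome :: "complex \<Rightarrow> complex" where
  "nome \<tau> = exp (2 * of_real pi * \<i> * \<tau>)"

definition eisenstein_E2 :: "complex \<Rightarrow> complex" where
  "eisenstein_E2 \<tau> = 1 - 24 * suminf (\<lambda>n. of_nat (divisor_power_sum 1 (Suc n)) * nome \<tau> ^ Suc n)"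

definition eisenstein_E4 :: "complex \<Rightarrow> complex" where
  "eisenstein_E4 \<tau> = 1 + 240 * suminf (\<lambda>n. of_nat (divisor_power_sum 3 (Suc n)) * nome \<tau> ^ Suc n)"

definition eisenstein_E6 :: "complex \<Rightarrow> complex" where
  "eisenstein_E6 \<tau> = 1 - 504 * suminf (\<lambda>n. of_nat (divisor_power_sum 5 (Suc n)) * nome \<tau> ^ Suc n)"

definition g1 :: "complex \<Rightarrow> complex" where
  "g1 \<tau> = (2 * of_real pi * \<i> / 12) * eisenstein_E2 \<tau>"

definition g2 :: "complex \<Rightarrow> complex" where
  "g2 \<tau> = 12 * (2 * of_real pi * \<i> / 12)^2 * eisenstein_E4 \<tau>"

definition g3 :: "complex \<Rightarrow> complex" where
  "g3 \<tau> = 8 * (2 * of_real pi * \<i> / 12)^3 * eisenstein_E6 \<tau>"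

fun modular_param :: "nat \<Rightarrow> complex \<Rightarrow> hcoord \<Rightarrow> complex" where
  "modular_param d \<tau> (Aff X2) = g2 \<tau>"
| "modular_param d \<tau> (Aff X3) = g3 \<tau>"
| "modular_param d \<tau> (Aff Y2) = of_nat d ^ 2 * g2 (of_nat d * \<tau>)"
| "modular_param d \<tau> (Aff Y3) = - (of_nat d ^ 3 * g3 (of_nat d * \<tau>))"
| "modular_param d \<tau> Y1 = g1 \<tau> - of_nat d * g1 (of_nat d * \<tau>)"

text \<open>
  The closure is the Zariski closure in the weighted projective space: the smallest common zero
  set of weighted homogeneous polynomials that contains the image.
\<close>

definition S0 :: "nat \<Rightarrow> (hcoord \<Rightarrow> complex) set set" where
  "S0 d = wproj_closed hull {wproj_point (modular_param d \<tau>) | \<tau>. Im \<tau> > 0}"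

definition S0_affine :: "nat \<Rightarrow> (coord \<Rightarrow> complex) set" where
  "S0_affine d = {a. chart a \<in> S0 d}"


section \<open>The vector field and the matrices\<close>

abbreviation x2 :: "(coord, rat) mpoly" where "x2 \<equiv> pvar X2"
abbreviation x3 :: "(coord, rat) mpoly" where "x3 \<equiv> pvar X3"
abbreviation y2 :: "(coord, rat) mpoly" where "y2 \<equiv> pvar Y2"
abbreviation y3 :: "(coord, rat) mpoly" where "y3 \<equiv> pvar Y3"

definition vfield :: "(coord, rat) mpoly \<Rightarrow> (coord, rat) mpoly" where
  "vfield p =
     (2 * x2 - 6 * x3 + pconst (1/6) * (x2 - y2) * x2) * partial_deriv X2 p
   + (3 * x3 - pconst (1/3) * x2^2 + pconst (1/4) * (x2 - y2) * x3) * partial_deriv X3 p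
   - (2 * y2 - 6 * y3 + pconst (1/6) * (y2 - x2) * y2) * partial_deriv Y2 p
   - (3 * y3 - pconst (1/3) * y2^2 + pconst (1/4) * (y2 - x2) * y3) * partial_deriv Y3 p"

definition dedekind_psi :: "nat \<Rightarrow> rat" where
  "dedekind_psi d = of_nat d * (\<Prod>p | prime p \<and> p dvd d. 1 + 1 / of_nat p)"

text \<open>\<open>y\<^sub>i\<close> in the chart \<open>y\<^sub>1 = 1\<close>; only the indices \<open>1, 2, 3\<close> are meaningful.\<close>

definition y_coord :: "nat \<Rightarrow> (coord, rat) mpoly" where
  "y_coord i = (if i = 1 then 1 else if i = 2 then y2 else y3)"

definition weighted_monomials :: "nat \<Rightarrow> nat \<Rightarrow> (coord, rat) mpoly set" where
  "weighted_monomials d i =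
     {y_coord i ^ a1 * x2 ^ a2 * x3 ^ a3 | a1 a2 a3.
        of_nat i * dedekind_psi d = of_nat (i * a1 + 2 * a2 + 3 * a3)}"

text \<open>
  The matrix depends on an enumeration of the monomials, given here as a list \<open>\<alpha>\<close>.
  Matrix and list indices start at \<open>0\<close>, so row \<open>r\<close> carries the \<open>r\<close>-th iterate of the derivation.
\<close>

definition B_matrix :: "(coord, rat) mpoly list \<Rightarrow> (coord, rat) mpoly mat" where
  "B_matrix \<alpha> = mat (length \<alpha>) (length \<alpha>) (\<lambda>(r, j). (vfield ^^ r) (\<alpha> ! j))"

definition J_poly :: "(coord, rat) mpoly list \<Rightarrow> (coord, rat) mpoly" where
  "J_poly \<alpha> = det (B_matrix \<alpha>)"

end

theory Submission
  imports Defs "HOL-Complex_Analysis.Complex_Analysis" "HOL-Number_Theory.Cong"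
begin

text \<open>
  On the parametrised curve let \<open>y\<^sub>1 = g\<^sub>1(\<tau>) - d g\<^sub>1(d\<tau>)\<close> and normalise \<open>y\<^sub>1 = 1\<close> by dividing each coordinate by the power of \<open>y\<^sub>1\<close>
  given by its weight.  Two facts about the resulting curve in the affine chart suffice.

  \<^item> The monomials \<open>\<alpha>\<^sub>j\<close> are linearly dependent on the curve
    (\<open>polynomial_relation_on_curve\<close>): some nonzero vector \<open>c\<close> of complex numbers satisfies
    \<open>\<Sum>\<^sub>j c\<^sub>j \<alpha>\<^sub>j = 0\<close> along it.

  \<^item> The vector field is tangent to the curve (\<open>vfield_tangent_to_curve\<close>): differentiation by
    \<open>\<tau>\<close> is \<open>y\<^sub>1\<close> times the derivation.  This is a reformulation of Ramanujan's differential equations for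
    \<open>g\<^sub>1, g\<^sub>2, g\<^sub>3\<close>, which hold for \<open>d\<^sup>i g\<^sub>i(d\<tau>)\<close> as well.

  Differentiating the dependence again and again shows that \<open>c\<close> is in the kernel of the matrix at
  each point of the curve with \<open>y\<^sub>1 \<noteq> 0\<close>, so the determinant is zero there.  The determinant,
  homogenised with a spare factor \<open>y\<^sub>1\<close>, then vanishes on the whole image, hence on its Zariski
  closure (\<open>S0_affine_vanishing\<close>).

  The linear dependence is a modular equation.  The function \<open>d\<^sup>i g\<^sub>i(d\<tau>)\<close> (for \<open>i = 1\<close>, the function
  \<open>y\<^sub>1\<close>) has conjugates under \<open>SL\<^sub>2(\<int>)\<close>, indexed by primitive integer matrices of determinant \<open>d\<close>
  modulo left multiplication; there are at most \<open>\<psi>(d)\<close> of them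
  (\<open>card_hecke_triples_le_psi\<close>).  The elementary symmetric functions of the conjugates are modular
  forms of level one, hence isobaric polynomials in \<open>g\<^sub>2\<close> and \<open>g\<^sub>3\<close>
  (\<open>modular_form_isobaric\<close>), and the polynomial whose roots are the conjugates gives the relation
  (\<open>modular_orbit_relation\<close>, \<open>modular_equation\<close>).  If there are fewer than \<open>\<psi>(d)\<close> conjugates, a power of
  \<open>y\<^sub>i\<close> brings the relation to weight \<open>i \<psi>(d)\<close>.

  The analytic input is the behaviour of \<open>g\<^sub>1, g\<^sub>2, g\<^sub>3\<close> under \<open>\<tau> \<mapsto> -1/\<tau>\<close>.  All three
  laws come from one identity (\<open>cot_sum_inversion\<close>) for the cotangent series
  \<open>\<Sum>\<^sub>m \<pi> cot(\<pi>(z + m\<tau>))\<close>: its failure to be invariant under \<open>(z, \<tau>) \<mapsto> (z/\<tau>, -1/\<tau>)\<close>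
  is, up to a linear term, an entire doubly periodic function, so it is constant by Liouville's theorem; the Taylor
  coefficients of order 1, 3 and 5 at \<open>z = 0\<close> are \<open>E\<^sub>2, E\<^sub>4, E\<^sub>6\<close> up to constants.  Ramanujan's
  equations follow because there are no cusp forms of weight at most 10
  (\<open>cusp_form_small_weight_eq_0\<close>).  They imply that the discriminant
  \<open>g\<^sub>2\<^sup>3 - 27 g\<^sub>3\<^sup>2\<close> satisfies a linear differential equation of first order and so has no zeros, which gives
  the structure of level-one modular forms and also shows that the parametrisation never hits the origin,
  so that it defines points of the weighted projective space.
\<close>

section \<open>The nome and twisted Lambert series\<close>

lemma summable_power_times_geometric:
  fixes x :: real
  assumes "\<bar>x\<bar> < 1"
  shows "summable (\<lambda>n. real (Suc n) ^ k * x ^ Suc n)"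
proof -
  have *: "summable (\<lambda>n. real n ^ k * x ^ n)" if "\<bar>x\<bar> < 1" for x :: real
    using that
  proof (induction k arbitrary: x)
    case 0
    then show ?case by (simp add: summable_geometric)
  next
    case (Suc k)
    have "summable (\<lambda>n. diffs (\<lambda>n. real n ^ k) n * x ^ n)"
      by (rule termdiff_converges[where K = 1]) (use Suc in auto)
    hence "summable (\<lambda>n. real (Suc n) ^ Suc k * x ^ n)"
      by (simp add: diffs_def mult_ac)
    hence "summable (\<lambda>n. x * (real (Suc n) ^ Suc k * x ^ n))"
      by (rule summable_mult)
    hence "summable (\<lambda>n. (\<lambda>n. real n ^ Suc k * x ^ n) (Suc n))"
      by (simp add: mult_ac)
    thus ?case by (subst (asm) summable_Suc_iff)
  qed
  from *[OF assms] have "summable (\<lambda>n. (\<lambda>n. real n ^ k * x ^ n) (Suc n))"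
    by (subst summable_Suc_iff)
  thus ?thesis by simp
qed

lemma norm_nome: "norm (nome \<tau>) = exp (- 2 * pi * Im \<tau>)"
  by (simp add: nome_def)

lemma nome_nonzero [simp]: "nome \<tau> \<noteq> 0"
  by (simp add: nome_def)

lemma nome_add: "nome (s + t) = nome s * nome t"
  by (simp add: nome_def algebra_simps exp_add)

lemma nome_of_nat_mult: "nome (of_nat n * t) = nome t ^ n"
  by (simp add: nome_def exp_of_nat_mult[symmetric] mult_ac)

lemma nome_1 [simp]: "nome 1 = 1"
  by (simp add: nome_def)

lemma nome_minus: "nome (- t) = inverse (nome t)"
  by (simp add: nome_def exp_minus)

lemma nome_diff: "nome (s - t) = nome s / nome t"
  using nome_add[of s "-t"] by (simp add: nome_minus field_simps)

lemma norm_nome_less_1: "norm (nome \<tau>) < 1 \<longleftrightarrow> Im \<tau> > 0"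
  by (simp add: norm_nome zero_less_mult_iff)

text \<open>
  The additive twist of \<open>\<sigma>\<^sub>k(n)\<close>: at \<open>z = 0\<close> it is the divisor power sum itself, and each
  derivative in \<open>z\<close> raises \<open>k\<close> by one, up to the factor \<open>2\<pi>\<i>\<close>.
\<close>

definition twisted_divisor_sum :: "nat \<Rightarrow> nat \<Rightarrow> complex \<Rightarrow> complex" where
  "twisted_divisor_sum k n z = (\<Sum>r | r dvd n. of_nat r ^ k * nome (of_nat r * z))"

definition twisted_lambert :: "nat \<Rightarrow> complex \<Rightarrow> complex \<Rightarrow> complex" where
  "twisted_lambert k \<tau> z = suminf (\<lambda>n. twisted_divisor_sum k (Suc n) z * nome \<tau> ^ Suc n)"

lemma norm_twisted_divisor_sum_le:
  assumes "n > 0" "\<bar>Im z\<bar> \<le> K"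
  shows "norm (twisted_divisor_sum k n z) \<le> real n ^ Suc k * exp (2 * pi * K) ^ n"
proof -
  have "norm (twisted_divisor_sum k n z) \<le> (\<Sum>r | r dvd n. norm (of_nat r ^ k * nome (of_nat r * z)))"
    unfolding twisted_divisor_sum_def by (rule norm_sum)
  also have "\<dots> \<le> (\<Sum>r | r dvd n. real n ^ k * exp (2 * pi * K) ^ n)"
  proof (rule sum_mono)
    fix r assume "r \<in> {r. r dvd n}"
    hence r: "r \<le> n" using assms by (auto dest: dvd_imp_le)
    have K: "K \<ge> 0" using assms by linarith
    have eq: "norm (nome (of_nat r * z)) = exp (2 * pi * (r * (- Im z)))"
      by (simp add: norm_nome)
    have "r * (- Im z) \<le> r * K" using assms by (intro mult_left_mono) auto
    also have "r * K \<le> n * K" using r K by (intro mult_right_mono) auto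
    finally have "r * (- Im z) \<le> n * K" .
    hence "exp (2 * pi * (r * (- Im z))) \<le> exp (2 * pi * (n * K))"
      by (subst exp_le_cancel_iff, intro mult_left_mono) auto
    also have "\<dots> = exp (2 * pi * K) ^ n" by (simp add: exp_of_nat_mult[symmetric] mult_ac)
    finally have "norm (nome (of_nat r * z)) \<le> exp (2 * pi * K) ^ n" by (simp only: eq)
    thus "norm (of_nat r ^ k * nome (of_nat r * z)) \<le> real n ^ k * exp (2 * pi * K) ^ n"
      using r by (auto simp: norm_mult norm_power intro!: mult_mono power_mono)
  qed
  also have "\<dots> = card {r. r dvd n} * (real n ^ k * exp (2 * pi * K) ^ n)" by simp
  also have "\<dots> \<le> n * (real n ^ k * exp (2 * pi * K) ^ n)"
  proof (intro mult_right_mono)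
    have "{r. r dvd n} \<subseteq> {1..n}" using assms by (auto dest: dvd_imp_le intro!: Nat.gr0I)
    hence "card {r. r dvd n} \<le> card {1..n}" by (intro card_mono) auto
    thus "real (card {r. r dvd n}) \<le> real n" by simp
  qed auto
  finally show ?thesis by (simp add: mult_ac)
qed

lemma twisted_lambert_majorant:
  assumes "n > 0" "\<bar>Im z\<bar> \<le> K"
  shows "norm (twisted_divisor_sum k n z * nome \<tau> ^ n) \<le>
    real n ^ Suc k * exp (2 * pi * (K - Im \<tau>)) ^ n"
proof -
  have "norm (twisted_divisor_sum k n z * nome \<tau> ^ n) \<le>
      (real n ^ Suc k * exp (2 * pi * K) ^ n) * exp (- 2 * pi * Im \<tau>) ^ n"
    unfolding norm_mult norm_power norm_nome
    by (intro mult_right_mono norm_twisted_divisor_sum_le assms) auto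
  also have "\<dots> = real n ^ Suc k * exp (2 * pi * (K - Im \<tau>)) ^ n"
    by (simp add: power_mult_distrib [symmetric] exp_add [symmetric] algebra_simps)
  finally show ?thesis .
qed

lemma summable_majorant:
  assumes "K < Im \<tau>"
  shows "summable (\<lambda>n. real (Suc n) ^ k * exp (2 * pi * (K - Im \<tau>)) ^ Suc n)"
  by (rule summable_power_times_geometric) (use assms in \<open>auto simp: mult_less_0_iff\<close>)

lemma open_strip: "open {z. \<bar>Im z\<bar> < (c::real)}"
  by (intro open_Collect_less continuous_intros)

text \<open>
  This ladder is why the twist is introduced: the Lambert series of \<open>\<sigma>\<^sub>1, \<sigma>\<^sub>3, \<sigma>\<^sub>5\<close> appear
  as Taylor coefficients of the single function \<open>twisted_lambert 0 \<tau>\<close>.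
\<close>

lemma has_field_derivative_twisted_lambert:
  assumes "\<bar>Im z\<bar> < Im \<tau>"
  shows "(twisted_lambert k \<tau> has_field_derivative 2 * pi * \<i> * twisted_lambert (Suc k) \<tau> z) (at z)"
proof -
  define S where "S = {z. \<bar>Im z\<bar> < Im \<tau>}"
  define f where "f = (\<lambda>k n z. twisted_divisor_sum k (Suc n) z * nome \<tau> ^ Suc n)"
  have S: "open S" unfolding S_def by (rule open_strip)
  have "\<exists>g g'. \<forall>z\<in>S. (\<lambda>n. f k n z) sums g z \<and>
      (\<lambda>n. 2 * pi * \<i> * f (Suc k) n z) sums g' z \<and> (g has_field_derivative g' z) (at z)"
  proof (rule series_and_derivative_comparison_complex[OF S])
    fix n z
    show "(f k n has_field_derivative 2 * pi * \<i> * f (Suc k) n z) (at z)"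
      unfolding f_def twisted_divisor_sum_def nome_def
      by (auto intro!: derivative_eq_intros sum.cong simp: sum_distrib_left sum_distrib_right mult_ac)
  next
    fix z assume z: "z \<in> S"
    define K where "K = (\<bar>Im z\<bar> + Im \<tau>) / 2"
    have K: "\<bar>Im z\<bar> < K" "K < Im \<tau>" using z by (auto simp: K_def S_def)
    define h where "h = (\<lambda>n. complex_of_real (real (Suc n) ^ Suc k * exp (2 * pi * (K - Im \<tau>)) ^ Suc n))"
    show "\<exists>d h. 0 < d \<and> summable h \<and> range h \<subseteq> \<real>\<^sub>\<ge>\<^sub>0 \<and>
       (\<forall>\<^sub>F n in sequentially. \<forall>y\<in>ball z d \<inter> S. cmod (f k n y) \<le> cmod (h n))"
    proof (intro exI conjI always_eventually allI ballI)
      show "0 < K - \<bar>Im z\<bar>" using K by simp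
      show "summable h" unfolding h_def 
        by (intro summable_of_real summable_majorant K)
      show "range h \<subseteq> \<real>\<^sub>\<ge>\<^sub>0" by (auto simp: h_def simp del: of_real_mult of_real_power)
      fix n y assume y: "y \<in> ball z (K - \<bar>Im z\<bar>) \<inter> S"
      have "\<bar>Im (y - z)\<bar> \<le> norm (y - z)" by (rule abs_Im_le_cmod)
      also have "\<dots> < K - \<bar>Im z\<bar>" using y by (simp add: dist_norm norm_minus_commute)
      finally have "\<bar>Im y\<bar> \<le> K" by (simp add: abs_if split: if_splits)
      from twisted_lambert_majorant[OF _ this, of "Suc n" k \<tau>]
      show "cmod (f k n y) \<le> cmod (h n)"
        unfolding f_def h_def norm_of_real by simp
    qed
  qed
  then obtain g g' where g: "\<And>z. z \<in> S \<Longrightarrow> (\<lambda>n. f k n z) sums g z"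
     "\<And>z. z \<in> S \<Longrightarrow> (\<lambda>n. 2 * pi * \<i> * f (Suc k) n z) sums g' z"
     "\<And>z. z \<in> S \<Longrightarrow> (g has_field_derivative g' z) (at z)" by metis
  have geq: "twisted_lambert k \<tau> z = g z" if "z \<in> S" for z
    using g(1)[OF that] by (simp add: twisted_lambert_def f_def sums_iff)
  have zS: "z \<in> S" using assms by (simp add: S_def)
  have "(\<lambda>n. f (Suc k) n z) sums (g' z / (2 * pi * \<i>))"
    using sums_divide[OF g(2)[OF zS], of "2 * pi * \<i>"] by simp
  hence g'eq: "2 * pi * \<i> * twisted_lambert (Suc k) \<tau> z = g' z"
    by (simp add: twisted_lambert_def f_def sums_iff)
  have "(g has_field_derivative 2 * pi * \<i> * twisted_lambert (Suc k) \<tau> z) (at z)"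
    using g(3)[OF zS] g'eq by simp
  thus "(twisted_lambert k \<tau> has_field_derivative 2 * pi * \<i> * twisted_lambert (Suc k) \<tau> z) (at z)"
    by (rule has_field_derivative_transform_within_open[OF _ S zS]) (simp add: geq)
qed

lemma twisted_lambert_0:
  "twisted_lambert k \<tau> 0 = suminf (\<lambda>n. of_nat (divisor_power_sum k (Suc n)) * nome \<tau> ^ Suc n)"
  by (simp add: twisted_lambert_def twisted_divisor_sum_def divisor_power_sum_def nome_def)

lemma holomorphic_twisted_lambert:
  "twisted_lambert k \<tau> holomorphic_on {z. \<bar>Im z\<bar> < Im \<tau>}"
  by (auto simp: holomorphic_on_open[OF open_strip] intro: has_field_derivative_twisted_lambert)

lemma higher_deriv_twisted_lambert:
  assumes "\<bar>Im z\<bar> < Im \<tau>"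
  shows "(deriv ^^ j) (twisted_lambert k \<tau>) z = (2 * pi * \<i>) ^ j * twisted_lambert (k + j) \<tau> z"
  using assms
proof (induction j arbitrary: z)
  case (Suc j)
  have "(deriv ^^ Suc j) (twisted_lambert k \<tau>) z = deriv ((deriv ^^ j) (twisted_lambert k \<tau>)) z" by simp
  also have "\<dots> = deriv (\<lambda>z. (2 * pi * \<i>) ^ j * twisted_lambert (k + j) \<tau> z) z"
    by (rule complex_derivative_transform_within_open[OF _ _ open_strip])
       (use Suc in \<open>auto intro!: holomorphic_intros open_strip holomorphic_twisted_lambert holomorphic_higher_deriv\<close>)
  also have "\<dots> = (2 * pi * \<i>) ^ j * (2 * pi * \<i> * twisted_lambert (Suc (k + j)) \<tau> z)"
    by (intro DERIV_imp_deriv DERIV_cmult has_field_derivative_twisted_lambert Suc.prems)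
  finally show ?case by (simp add: mult_ac)
qed auto

section \<open>The cotangent series\<close>

lemma has_sum_atLeast_1_imp_sums:
  assumes "(f has_sum s) {1::nat..}"
  shows "(\<lambda>n. f (Suc n)) sums s"
proof -
  have "bij_betw Suc UNIV {1..}"
    by (rule bij_betwI[where g = "\<lambda>n. n - 1"]) auto
  from has_sum_reindex_bij_betw[OF this, of f s] assms
  have "((\<lambda>n. f (Suc n)) has_sum s) UNIV" by simp
  thus ?thesis by (rule has_sum_imp_sums)
qed

text \<open>
  Both series are \<open>\<Sum>\<^sub>m\<^sub>,\<^sub>r w\<^sup>r q\<^sup>m\<^sup>r\<close>, summed once along \<open>mr = n\<close> and once over \<open>r\<close> first.
\<close>

lemma divisor_sum_regroup:
  fixes w q :: complex
  assumes q: "norm q < 1" and wq: "norm (w * q) < 1"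
  shows "\<exists>s. (\<lambda>n. (\<Sum>r | r dvd Suc n. w ^ r) * q ^ Suc n) sums s \<and>
             (\<lambda>m. w * q ^ Suc m / (1 - w * q ^ Suc m)) sums s"
proof -
  define F where "F = (\<lambda>(m,r). w ^ r * q ^ (m * r))"
  have wqm: "norm (w * q ^ m) < 1" if "m \<ge> 1" for m
  proof -
    have "norm (w * q ^ m) = norm (w * q) * norm q ^ (m - 1)"
      using that by (cases m) (auto simp: norm_mult norm_power)
    also have "\<dots> \<le> norm (w * q) * 1" using q by (intro mult_left_mono power_le_one) auto
    finally show ?thesis using wq by simp
  qed
  have "(\<lambda>(m,r). norm q ^ (m - 1) * norm (w * q) ^ r) summable_on ({1..} \<times> {1..})"
  proof (rule summable_on_SigmaI)
    fix m :: nat assume "m \<in> {1..}"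
    have "((\<lambda>r. norm (w * q) ^ r) has_sum (norm (w * q) / (1 - norm (w * q)))) {1..}"
      using has_sum_geometric_from_1[of "norm (w * q)"] wq by simp
    thus "((\<lambda>r. case (m, r) of (m, r) \<Rightarrow> norm q ^ (m - 1) * norm (w * q) ^ r) has_sum
            norm q ^ (m - 1) * (norm (w * q) / (1 - norm (w * q)))) {1..}"
      unfolding prod.case by (rule has_sum_cmult_right)
  next
    have "bij_betw Suc UNIV {1..}"
      by (rule bij_betwI[where g = "\<lambda>n. n - 1"]) auto
    moreover have "(\<lambda>n. norm q ^ n) summable_on UNIV"
      by (subst summable_on_UNIV_nonneg_real_iff) (use q in \<open>auto intro: summable_geometric\<close>)
    ultimately have "(\<lambda>m. norm q ^ (m - 1)) summable_on {1..}"
      using summable_on_reindex_bij_betw[of Suc UNIV "{1..}" "\<lambda>m. norm q ^ (m - 1)"] by simp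
    thus "(\<lambda>m. norm q ^ (m - 1) * (norm (w * q) / (1 - norm (w * q)))) summable_on {1..}"
      by (rule summable_on_cmult_left)
  qed auto
  hence "(\<lambda>x. norm (F x)) summable_on ({1..} \<times> {1..})"
  proof (rule Infinite_Sum.abs_summable_on_comparison_test')
    fix x :: "nat \<times> nat" assume "x \<in> {1..} \<times> {1..}"
    then obtain m r where x: "x = (m, r)" "m \<ge> 1" "r \<ge> 1" by auto
    have "norm (F x) = norm (w * q) ^ r * norm q ^ ((m - 1) * r)"
      using x by (cases m) (auto simp: F_def norm_mult norm_power power_mult_distrib power_add)
    also have "\<dots> \<le> norm (w * q) ^ r * norm q ^ (m - 1)"
      using q x by (intro mult_left_mono power_decreasing) auto
    finally show "norm (F x) \<le> (case x of (m, r) \<Rightarrow> norm q ^ (m - 1) * norm (w * q) ^ r)"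
      by (simp add: x mult_ac)
  qed
  hence "F summable_on ({1..} \<times> {1..})" by (rule abs_summable_summable)
  then obtain s where s: "(F has_sum s) ({1..} \<times> {1..})" by (auto simp: summable_on_def)
  have "((\<lambda>m. w * q ^ m / (1 - w * q ^ m)) has_sum s) {1..}"
  proof (rule has_sum_SigmaD[OF s])
    fix m :: nat assume "m \<in> {1..}"
    hence "((\<lambda>r. (w * q ^ m) ^ r) has_sum (w * q ^ m / (1 - w * q ^ m))) {1..}"
      using has_sum_geometric_from_1[of "w * q ^ m"] wqm[of m] by simp
    thus "((\<lambda>r. F (m, r)) has_sum (w * q ^ m / (1 - w * q ^ m))) {1..}"
      by (simp add: F_def power_mult_distrib power_mult)
  qed
  moreover have "((\<lambda>(n, r). w ^ r * q ^ n) has_sum s) (SIGMA n:{1..}. {r. r dvd n})"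
    using s
    by (subst has_sum_reindex_bij_witness[where i = "\<lambda>(m,r). (m * r, r)" and
          j = "\<lambda>(n,r). (n div r, r)" and h = F and T = "{1..} \<times> {1..}" and s' = s])
       (auto simp: F_def Suc_le_eq dvd_div_eq_0_iff intro!: Nat.gr0I)
  hence "((\<lambda>n. (\<Sum>r | r dvd n. w ^ r) * q ^ n) has_sum s) {1..}"
  proof (rule has_sum_SigmaD)
    fix n :: nat assume "n \<in> {1..}"
    thus "((\<lambda>r. case (n, r) of (n, r) \<Rightarrow> w ^ r * q ^ n) has_sum (\<Sum>r | r dvd n. w ^ r) * q ^ n) {r. r dvd n}"
      by (auto simp: sum_distrib_right intro!: has_sum_finiteI)
  qed
  ultimately show ?thesis
    by (intro exI[of _ s] conjI; drule_tac has_sum_atLeast_1_imp_sums; simp)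
qed

text \<open>
  The zeros of the sine are poles; the value 0 that division by zero assigns there is the one that makes
  \<open>pcot\<close> odd everywhere, so the functional equations below hold without exceptions.
\<close>

definition pcot :: "complex \<Rightarrow> complex" where
  "pcot z = of_real pi * cot (of_real pi * z)"

lemma pcot_minus: "pcot (- z) = - pcot z"
  by (simp add: pcot_def cot_def)

lemma pcot_plus_1: "pcot (z + 1) = pcot z"
proof -
  have "sin (of_real pi * (z + 1)) = - sin (of_real pi * z)" "cos (of_real pi * (z + 1)) = - cos (of_real pi * z)"
    by (simp_all add: algebra_simps sin_add cos_add flip: sin_of_real cos_of_real)
  thus ?thesis by (simp add: pcot_def cot_def)
qed

lemma nome_eq_1_iff_sin: "nome z = 1 \<longleftrightarrow> sin (of_real pi * z) = 0"
proof -
  have "sin (of_real pi * z) = (exp (\<i> * (of_real pi * z)) - exp (-\<i> * (of_real pi * z))) / (2 * \<i>)"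
    by (simp add: sin_exp_eq)
  also have "\<dots> = exp (-\<i> * (of_real pi * z)) * (nome z - 1) / (2 * \<i>)"
    by (simp add: nome_def algebra_simps flip: exp_add)
  finally show ?thesis by simp
qed

lemma pcot_eq:
  assumes "nome z \<noteq> 1"
  shows "pcot z = - pi * \<i> - 2 * pi * \<i> * (nome z / (1 - nome z))"
proof -
  define e where "e = exp (\<i> * (of_real pi * z))"
  have e: "e \<noteq> 0" "exp (-\<i> * (of_real pi * z)) = inverse e" "nome z = e ^ 2"
    by (auto simp: e_def exp_minus nome_def exp_double [symmetric] algebra_simps power2_eq_square simp flip: exp_add)
  have e2: "e ^ 2 \<noteq> 1" using assms e by simp
  have "pcot z = pi * (((e + inverse e) / 2) / ((e - inverse e) / (2 * \<i>)))"
    using e(2) unfolding pcot_def cot_def by (simp add: sin_exp_eq cos_exp_eq e_def)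
  also have "\<dots> = pi * \<i> * (e ^ 2 + 1) / (e ^ 2 - 1)"
    using e(1) e2 by (simp add: divide_simps) (simp add: algebra_simps power2_eq_square)
  finally have "pcot z = pi * \<i> * (e ^ 2 + 1) / (e ^ 2 - 1)" .
  thus ?thesis using e2 unfolding e(3) by (simp add: divide_simps) (simp add: algebra_simps)
qed

definition cot_pair :: "complex \<Rightarrow> complex \<Rightarrow> nat \<Rightarrow> complex" where
  "cot_pair \<tau> z m = pcot (z + of_nat (Suc m) * \<tau>) + pcot (z - of_nat (Suc m) * \<tau>)"

text \<open>
  Eisenstein summation: pairing \<open>m\<close> with \<open>-m\<close> makes the series converge geometrically, since the
  cotangent tends to \<open>-\<i>\<close> and to \<open>\<i>\<close> at the two ends of the imaginary axis.
\<close>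

definition cot_sum :: "complex \<Rightarrow> complex \<Rightarrow> complex" where
  "cot_sum \<tau> z = pcot z + suminf (cot_pair \<tau> z)"

lemma cot_pair_eq:
  assumes "nome z * nome \<tau> ^ Suc m \<noteq> 1" "nome (- z) * nome \<tau> ^ Suc m \<noteq> 1"
  shows "cot_pair \<tau> z m = - 2 * pi * \<i> *
    (nome z * nome \<tau> ^ Suc m / (1 - nome z * nome \<tau> ^ Suc m)
     - nome (- z) * nome \<tau> ^ Suc m / (1 - nome (- z) * nome \<tau> ^ Suc m))"
proof -
  have a: "nome (z + of_nat (Suc m) * \<tau>) = nome z * nome \<tau> ^ Suc m"
    "nome (- z + of_nat (Suc m) * \<tau>) = nome (- z) * nome \<tau> ^ Suc m"
    by (simp_all only: nome_add nome_of_nat_mult)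
  have "pcot (z - of_nat (Suc m) * \<tau>) = - pcot (- z + of_nat (Suc m) * \<tau>)"
    using pcot_minus[of "- z + of_nat (Suc m) * \<tau>"] by simp
  moreover have "pcot (z + of_nat (Suc m) * \<tau>) = - pi * \<i> - 2 * pi * \<i> *
      (nome z * nome \<tau> ^ Suc m / (1 - nome z * nome \<tau> ^ Suc m))"
    using pcot_eq[of "z + of_nat (Suc m) * \<tau>"] assms unfolding a by blast
  moreover have "pcot (- z + of_nat (Suc m) * \<tau>) = - pi * \<i> - 2 * pi * \<i> *
      (nome (- z) * nome \<tau> ^ Suc m / (1 - nome (- z) * nome \<tau> ^ Suc m))"
    using pcot_eq[of "- z + of_nat (Suc m) * \<tau>"] assms unfolding a by blast
  ultimately show ?thesis unfolding cot_pair_def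
    by (simp only: right_diff_distrib) (simp del: power_Suc)
qed

lemma nome_power_tendsto_0:
  assumes "Im \<tau> > 0"
  shows "(\<lambda>m. c * nome \<tau> ^ m) \<longlonglongrightarrow> 0"
  using assms by (auto intro!: tendsto_mult_right_zero LIMSEQ_power_zero simp: norm_nome_less_1)

lemma pcot_tendsto:
  assumes "Im \<tau> > 0"
  shows "(\<lambda>m. pcot (z + of_nat m * \<tau>)) \<longlonglongrightarrow> - pi * \<i>"
proof -
  have lim: "(\<lambda>m. nome z * nome \<tau> ^ m) \<longlonglongrightarrow> 0" by (rule nome_power_tendsto_0[OF assms])
  have "eventually (\<lambda>m. nome z * nome \<tau> ^ m \<noteq> 1) sequentially"
    by (rule tendsto_imp_eventually_ne[OF lim]) simp
  hence ev: "eventually (\<lambda>m. - pi * \<i> - 2 * pi * \<i> * (nome z * nome \<tau> ^ m / (1 - nome z * nome \<tau> ^ m)) =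
       pcot (z + of_nat m * \<tau>)) sequentially"
    by eventually_elim (simp add: pcot_eq nome_add nome_of_nat_mult)
  have "(\<lambda>m. - pi * \<i> - 2 * pi * \<i> * (nome z * nome \<tau> ^ m / (1 - nome z * nome \<tau> ^ m)))
     \<longlonglongrightarrow> - pi * \<i> - 2 * pi * \<i> * (0 / (1 - 0))"
    by (intro tendsto_intros lim) auto
  with ev show ?thesis by (simp add: tendsto_cong)
qed

lemma summable_cot_pair:
  assumes "Im \<tau> > 0"
  shows "summable (cot_pair \<tau> z)"
proof -
  have *: "summable (\<lambda>m. c * nome \<tau> ^ Suc m / (1 - c * nome \<tau> ^ Suc m))" for c
  proof (rule summable_comparison_test_ev)
    have "(\<lambda>m. c * nome \<tau> ^ Suc m) \<longlonglongrightarrow> 0"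
      using nome_power_tendsto_0[OF assms, of c] by (rule LIMSEQ_Suc)
    hence "eventually (\<lambda>m. norm (c * nome \<tau> ^ Suc m) < 1 / 2) sequentially"
      by (auto simp: tendsto_iff dist_norm dest!: spec[of _ "1/2"])
    thus "eventually (\<lambda>m. norm (c * nome \<tau> ^ Suc m / (1 - c * nome \<tau> ^ Suc m)) \<le>
       2 * norm c * norm (nome \<tau>) ^ Suc m) sequentially"
    proof eventually_elim
      case (elim m)
      have "1 / 2 \<le> norm (1 - c * nome \<tau> ^ Suc m)"
        using elim norm_triangle_ineq2[of 1 "c * nome \<tau> ^ Suc m"] by simp
      hence "norm (c * nome \<tau> ^ Suc m) / norm (1 - c * nome \<tau> ^ Suc m) \<le> norm (c * nome \<tau> ^ Suc m) / (1 / 2)"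
        by (intro divide_left_mono) auto
      thus ?case by (simp add: norm_divide norm_mult norm_power mult_ac)
    qed
    show "summable (\<lambda>m. 2 * norm c * norm (nome \<tau>) ^ Suc m)"
      using assms by (intro summable_mult) (auto simp: norm_nome_less_1 summable_Suc_iff summable_geometric)
  qed
  have "eventually (\<lambda>m. c * nome \<tau> ^ Suc m \<noteq> 1) sequentially" for c
    by (rule tendsto_imp_eventually_ne[OF LIMSEQ_Suc[OF nome_power_tendsto_0[OF assms]]]) simp
  from this[of "nome z"] this[of "nome (- z)"]
  have "eventually (\<lambda>m. cot_pair \<tau> z m = - 2 * pi * \<i> *
    (nome z * nome \<tau> ^ Suc m / (1 - nome z * nome \<tau> ^ Suc m)
     - nome (- z) * nome \<tau> ^ Suc m / (1 - nome (- z) * nome \<tau> ^ Suc m))) sequentially"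
    by eventually_elim (rule cot_pair_eq)
  from summable_cong[OF this] show ?thesis
    using summable_mult[OF summable_diff[OF *[of "nome z"] *[of "nome (- z)"]]] by blast
qed

lemma cot_sum_plus_1: "cot_sum \<tau> (z + 1) = cot_sum \<tau> z"
proof -
  have "cot_pair \<tau> (z + 1) = cot_pair \<tau> z"
  proof
    fix m
    have "z + 1 + of_nat (Suc m) * \<tau> = z + of_nat (Suc m) * \<tau> + 1"
         "z + 1 - of_nat (Suc m) * \<tau> = z - of_nat (Suc m) * \<tau> + 1" by simp_all
    thus "cot_pair \<tau> (z + 1) m = cot_pair \<tau> z m"
      unfolding cot_pair_def by (simp only: pcot_plus_1)
  qed
  thus ?thesis by (simp add: cot_sum_def pcot_plus_1)
qed

lemma cot_sum_0: "cot_sum \<tau> 0 = 0"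
  using pcot_minus[of 0] by (simp add: cot_sum_def cot_pair_def [abs_def] pcot_minus)

text \<open>
  Shifting by \<open>\<tau>\<close> moves the symmetric partial sums by one term at either end; these two terms tend to
  \<open>-\<pi>\<i>\<close> each.
\<close>

lemma cot_sum_plus_tau:
  assumes "Im \<tau> > 0"
  shows "cot_sum \<tau> (z + \<tau>) = cot_sum \<tau> z - 2 * pi * \<i>"
proof -
  define S where "S = (\<lambda>z M. pcot z + (\<Sum>m<M. cot_pair \<tau> z m))"
  have lim: "S z \<longlonglongrightarrow> cot_sum \<tau> z" for z
    unfolding S_def cot_sum_def by (intro tendsto_intros summable_LIMSEQ summable_cot_pair assms)
  have eq: "S (z + \<tau>) M = S z M + pcot ((z + \<tau>) + of_nat M * \<tau>) + pcot (- z + of_nat M * \<tau>)" for M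
  proof (induction M)
    case 0
    show ?case by (simp add: S_def pcot_minus)
  next
    case (Suc M)
    have a: "z + \<tau> + of_nat (Suc M) * \<tau> = z + \<tau> + of_nat M * \<tau> + \<tau>"
      "z + \<tau> - of_nat (Suc M) * \<tau> = - (- z + of_nat M * \<tau>)"
      "z - of_nat (Suc M) * \<tau> = - (- z + of_nat (Suc M) * \<tau>)"
      "z + of_nat (Suc M) * \<tau> = z + \<tau> + of_nat M * \<tau>"
      by (simp_all add: algebra_simps)
    have "S (z + \<tau>) (Suc M) = S (z + \<tau>) M + cot_pair \<tau> (z + \<tau>) M" by (simp add: S_def)
    also have "cot_pair \<tau> (z + \<tau>) M = pcot (z + \<tau> + of_nat (Suc M) * \<tau>) - pcot (- z + of_nat M * \<tau>)"
      unfolding cot_pair_def by (simp only: a(2) pcot_minus) simp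
    also have "S (z + \<tau>) M = S z M + pcot (z + \<tau> + of_nat M * \<tau>) + pcot (- z + of_nat M * \<tau>)"
      by (rule Suc)
    also have "S z M = S z (Suc M) - cot_pair \<tau> z M" by (simp add: S_def)
    also have "cot_pair \<tau> z M = pcot (z + \<tau> + of_nat M * \<tau>) - pcot (- z + of_nat (Suc M) * \<tau>)"
      unfolding cot_pair_def by (simp only: a(3,4) pcot_minus) simp
    finally show ?case by simp
  qed
  have "(\<lambda>M. S z M + pcot ((z + \<tau>) + of_nat M * \<tau>) + pcot (- z + of_nat M * \<tau>)) \<longlonglongrightarrow>
      cot_sum \<tau> z + (- pi * \<i>) + (- pi * \<i>)"
    by (intro tendsto_add lim pcot_tendsto assms)
  moreover have "S (z + \<tau>) = (\<lambda>M. S z M + pcot ((z + \<tau>) + of_nat M * \<tau>) + pcot (- z + of_nat M * \<tau>))"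
    using eq by blast
  ultimately have "cot_sum \<tau> (z + \<tau>) = cot_sum \<tau> z + (- pi * \<i>) + (- pi * \<i>)"
    using lim[of "z + \<tau>"] LIMSEQ_unique by metis
  thus ?thesis by simp
qed

text \<open>
  Near the real axis every paired term can be expanded geometrically in the nome, which turns the series into
  a Lambert series.
\<close>

lemma cot_sum_strip:
  assumes "\<bar>Im z\<bar> < Im \<tau>"
  shows "cot_sum \<tau> z = pcot z - 2 * pi * \<i> * (twisted_lambert 0 \<tau> z - twisted_lambert 0 \<tau> (- z))"
proof -
  have tau: "Im \<tau> > 0" using assms by simp
  have *: "(\<lambda>m. nome u * nome \<tau> ^ Suc m / (1 - nome u * nome \<tau> ^ Suc m)) sums twisted_lambert 0 \<tau> u"
    and **: "\<And>m. nome u * nome \<tau> ^ Suc m \<noteq> 1"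
    if u: "\<bar>Im u\<bar> < Im \<tau>" for u
  proof -
    have "norm (nome u * nome \<tau>) < 1"
      using norm_nome_less_1[of "u + \<tau>"] u by (simp add: nome_add)
    then obtain s where s: "(\<lambda>n. (\<Sum>r | r dvd Suc n. nome u ^ r) * nome \<tau> ^ Suc n) sums s"
      "(\<lambda>m. nome u * nome \<tau> ^ Suc m / (1 - nome u * nome \<tau> ^ Suc m)) sums s"
      using divisor_sum_regroup[of "nome \<tau>" "nome u"] tau by (auto simp: norm_nome_less_1)
    from s(1) have "s = twisted_lambert 0 \<tau> u"
      by (simp add: twisted_lambert_def twisted_divisor_sum_def sums_iff nome_of_nat_mult)
    thus "(\<lambda>m. nome u * nome \<tau> ^ Suc m / (1 - nome u * nome \<tau> ^ Suc m)) sums twisted_lambert 0 \<tau> u"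
      using s(2) by simp
    fix m
    have "norm (nome u * nome \<tau> ^ Suc m) < 1"
    proof -
      have "Im \<tau> + Im u > 0" "Im \<tau> * real m \<ge> 0" using u tau by auto
      hence "Im (u + of_nat (Suc m) * \<tau>) > 0" by (simp add: algebra_simps)
      thus ?thesis using norm_nome_less_1[of "u + of_nat (Suc m) * \<tau>"]
        by (simp only: nome_add nome_of_nat_mult)
    qed
    thus "nome u * nome \<tau> ^ Suc m \<noteq> 1" by auto
  qed
  have "(\<lambda>m. - 2 * pi * \<i> *
    (nome z * nome \<tau> ^ Suc m / (1 - nome z * nome \<tau> ^ Suc m)
     - nome (- z) * nome \<tau> ^ Suc m / (1 - nome (- z) * nome \<tau> ^ Suc m))) sums
     (- 2 * pi * \<i> * (twisted_lambert 0 \<tau> z - twisted_lambert 0 \<tau> (- z)))"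
    using assms by (intro sums_mult sums_diff *) auto
  also have "(\<lambda>m. - 2 * pi * \<i> *
    (nome z * nome \<tau> ^ Suc m / (1 - nome z * nome \<tau> ^ Suc m)
     - nome (- z) * nome \<tau> ^ Suc m / (1 - nome (- z) * nome \<tau> ^ Suc m))) = cot_pair \<tau> z"
    using assms by (intro ext cot_pair_eq[symmetric] **) auto
  finally show ?thesis by (simp add: cot_sum_def sums_iff)
qed

section \<open>Inversion formulas for the Eisenstein series\<close>

text \<open>
  At \<open>z = 0\<close> both terms are 0 by convention, which is also the value of the holomorphic extension.
\<close>

definition cot_regular :: "complex \<Rightarrow> complex" where
  "cot_regular z = pcot z - 1 / z"

definition cot_domain :: "complex set" where
  "cot_domain = {z. z = 0 \<or> nome z \<noteq> 1}"

lemma cot_regular_0 [simp]: "cot_regular 0 = 0"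
  by (simp add: cot_regular_def pcot_def cot_def)

text \<open>
  The singularity at 0 is removed by writing the function as a quotient of entire functions: the numerator
  \<open>\<pi> cos \<pi>z - sin(\<pi>z)/z\<close> is even and vanishes at 0, so it is divisible by \<open>z\<close> with quotient vanishing at 0.
\<close>

lemma cot_regular_holomorphic:
  "open cot_domain" "cot_regular holomorphic_on cot_domain"
proof -
  define s where "s = (\<lambda>z::complex. if z = 0 then of_real pi else sin (of_real pi * z) / z)"
  define t where "t = (\<lambda>z. of_real pi * cos (of_real pi * z) - s z)"
  define t1 where "t1 = (\<lambda>z. if z = 0 then 0 else t z / z)"
  have s_holo: "s holomorphic_on UNIV"
  proof (rule pole_theorem_open_0[where g = "\<lambda>z. sin (of_real pi * z)" and a = 0])
    have "((\<lambda>z. sin (of_real pi * z)) has_field_derivative of_real pi) (at (0::complex))"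
      by (auto intro!: derivative_eq_intros)
    thus "s 0 = deriv (\<lambda>z. sin (of_real pi * z)) 0"
      by (simp add: s_def DERIV_imp_deriv)
  qed (auto simp: s_def intro!: holomorphic_intros)
  have t_holo: "t holomorphic_on UNIV"
    unfolding t_def by (intro holomorphic_intros holomorphic_on_subset[OF s_holo]) auto
  have t_even: "t (- z) = t z" for z by (simp add: t_def s_def)
  obtain t' where t': "(t has_field_derivative t') (at 0)"
    using t_holo by (auto simp: holomorphic_on_open)
  have "((\<lambda>z. t (- z)) has_field_derivative t' * (-1)) (at 0)"
    by (rule DERIV_chain2[of t t' "\<lambda>z. - z" 0]) (use t' in \<open>auto intro!: derivative_eq_intros\<close>)
  hence "(t has_field_derivative - t') (at 0)" by (simp add: t_even)
  hence "t' = - t'" using DERIV_unique[OF t'] by blast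
  hence "t' = 0" by simp
  have t1_holo: "t1 holomorphic_on UNIV"
    by (rule pole_theorem_open_0[where g = t and a = 0])
       (use t_holo \<open>t' = 0\<close> t' in \<open>auto simp: t1_def DERIV_imp_deriv t_def s_def\<close>)
  have dom: "cot_domain = {z. s z \<noteq> 0}"
    by (auto simp: cot_domain_def s_def nome_eq_1_iff_sin)
  show "open cot_domain"
    unfolding dom by (intro open_Collect_neq holomorphic_on_imp_continuous_on s_holo continuous_intros)
  have "(\<lambda>z. t1 z / s z) holomorphic_on cot_domain"
    unfolding dom by (intro holomorphic_intros holomorphic_on_subset[OF s_holo] holomorphic_on_subset[OF t1_holo]) auto
  moreover have "t1 z / s z = cot_regular z" if "z \<in> cot_domain" for z
  proof (cases "z = 0")
    case False
    hence "s z \<noteq> 0" "sin (of_real pi * z) = z * s z" using that by (auto simp: dom s_def)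
    thus ?thesis using False
      by (simp add: cot_regular_def pcot_def cot_def t1_def t_def field_simps)
  qed (simp add: t1_def)
  ultimately show "cot_regular holomorphic_on cot_domain"
    using holomorphic_cong[of cot_domain cot_domain "\<lambda>z. t1 z / s z" cot_regular] by auto
qed

lemma pcot_deriv:
  assumes "nome z \<noteq> 1"
  shows "(pcot has_field_derivative - (of_real pi ^ 2 + pcot z ^ 2)) (at z)"
proof -
  have *: "sin (of_real pi * z) \<noteq> 0" using assms by (simp add: nome_eq_1_iff_sin)
  have "cos (of_real pi * z) ^ 2 = 1 - sin (of_real pi * z) ^ 2" by (rule cos_squared_eq)
  hence c: "cot (of_real pi * z) ^ 2 = inverse (sin (of_real pi * z) ^ 2) - 1"
    using * by (simp add: cot_def power_divide field_simps)
  have "((\<lambda>z. of_real pi * cot (of_real pi * z)) has_field_derivative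
      of_real pi * (- inverse (sin (of_real pi * z) ^ 2) * of_real pi)) (at z)"
    by (intro DERIV_cmult DERIV_chain2[OF DERIV_cot]) (use * in \<open>auto intro!: derivative_eq_intros\<close>)
  moreover have "of_real pi * (- inverse (sin (of_real pi * z) ^ 2) * of_real pi) =
      - (of_real pi ^ 2 + pcot z ^ 2)"
    unfolding pcot_def power_mult_distrib c by (simp add: algebra_simps power2_eq_square)
  ultimately show ?thesis by (simp add: pcot_def [abs_def])
qed

text \<open>
  The Riccati equation \<open>pcot' = -(\<pi>\<^sup>2 + pcot\<^sup>2)\<close> determines the expansion of the regular part
  recursively.
\<close>

lemma cot_regular_coeffs:
  "(deriv ^^ 1) cot_regular 0 = - (of_real pi ^ 2) / 3"
  "(deriv ^^ 3) cot_regular 0 = - 2 * of_real pi ^ 4 / 15"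
  "(deriv ^^ 5) cot_regular 0 = - 16 * of_real pi ^ 6 / 63"
proof -
  define F where "F = fps_expansion cot_regular 0"
  have 0: "0 \<in> cot_domain" by (simp add: cot_domain_def)
  have F: "cot_regular has_fps_expansion F"
    unfolding F_def by (rule has_fps_expansion_fps_expansion[OF cot_regular_holomorphic(1) 0 cot_regular_holomorphic(2)])
  have "z * deriv cot_regular z + 2 * cot_regular z = - z * (of_real pi ^ 2 + cot_regular z * cot_regular z)"
    if "z \<in> cot_domain" for z
  proof (cases "z = 0")
    case False
    hence "nome z \<noteq> 1" using that by (auto simp: cot_domain_def)
    hence "(cot_regular has_field_derivative - (of_real pi ^ 2 + pcot z ^ 2) + 1 / z ^ 2) (at z)"
      unfolding cot_regular_def [abs_def] using False
      by (auto intro!: derivative_eq_intros pcot_deriv simp: power2_eq_square)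
    from DERIV_imp_deriv[OF this] have "deriv cot_regular z = - (of_real pi ^ 2 + pcot z ^ 2) + 1 / z ^ 2" .
    thus ?thesis using False
      by (simp add: cot_regular_def divide_simps) (simp add: algebra_simps power2_eq_square)
  qed simp
  hence ev: "eventually (\<lambda>z. z * deriv cot_regular z + 2 * cot_regular z =
       - z * (of_real pi ^ 2 + cot_regular z * cot_regular z)) (nhds 0)"
    using cot_regular_holomorphic(1) 0 by (auto simp: eventually_nhds)
  have "(\<lambda>z. z * deriv cot_regular z + 2 * cot_regular z) has_fps_expansion
      fps_X * fps_deriv F + fps_const 2 * F"
    by (intro fps_expansion_intros F)
  moreover have "(\<lambda>z. - z * (of_real pi ^ 2 + cot_regular z * cot_regular z)) has_fps_expansion
      - fps_X * (fps_const (of_real pi ^ 2) + F * F)"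
    by (intro fps_expansion_intros F)
  ultimately have eq: "fps_X * fps_deriv F + fps_const 2 * F = - fps_X * (fps_const (of_real pi ^ 2) + F * F)"
    using has_fps_expansion_cong[OF ev refl] fps_expansion_unique_complex by (metis (no_types, lifting))
  define G where "G = fps_const (complex_of_real pi ^ 2) + F * F"
  have nth: "of_nat (n + 3) * fps_nth F (Suc n) =
      - ((if n = 0 then of_real pi ^ 2 else 0) + (\<Sum>i=0..n. fps_nth F i * fps_nth F (n - i)))" for n
  proof -
    have "of_nat (n + 3) * fps_nth F (Suc n) = - fps_nth G n"
      using arg_cong[OF eq, of "\<lambda>F. fps_nth F (Suc n)"] unfolding G_def [symmetric]
      by (simp add: algebra_simps)
    thus ?thesis by (simp add: G_def fps_mult_nth)
  qed
  have F0: "fps_nth F 0 = 0" using fps_nth_fps_expansion[OF F, of 0] by simp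
  have F1: "fps_nth F 1 = - (of_real pi ^ 2) / 3" using nth[of 0] F0 by (simp add: field_simps)
  have F2: "fps_nth F 2 = 0" using nth[of 1] F0 by (simp add: numeral_2_eq_2)
  have "5 * fps_nth F 3 = - (fps_nth F 1 * fps_nth F 1)"
    using nth[of 2] F0 F2 by (simp add: eval_nat_numeral)
  hence F3: "fps_nth F 3 = - (of_real pi ^ 4) / 45"
    unfolding F1 by (simp add: field_simps eval_nat_numeral)
  have F4: "fps_nth F 4 = 0" using nth[of 3] F0 F1 F2 by (simp add: eval_nat_numeral)
  have "7 * fps_nth F 5 = - (2 * fps_nth F 1 * fps_nth F 3)"
    using nth[of 4] F0 F2 F4 by (simp add: eval_nat_numeral)
  hence F5: "fps_nth F 5 = - 2 * (of_real pi ^ 6) / 945"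
    unfolding F1 F3 by (simp add: field_simps eval_nat_numeral)
  have D: "(deriv ^^ n) cot_regular 0 = fact n * fps_nth F n" for n
    using fps_nth_fps_expansion[OF F, of n] by simp
  show "(deriv ^^ 1) cot_regular 0 = - (of_real pi ^ 2) / 3"
    "(deriv ^^ 3) cot_regular 0 = - 2 * of_real pi ^ 4 / 15"
    "(deriv ^^ 5) cot_regular 0 = - 16 * of_real pi ^ 6 / 63"
    unfolding D by (simp_all only: F1 F3 F5) (simp_all add: fact_numeral)
qed

text \<open>
  The regular part of the cotangent series at 0, in the form in which its Taylor coefficients can be
  read off.
\<close>

definition cot_sum_regular :: "complex \<Rightarrow> complex \<Rightarrow> complex" where
  "cot_sum_regular \<tau> z = cot_regular z - 2 * pi * \<i> * (twisted_lambert 0 \<tau> z - twisted_lambert 0 \<tau> (- z))"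

lemma cot_sum_eq_regular:
  assumes "\<bar>Im z\<bar> < Im \<tau>"
  shows "cot_sum \<tau> z = 1 / z + cot_sum_regular \<tau> z"
  using cot_sum_strip[OF assms] by (simp add: cot_sum_regular_def cot_regular_def)

lemma holomorphic_cot_sum_regular:
  assumes "S \<subseteq> cot_domain" "S \<subseteq> {z. \<bar>Im z\<bar> < Im \<tau>}"
  shows "cot_sum_regular \<tau> holomorphic_on S"
proof -
  have "twisted_lambert 0 \<tau> \<circ> uminus holomorphic_on S"
    by (rule holomorphic_on_compose)
       (use assms in \<open>auto intro!: holomorphic_on_minus holomorphic_on_id holomorphic_on_subset[OF holomorphic_twisted_lambert]\<close>)
  hence 1: "(\<lambda>z. twisted_lambert 0 \<tau> (- z)) holomorphic_on S" by (simp add: o_def)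
  have 2: "cot_regular holomorphic_on S" "twisted_lambert 0 \<tau> holomorphic_on S"
    using assms holomorphic_on_subset[OF cot_regular_holomorphic(2)]
      holomorphic_on_subset[OF holomorphic_twisted_lambert] by blast+
  show ?thesis unfolding cot_sum_regular_def [abs_def]
    by (intro holomorphic_on_diff holomorphic_on_mult holomorphic_on_const 1 2)
qed

lemma higher_deriv_cot_sum_regular:
  assumes "Im \<tau> > 0" "odd n"
  shows "(deriv ^^ n) (cot_sum_regular \<tau>) 0 =
    (deriv ^^ n) cot_regular 0 - 2 * (2 * pi * \<i>) ^ Suc n * twisted_lambert n \<tau> 0"
proof -
  define S where "S = cot_domain \<inter> {z. \<bar>Im z\<bar> < Im \<tau>}"
  have S: "open S" "0 \<in> S" unfolding S_def using assms
    by (intro open_Int cot_regular_holomorphic open_strip) (simp add: cot_domain_def assms)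
  define T where "T = twisted_lambert 0 \<tau>"
  have T: "T holomorphic_on {z. \<bar>Im z\<bar> < Im \<tau>}" unfolding T_def by (rule holomorphic_twisted_lambert)
  have "T \<circ> uminus holomorphic_on S"
    by (rule holomorphic_on_compose)
       (auto simp: S_def intro!: holomorphic_intros holomorphic_on_subset[OF T])
  hence T': "(\<lambda>z. T (- z)) holomorphic_on S" by (simp add: o_def)
  have T2: "T holomorphic_on S" by (rule holomorphic_on_subset[OF T]) (auto simp: S_def)
  have C: "cot_regular holomorphic_on S"
    by (rule holomorphic_on_subset[OF cot_regular_holomorphic(2)]) (auto simp: S_def)
  have "(deriv ^^ n) (\<lambda>z. T (-1 * z)) 0 = (-1) ^ n * (deriv ^^ n) T (-1 * 0)"
    by (rule higher_deriv_compose_linear[OF T S(1) open_strip S(2)]) (auto simp: S_def)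
  hence Tm: "(deriv ^^ n) (\<lambda>z. T (- z)) 0 = - (deriv ^^ n) T 0" using assms by simp
  have "(deriv ^^ n) (\<lambda>z. cot_regular z - (2 * pi * \<i>) * (T z - T (- z))) 0 =
      (deriv ^^ n) cot_regular 0 - (2 * pi * \<i>) * ((deriv ^^ n) T 0 - (deriv ^^ n) (\<lambda>z. T (- z)) 0)"
    by (subst higher_deriv_diff[OF _ _ S] higher_deriv_cmult[OF _ S(2,1)],
        (intro holomorphic_intros C T2 T')+)+ simp
  also have "\<dots> = (deriv ^^ n) cot_regular 0 - 2 * (2 * pi * \<i>) ^ Suc n * twisted_lambert n \<tau> 0"
    unfolding Tm unfolding T_def using assms by (simp add: higher_deriv_twisted_lambert)
  finally show ?thesis by (simp add: cot_sum_regular_def [abs_def] T_def)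
qed

lemma Im_minus_inverse: "Im (- 1 / \<tau>) = Im \<tau> / norm \<tau> ^ 2"
  by (simp add: Im_divide cmod_def power2_eq_square)

lemma Im_minus_inverse_pos: "Im \<tau> > 0 \<Longrightarrow> Im (- 1 / \<tau>) > 0"
  unfolding Im_minus_inverse by (intro divide_pos_pos) (auto simp: complex_eq_iff)

text \<open>
  The open parallelogram of the points \<open>s + t\<tau>\<close> with \<open>\<bar>s\<bar>, \<bar>t\<bar> < 1\<close>
  (\<open>period_cell_lattice_coords\<close>), described so that both \<open>z\<close> and \<open>z/\<tau>\<close> are in the strip in which
  \<open>cot_sum_strip\<close> applies.
\<close>

definition period_cell :: "complex \<Rightarrow> complex set" where
  "period_cell \<tau> = {z. \<bar>Im z\<bar> < Im \<tau>} \<inter> {z. \<bar>Im (z / \<tau>)\<bar> < Im (- 1 / \<tau>)}"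

lemma nome_eq_1_iff: "nome z = 1 \<longleftrightarrow> (\<exists>n::int. z = of_int n)"
proof -
  have "nome z = 1 \<longleftrightarrow> (Re (2 * pi * \<i> * z) = 0 \<and> (\<exists>n::int. Im (2 * pi * \<i> * z) = real_of_int (2 * n) * pi))"
    by (simp add: nome_def exp_eq_1)
  also have "\<dots> \<longleftrightarrow> (\<exists>n::int. z = of_int n)"
    by (auto simp: complex_eq_iff)
  finally show ?thesis .
qed

lemma period_cell_lattice_coords:
  assumes "Im \<tau> > 0"
  shows "of_real s + of_real t * \<tau> \<in> period_cell \<tau> \<longleftrightarrow> \<bar>s\<bar> < 1 \<and> \<bar>t\<bar> < 1"
proof -
  have tau: "\<tau> \<noteq> 0" using assms by auto
  have lin: "Im (of_real a * w + of_real b) = a * Im w" for a b w by simp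
  have "(of_real s + of_real t * \<tau>) / \<tau> = of_real (-s) * (- 1 / \<tau>) + of_real t"
    using tau by (simp add: field_simps)
  hence "Im ((of_real s + of_real t * \<tau>) / \<tau>) = Im (of_real (-s) * (- 1 / \<tau>) + of_real t)" by (rule arg_cong)
  also have "\<dots> = - s * Im (- 1 / \<tau>)"
    using lin[of "- s" "- 1 / \<tau>" t] .
  finally have "Im ((of_real s + of_real t * \<tau>) / \<tau>) = - s * Im (- 1 / \<tau>)" .
  hence "\<bar>Im ((of_real s + of_real t * \<tau>) / \<tau>)\<bar> < Im (- 1 / \<tau>) \<longleftrightarrow> \<bar>s\<bar> < 1"
    using Im_minus_inverse_pos[OF assms] by (simp add: abs_mult)
  moreover have "\<bar>Im (of_real s + of_real t * \<tau>)\<bar> < Im \<tau> \<longleftrightarrow> \<bar>t\<bar> < 1"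
    using assms by (simp add: abs_mult)
  ultimately show ?thesis by (auto simp: period_cell_def)
qed

lemma open_period_cell: "open (period_cell \<tau>)"
  unfolding period_cell_def divide_inverse
  by (intro open_Int open_strip open_Collect_less continuous_intros)

lemma period_cell_subset_cot_domain:
  assumes "Im \<tau> > 0"
  shows "period_cell \<tau> \<subseteq> cot_domain" "(\<lambda>z. z / \<tau>) ` period_cell \<tau> \<subseteq> cot_domain"
proof -
  have tau: "\<tau> \<noteq> 0" using assms by auto
  show "period_cell \<tau> \<subseteq> cot_domain"
  proof
    fix z assume z: "z \<in> period_cell \<tau>"
    show "z \<in> cot_domain"
    proof (cases "nome z = 1")
      case True
      then obtain n :: int where "z = of_int n" by (auto simp: nome_eq_1_iff)
      hence "z = of_real (of_int n) + of_real 0 * \<tau>" by simp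
      with z have "\<bar>real_of_int n\<bar> < 1" using period_cell_lattice_coords[OF assms] by metis
      hence "n = 0" by linarith
      thus ?thesis by (simp add: \<open>z = of_int n\<close> cot_domain_def)
    qed (simp add: cot_domain_def)
  qed
  show "(\<lambda>z. z / \<tau>) ` period_cell \<tau> \<subseteq> cot_domain"
  proof safe
    fix z assume z: "z \<in> period_cell \<tau>"
    show "z / \<tau> \<in> cot_domain"
    proof (cases "nome (z / \<tau>) = 1")
      case True
      then obtain n :: int where "z / \<tau> = of_int n" by (auto simp: nome_eq_1_iff)
      hence "z = of_real 0 + of_real (of_int n) * \<tau>" using tau by (simp add: field_simps)
      with z have "\<bar>real_of_int n\<bar> < 1" using period_cell_lattice_coords[OF assms] by metis
      hence "n = 0" by linarith
      thus ?thesis by (simp add: \<open>z / \<tau> = of_int n\<close> cot_domain_def)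
    qed (simp add: cot_domain_def)
  qed
qed

text \<open>
  The poles of the two series at 0 cancel.  This needs no separate treatment of \<open>z = 0\<close>, where the
  convention for division by zero removes both principal parts.
\<close>

lemma cot_sum_inversion_cell:
  assumes "Im \<tau> > 0"
  defines "W \<equiv> (\<lambda>z. cot_sum \<tau> z - cot_sum (- 1 / \<tau>) (z / \<tau>) / \<tau> + 2 * pi * \<i> / \<tau> * z)"
  defines "V \<equiv> (\<lambda>z. cot_sum_regular \<tau> z - cot_sum_regular (- 1 / \<tau>) (inverse \<tau> * z) / \<tau> + 2 * pi * \<i> / \<tau> * z)"
  shows "V holomorphic_on period_cell \<tau>" "\<And>z. z \<in> period_cell \<tau> \<Longrightarrow> W z = V z"
proof -
  have tau: "\<tau> \<noteq> 0" using assms by auto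
  have "cot_sum_regular (- 1 / \<tau>) \<circ> (\<lambda>z. z / \<tau>) holomorphic_on period_cell \<tau>"
    using period_cell_subset_cot_domain(2)[OF assms(1)]
    by (intro holomorphic_on_compose holomorphic_cot_sum_regular)
       (auto simp: period_cell_def tau intro!: holomorphic_intros)
  moreover have "cot_sum_regular \<tau> holomorphic_on period_cell \<tau>"
    by (rule holomorphic_cot_sum_regular[OF period_cell_subset_cot_domain(1)[OF assms(1)]])
       (auto simp: period_cell_def)
  ultimately show "V holomorphic_on period_cell \<tau>"
    unfolding V_def using tau by (auto intro!: holomorphic_intros simp: o_def field_simps)
  fix z assume z: "z \<in> period_cell \<tau>"
  hence "cot_sum \<tau> z = 1 / z + cot_sum_regular \<tau> z"
    "cot_sum (- 1 / \<tau>) (z / \<tau>) = 1 / (z / \<tau>) + cot_sum_regular (- 1 / \<tau>) (z / \<tau>)"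
    by (intro cot_sum_eq_regular; simp add: period_cell_def)+
  thus "W z = V z" using tau by (simp add: W_def V_def field_simps)
qed

text \<open>
  The linear term is chosen so that the difference \<open>W\<close> of both sides has period 1, as well as period \<open>\<tau>\<close>.
  The cell contains a compact set of representatives for the lattice, so \<open>W\<close> is entire and
  bounded.  Liouville's theorem makes it constant, and \<open>W(0) = 0\<close>.
\<close>

theorem cot_sum_inversion:
  assumes "Im \<tau> > 0"
  shows "cot_sum \<tau> z = cot_sum (- 1 / \<tau>) (z / \<tau>) / \<tau> - 2 * pi * \<i> / \<tau> * z"
proof -
  define W where "W = (\<lambda>z. cot_sum \<tau> z - cot_sum (- 1 / \<tau>) (z / \<tau>) / \<tau> + 2 * pi * \<i> / \<tau> * z)"
  have tau: "\<tau> \<noteq> 0" using assms by auto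
  note tau' = Im_minus_inverse_pos[OF assms]
  have W_holo_cell: "W holomorphic_on period_cell \<tau>"
    using cot_sum_inversion_cell[OF assms] unfolding W_def by (subst holomorphic_cong) auto
  have W1: "W (z + 1) = W z" for z
  proof -
    have "cot_sum (- 1 / \<tau>) (z / \<tau>) = cot_sum (- 1 / \<tau>) ((z + 1) / \<tau> + (- 1 / \<tau>))"
      by (simp add: add_divide_distrib)
    also have "\<dots> = cot_sum (- 1 / \<tau>) ((z + 1) / \<tau>) - 2 * pi * \<i>"
      by (rule cot_sum_plus_tau[OF tau'])
    finally have "cot_sum (- 1 / \<tau>) ((z + 1) / \<tau>) = cot_sum (- 1 / \<tau>) (z / \<tau>) + 2 * pi * \<i>" by simp
    thus ?thesis using tau unfolding W_def cot_sum_plus_1 by (simp add: field_simps)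
  qed
  have Wt: "W (z + \<tau>) = W z" for z
  proof -
    have "cot_sum (- 1 / \<tau>) ((z + \<tau>) / \<tau>) = cot_sum (- 1 / \<tau>) (z / \<tau>)"
      using cot_sum_plus_1[of "- 1 / \<tau>" "z / \<tau>"] tau by (simp add: add_divide_distrib)
    thus ?thesis using tau unfolding W_def cot_sum_plus_tau[OF assms] by (simp add: field_simps)
  qed
  have W1n: "W (z + of_int n) = W z" for z n
  proof (induction n rule: int_induct[of _ 0])
    case (step1 i)
    thus ?case using W1[of "z + of_int i"] by (simp add: add_ac)
  next
    case (step2 i)
    thus ?case using W1[of "z + of_int (i - 1)"] by (simp add: algebra_simps)
  qed auto
  have Wtn: "W (z + of_int n * \<tau>) = W z" for z n
  proof (induction n rule: int_induct[of _ 0])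
    case (step1 i)
    thus ?case using Wt[of "z + of_int i * \<tau>"] by (simp add: algebra_simps)
  next
    case (step2 i)
    thus ?case using Wt[of "z + of_int (i - 1) * \<tau>"] by (simp add: algebra_simps)
  qed auto
  \<comment> \<open>a closed fundamental parallelogram inside the cell\<close>
  define Q where "Q = (\<lambda>(s, t). of_real s + of_real t * \<tau>) ` ({-1/2..1/2::real} \<times> {-1/2..1/2::real})"
  have Q_compact: "compact Q" unfolding Q_def case_prod_unfold
    by (intro compact_continuous_image compact_Times continuous_intros) auto
  have Q_cell: "Q \<subseteq> period_cell \<tau>"
    by (auto simp: Q_def period_cell_lattice_coords[OF assms])
  have red: "\<exists>m n. z - of_int m - of_int n * \<tau> \<in> Q" for z
  proof -
    define t where "t = Im z / Im \<tau>"
    define s where "s = Re (z - of_real t * \<tau>)"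
    have z: "z = of_real s + of_real t * \<tau>"
      using assms by (simp add: complex_eq_iff s_def t_def)
    have "z - of_int (round s) - of_int (round t) * \<tau> =
        of_real (s - of_int (round s)) + of_real (t - of_int (round t)) * \<tau>"
      by (subst z) (simp add: algebra_simps)
    moreover have "s - of_int (round s) \<in> {-1/2..1/2}" "t - of_int (round t) \<in> {-1/2..1/2}"
      using of_int_round_abs_le[of s] of_int_round_abs_le[of t]
      unfolding atLeastAtMost_iff by linarith+
    ultimately have "z - of_int (round s) - of_int (round t) * \<tau> \<in> Q"
      unfolding Q_def by (intro image_eqI[where x = "(s - of_int (round s), t - of_int (round t))"])
        auto
    thus ?thesis by blast
  qed
  have W_shift: "W (z - of_int m - of_int n * \<tau>) = W z" for z m n
    using W1n[of z "-m"] Wtn[of "z - of_int m" "-n"] by simp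
  have "W holomorphic_on UNIV"
    unfolding holomorphic_on_def
  proof
    fix z :: complex
    obtain m n where mn: "z - of_int m - of_int n * \<tau> \<in> Q" using red by blast
    hence "W field_differentiable (at (z - of_int m - of_int n * \<tau>))"
      using W_holo_cell open_period_cell Q_cell by (meson holomorphic_on_imp_differentiable_at subsetD)
    then obtain D where D: "(W has_field_derivative D) (at (z - of_int m - of_int n * \<tau>))"
      by (auto simp: field_differentiable_def)
    have "((\<lambda>z. W (z - of_int m - of_int n * \<tau>)) has_field_derivative D * 1) (at z)"
      by (rule DERIV_chain2[where f = W and g = "\<lambda>z. z - of_int m - of_int n * \<tau>", OF D])
         (auto intro!: derivative_eq_intros)
    thus "W field_differentiable (at z within UNIV)"
      by (auto simp: W_shift field_differentiable_def)
  qed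
  moreover have "bounded (range W)"
  proof -
    have "compact (W ` Q)"
      by (intro compact_continuous_image Q_compact holomorphic_on_imp_continuous_on
            holomorphic_on_subset[OF W_holo_cell] Q_cell)
    hence "bounded (W ` Q)" by (rule compact_imp_bounded)
    moreover have "range W \<subseteq> W ` Q" using red W_shift by (metis image_eqI image_subsetI)
    ultimately show ?thesis by (rule bounded_subset)
  qed
  ultimately have "W constant_on UNIV" by (rule Liouville_theorem)
  hence "W z = W 0" by (auto simp: constant_on_def)
  also have "W 0 = 0" by (simp add: W_def cot_sum_0)
  finally show ?thesis by (simp add: W_def field_simps)
qed

lemma higher_deriv_inversion:
  assumes "Im \<tau> > 0"
  shows "(deriv ^^ n) (cot_sum_regular \<tau>) 0 =
    (deriv ^^ n) (cot_sum_regular (- 1 / \<tau>)) 0 / \<tau> ^ Suc n - (if n = 1 then 2 * pi * \<i> / \<tau> else 0)"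
proof -
  have tau: "\<tau> \<noteq> 0" using assms by auto
  note tau' = Im_minus_inverse_pos[OF assms]
  define S where "S = period_cell \<tau>"
  define T where "T = cot_domain \<inter> {z. \<bar>Im z\<bar> < Im (- 1 / \<tau>)}"
  have S: "open S" "0 \<in> S" using assms tau' by (simp add: S_def open_period_cell) (simp add: S_def period_cell_def assms tau'[simplified])
  have T: "open T" unfolding T_def by (intro open_Int cot_regular_holomorphic open_strip)
  have ST: "inverse \<tau> * z \<in> T" if "z \<in> S" for z
    using period_cell_subset_cot_domain(2)[OF assms] that
    by (auto simp: S_def T_def period_cell_def divide_inverse_commute)
  have R': "cot_sum_regular (- 1 / \<tau>) holomorphic_on T"
    by (rule holomorphic_cot_sum_regular) (auto simp: T_def)
  have "cot_sum_regular (- 1 / \<tau>) \<circ> (\<lambda>z. inverse \<tau> * z) holomorphic_on S"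
    using ST by (intro holomorphic_on_compose holomorphic_on_subset[OF R']) (auto intro!: holomorphic_intros)
  hence RS: "(\<lambda>z. cot_sum_regular (- 1 / \<tau>) (inverse \<tau> * z)) holomorphic_on S" by (simp add: o_def)
  have R: "cot_sum_regular \<tau> holomorphic_on S"
    unfolding S_def by (rule holomorphic_cot_sum_regular[OF period_cell_subset_cot_domain(1)[OF assms(1)]])
       (auto simp: period_cell_def)
  have "(deriv ^^ n) (cot_sum_regular \<tau>) 0 =
    (deriv ^^ n) (\<lambda>z. inverse \<tau> * cot_sum_regular (- 1 / \<tau>) (inverse \<tau> * z) - (2 * pi * \<i> / \<tau>) * z) 0"
  proof (rule higher_deriv_transform_within_open[OF R _ S])
    fix z assume "z \<in> S"
    from cot_sum_inversion_cell(2)[OF assms this[unfolded S_def]] cot_sum_inversion[OF assms, of z]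
    show "cot_sum_regular \<tau> z = inverse \<tau> * cot_sum_regular (- 1 / \<tau>) (inverse \<tau> * z) - (2 * pi * \<i> / \<tau>) * z"
      by (simp add: field_simps)
  qed (intro holomorphic_intros RS)
  also have "\<dots> = inverse \<tau> * (deriv ^^ n) (\<lambda>z. cot_sum_regular (- 1 / \<tau>) (inverse \<tau> * z)) 0 -
      (2 * pi * \<i> / \<tau>) * (deriv ^^ n) (\<lambda>z. z) 0"
    by (subst higher_deriv_diff[OF _ _ S] higher_deriv_cmult[OF _ S(2,1)],
        (intro holomorphic_intros RS)+)+ simp
  also have "(deriv ^^ n) (\<lambda>z. cot_sum_regular (- 1 / \<tau>) (inverse \<tau> * z)) 0 =
     inverse \<tau> ^ n * (deriv ^^ n) (cot_sum_regular (- 1 / \<tau>)) (inverse \<tau> * 0)"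
    by (rule higher_deriv_compose_linear[OF R' S(1) T S(2) ST])
  finally show ?thesis by (simp add: divide_inverse power_inverse mult_ac)
qed

text \<open>
  The Taylor coefficient of order \<open>n\<close> of the inversion identity.  Since \<open>a - 2(2\<pi>\<i>)\<^sup>n\<^sup>+\<^sup>1 \<Sum> \<sigma>\<^sub>n(m) q\<^sup>m\<close>
  is a multiple of an Eisenstein series of weight \<open>n + 1\<close>, this is its transformation law; the linear term
  contributes for \<open>n = 1\<close> only and makes \<open>E\<^sub>2\<close> quasimodular.
\<close>

lemma Lambert_inversion:
  assumes "Im \<tau> > 0" "odd n" and a: "(deriv ^^ n) cot_regular 0 = a"
  shows "a - 2 * (2 * pi * \<i>) ^ Suc n * twisted_lambert n (- 1 / \<tau>) 0 =
    \<tau> ^ Suc n * (a - 2 * (2 * pi * \<i>) ^ Suc n * twisted_lambert n \<tau> 0) +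
      (if n = 1 then 2 * pi * \<i> * \<tau> else 0)"
proof -
  have tau: "\<tau> \<noteq> 0" using assms by auto
  show ?thesis
    using higher_deriv_inversion[OF assms(1), of n] tau
    unfolding higher_deriv_cot_sum_regular[OF assms(1,2)]
      higher_deriv_cot_sum_regular[OF Im_minus_inverse_pos[OF assms(1)] assms(2)] a
    by (auto simp add: field_simps power2_eq_square)
qed

lemma g1_inversion:
  assumes "Im \<tau> > 0"
  shows "g1 (- 1 / \<tau>) = \<tau> ^ 2 * g1 \<tau> + \<tau>"
proof -
  have E: "eisenstein_E2 \<tau> = 1 - 24 * twisted_lambert 1 \<tau> 0" for \<tau>
    by (simp add: eisenstein_E2_def twisted_lambert_0)
  have pi: "complex_of_real pi \<noteq> 0" by simp
  have *: "- (of_real pi ^ 2) / 3 * eisenstein_E2 t =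
     - (of_real pi ^ 2) / 3 - 2 * (2 * pi * \<i>) ^ Suc 1 * twisted_lambert 1 t 0" for t
    by (simp add: E field_simps power2_eq_square)
  have "- (of_real pi ^ 2) / 3 * eisenstein_E2 (- 1 / \<tau>) =
      \<tau> ^ 2 * (- (of_real pi ^ 2) / 3 * eisenstein_E2 \<tau>) + 2 * pi * \<i> * \<tau>"
    using Lambert_inversion[OF assms _ cot_regular_coeffs(1)] unfolding * by (simp add: numeral_2_eq_2)
  hence "of_real pi * (of_real pi * eisenstein_E2 (- 1 / \<tau>)) =
      of_real pi * (\<tau> ^ 2 * of_real pi * eisenstein_E2 \<tau> - 6 * \<i> * \<tau>)"
    by (simp add: field_simps power2_eq_square)
  hence "of_real pi * eisenstein_E2 (- 1 / \<tau>) = \<tau> ^ 2 * of_real pi * eisenstein_E2 \<tau> - 6 * \<i> * \<tau>"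
    by simp
  hence "\<i> / 6 * (of_real pi * eisenstein_E2 (- 1 / \<tau>)) =
      \<i> / 6 * (\<tau> ^ 2 * of_real pi * eisenstein_E2 \<tau> - 6 * \<i> * \<tau>)" by (rule arg_cong)
  thus ?thesis unfolding g1_def by (simp add: algebra_simps)
qed

lemma g2_inversion:
  assumes "Im \<tau> > 0"
  shows "g2 (- 1 / \<tau>) = \<tau> ^ 4 * g2 \<tau>"
proof -
  have E: "eisenstein_E4 \<tau> = 1 + 240 * twisted_lambert 3 \<tau> 0" for \<tau>
    by (simp add: eisenstein_E4_def twisted_lambert_0)
  have *: "- 2 * of_real pi ^ 4 / 15 * eisenstein_E4 t =
     - 2 * of_real pi ^ 4 / 15 - 2 * (2 * pi * \<i>) ^ Suc 3 * twisted_lambert 3 t 0" for t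
    by (simp add: E field_simps eval_nat_numeral)
  have "- 2 * of_real pi ^ 4 / 15 * eisenstein_E4 (- 1 / \<tau>) =
      \<tau> ^ 4 * (- 2 * of_real pi ^ 4 / 15 * eisenstein_E4 \<tau>)"
    using Lambert_inversion[OF assms _ cot_regular_coeffs(2)] unfolding * by simp
  thus ?thesis by (simp add: g2_def)
qed

lemma g3_inversion:
  assumes "Im \<tau> > 0"
  shows "g3 (- 1 / \<tau>) = \<tau> ^ 6 * g3 \<tau>"
proof -
  have E: "eisenstein_E6 \<tau> = 1 - 504 * twisted_lambert 5 \<tau> 0" for \<tau>
    by (simp add: eisenstein_E6_def twisted_lambert_0)
  have *: "- 16 * of_real pi ^ 6 / 63 * eisenstein_E6 t =
     - 16 * of_real pi ^ 6 / 63 - 2 * (2 * pi * \<i>) ^ Suc 5 * twisted_lambert 5 t 0" for t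
    by (simp add: E field_simps eval_nat_numeral)
  have "- 16 * of_real pi ^ 6 / 63 * eisenstein_E6 (- 1 / \<tau>) =
      \<tau> ^ 6 * (- 16 * of_real pi ^ 6 / 63 * eisenstein_E6 \<tau>)"
    using Lambert_inversion[OF assms _ cot_regular_coeffs(3)] unfolding * by simp
  thus ?thesis by (simp add: g3_def)
qed

section \<open>Expansions in the nome and cusp forms of small weight\<close>

text \<open>
  Holomorphy of \<open>F\<close> on the whole disc, including \<open>q = 0\<close>, encodes that \<open>f\<close> is 1-periodic and
  holomorphic at the cusp.  Together with \<open>half_weight n f\<close> it says that \<open>f\<close> is a modular form of weight \<open>2n\<close> for
  the full modular group.
\<close>

definition q_expansion :: "(complex \<Rightarrow> complex) \<Rightarrow> (complex \<Rightarrow> complex) \<Rightarrow> bool" where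
  "q_expansion f F \<longleftrightarrow> F holomorphic_on ball 0 1 \<and> (\<forall>\<tau>. Im \<tau> > 0 \<longrightarrow> f \<tau> = F (nome \<tau>))"

definition half_weight :: "nat \<Rightarrow> (complex \<Rightarrow> complex) \<Rightarrow> bool" where
  "half_weight n f \<longleftrightarrow> (\<forall>\<tau>. Im \<tau> > 0 \<longrightarrow> f (- 1 / \<tau>) = \<tau> ^ (2 * n) * f \<tau>)"

lemma nome_in_ball: "Im \<tau> > 0 \<Longrightarrow> nome \<tau> \<in> ball 0 1"
  by (simp add: norm_nome_less_1)

lemma nome_surj:
  assumes "q \<noteq> 0" "norm q < 1"
  obtains \<tau> where "Im \<tau> > 0" "nome \<tau> = q"
proof -
  have "nome (Ln q / (2 * pi * \<i>)) = q" using assms by (simp add: nome_def)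
  with that show ?thesis using assms norm_nome_less_1 by metis
qed

lemma q_expansion_plus_1:
  assumes "q_expansion f F" "Im \<tau> > 0"
  shows "f (\<tau> + 1) = f \<tau>"
  using assms by (simp add: q_expansion_def nome_add)

lemma q_expansion_diff: "q_expansion f F \<Longrightarrow> q_expansion g G \<Longrightarrow> q_expansion (\<lambda>\<tau>. f \<tau> - g \<tau>) (\<lambda>q. F q - G q)"
  and q_expansion_mult: "q_expansion f F \<Longrightarrow> q_expansion g G \<Longrightarrow> q_expansion (\<lambda>\<tau>. f \<tau> * g \<tau>) (\<lambda>q. F q * G q)"
  and q_expansion_power: "q_expansion f F \<Longrightarrow> q_expansion (\<lambda>\<tau>. f \<tau> ^ n) (\<lambda>q. F q ^ n)"
  and q_expansion_const: "q_expansion (\<lambda>\<tau>. c) (\<lambda>q. c)"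
  by (auto simp: q_expansion_def intro!: holomorphic_intros)

lemma open_upper_half_plane: "open {\<tau>. Im \<tau> > 0}"
  by (rule open_halfspace_Im_gt)

lemma has_field_derivative_q_expansion:
  assumes "q_expansion f F" "Im \<tau> > 0"
  shows "(f has_field_derivative 2 * pi * \<i> * nome \<tau> * deriv F (nome \<tau>)) (at \<tau>)"
proof -
  have "(F has_field_derivative deriv F (nome \<tau>)) (at (nome \<tau>))"
    using assms nome_in_ball[OF assms(2)]
    by (intro holomorphic_derivI[of F "ball 0 1"]) (auto simp: q_expansion_def)
  moreover have "(nome has_field_derivative 2 * pi * \<i> * nome \<tau>) (at \<tau>)"
    unfolding nome_def [abs_def] by (auto intro!: derivative_eq_intros simp: nome_def)
  ultimately have "((\<lambda>\<tau>. F (nome \<tau>)) has_field_derivative deriv F (nome \<tau>) * (2 * pi * \<i> * nome \<tau>)) (at \<tau>)"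
    by (rule DERIV_chain2)
  hence "((\<lambda>\<tau>. F (nome \<tau>)) has_field_derivative 2 * pi * \<i> * nome \<tau> * deriv F (nome \<tau>)) (at \<tau>)"
    by (simp add: mult_ac)
  thus ?thesis
    by (rule has_field_derivative_transform_within_open[OF _ open_upper_half_plane])
       (use assms in \<open>auto simp: q_expansion_def\<close>)
qed

lemma q_expansion_deriv:
  assumes "q_expansion f F"
  shows "q_expansion (deriv f) (\<lambda>q. 2 * pi * \<i> * q * deriv F q)"
  unfolding q_expansion_def
proof (intro conjI allI impI)
  show "(\<lambda>q. 2 * pi * \<i> * q * deriv F q) holomorphic_on ball 0 1"
    using assms by (auto simp: q_expansion_def intro!: holomorphic_intros holomorphic_deriv)
qed (use has_field_derivative_q_expansion[OF assms] in \<open>auto intro!: DERIV_imp_deriv\<close>)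

lemma q_expansion_has_deriv:
  assumes "q_expansion f F" "Im \<tau> > 0"
  shows "(f has_field_derivative deriv f \<tau>) (at \<tau>)"
  using has_field_derivative_q_expansion[OF assms] DERIV_imp_deriv by metis

lemma q_expansion_factor:
  assumes "F holomorphic_on ball 0 1" "F 0 = (0::complex)"
  obtains G where "G holomorphic_on ball 0 1" "\<And>q. q \<in> ball 0 1 \<Longrightarrow> F q = q * G q"
proof -
  define G where "G = (\<lambda>q. if q = 0 then deriv F 0 else F q / q)"
  have "G holomorphic_on ball 0 1"
    by (rule pole_theorem_open_0[where g = F and a = 0]) (use assms in \<open>auto simp: G_def\<close>)
  moreover have "F q = q * G q" for q using assms by (simp add: G_def)
  ultimately show ?thesis using that by blast
qed

lemma periodic_int_shift:
  assumes "\<And>\<tau>. Im \<tau> > 0 \<Longrightarrow> f (\<tau> + 1) = f \<tau>" "Im \<tau> > 0"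
  shows "f (\<tau> + of_int k) = f \<tau>"
proof (induction k rule: int_induct[of _ 0])
  case (step1 i)
  thus ?case using assms(1)[of "\<tau> + of_int i"] assms(2) by (simp add: add_ac)
next
  case (step2 i)
  thus ?case using assms(1)[of "\<tau> + of_int (i - 1)"] assms(2) by (simp add: algebra_simps)
qed auto

text \<open>
  The value 17/20 is below \<open>\<surd>3/2\<close>, so on the strip \<open>\<bar>Re \<tau>\<bar> \<le> 1/2\<close> inversion multiplies imaginary parts
  below 17/20 by at least 51/50, and finitely many inversions suffice.  It is large enough for
  \<open>cusp_form_small_weight_eq_0\<close>.
\<close>

lemma upper_half_plane_reduction:
  fixes M :: "complex \<Rightarrow> real"
  assumes T: "\<And>\<tau>. Im \<tau> > 0 \<Longrightarrow> M (\<tau> + 1) = M \<tau>"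
    and S: "\<And>\<tau>. Im \<tau> > 0 \<Longrightarrow> M (- 1 / \<tau>) = M \<tau>"
    and pos: "Im \<tau> > 0"
  shows "\<exists>\<tau>'. \<bar>Re \<tau>'\<bar> \<le> 1/2 \<and> Im \<tau>' \<ge> 17/20 \<and> M \<tau>' = M \<tau>"
proof -
  have norm: "\<exists>\<tau>'. \<bar>Re \<tau>'\<bar> \<le> 1/2 \<and> Im \<tau>' = Im \<tau> \<and> M \<tau>' = M \<tau>" if "Im \<tau> > 0" for \<tau>
  proof (intro exI conjI)
    show "\<bar>Re (\<tau> + of_int (- round (Re \<tau>)))\<bar> \<le> 1/2"
      using of_int_round_abs_le[of "Re \<tau>"] by (simp add: abs_minus_commute)
    show "M (\<tau> + of_int (- round (Re \<tau>))) = M \<tau>" using T that by (rule periodic_int_shift)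
  qed auto
  have main: "\<exists>\<tau>'. \<bar>Re \<tau>'\<bar> \<le> 1/2 \<and> Im \<tau>' \<ge> 17/20 \<and> M \<tau>' = M \<tau>"
    if "Im \<tau> > 0" "Im \<tau> * (51/50) ^ n \<ge> 17/20" for n \<tau>
    using that
  proof (induction n arbitrary: \<tau>)
    case 0
    thus ?case using norm[OF 0(1)] by auto
  next
    case (Suc n)
    obtain \<tau>' where \<tau>': "\<bar>Re \<tau>'\<bar> \<le> 1/2" "Im \<tau>' = Im \<tau>" "M \<tau>' = M \<tau>"
      using norm[OF Suc.prems(1)] by blast
    show ?case
    proof (cases "Im \<tau> \<ge> 17/20")
      case True
      thus ?thesis using \<tau>' by auto
    next
      case False
      have "\<bar>Re \<tau>'\<bar> ^ 2 \<le> (1/2) ^ 2" "Im \<tau>' ^ 2 \<le> (17/20) ^ 2"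
        using \<tau>' False Suc.prems by (intro power_mono; simp)+
      hence "norm \<tau>' ^ 2 \<le> 50/51"
        by (simp add: cmod_def power2_eq_square)
      moreover have "\<tau>' \<noteq> 0" using \<tau>' Suc.prems by auto
      ultimately have "Im \<tau>' / (50/51) \<le> Im \<tau>' / norm \<tau>' ^ 2"
        using \<tau>' Suc.prems by (intro divide_left_mono) auto
      hence ge: "Im \<tau> * (51/50) \<le> Im (- 1 / \<tau>')"
        unfolding Im_minus_inverse using \<tau>'(2) by simp
      have "17/20 \<le> (Im \<tau> * (51/50)) * (51/50) ^ n" using Suc.prems by simp
      also have "\<dots> \<le> Im (- 1 / \<tau>') * (51/50) ^ n" using ge by (intro mult_right_mono) auto
      finally obtain \<tau>'' where "\<bar>Re \<tau>''\<bar> \<le> 1/2" "Im \<tau>'' \<ge> 17/20" "M \<tau>'' = M (- 1 / \<tau>')"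
        using Suc.IH[of "- 1 / \<tau>'"] Im_minus_inverse_pos[of \<tau>'] \<tau>'(2) Suc.prems(1) by metis
      moreover have "M (- 1 / \<tau>') = M \<tau>" using S[of \<tau>'] \<tau>' Suc.prems by simp
      ultimately show ?thesis by auto
    qed
  qed
  obtain n where "(17/20) / Im \<tau> < (51/50) ^ n" using real_arch_pow[of "51/50" "(17/20) / Im \<tau>"] by auto
  hence "17/20 \<le> Im \<tau> * (51/50) ^ n" using pos by (simp add: field_simps)
  thus ?thesis using main pos by blast
qed

lemma pi_ge_3: "pi \<ge> 3"
proof -
  have "sin (pi/6) \<le> pi/6" by (intro sin_x_le_x) auto
  thus ?thesis using sin_30 by simp
qed

text \<open>
  The invariant function \<open>M(\<tau>) = \<bar>f(\<tau>)\<bar> (Im \<tau>)\<^sup>n\<close> tends to 0 at the cusp, so it has a maximum \<open>\<mu>\<close>, attained at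
  a point of imaginary part \<open>y0 \<ge> 17/20\<close>.  The maximum principle for \<open>F(q)/q\<close> compares this point with the horizontal
  line at the height \<open>y1 = 21/25\<close> and gives \<open>y0\<^sup>-\<^sup>n exp(2\<pi> y0) \<le> y1\<^sup>-\<^sup>n exp(2\<pi> y1)\<close> unless \<open>\<mu> = 0\<close>.  But
  \<open>y\<^sup>-\<^sup>n exp(2\<pi> y)\<close> increases strictly for \<open>y \<ge> y1\<close>, because \<open>2\<pi> y1 > 5 \<ge> n\<close>.
\<close>

theorem cusp_form_small_weight_eq_0:
  assumes F: "q_expansion f F" "F 0 = 0" and n: "half_weight n f" "n \<le> 5" and pos: "Im \<tau> > 0"
  shows "f \<tau> = 0"
proof (rule ccontr)
  assume nz: "f \<tau> \<noteq> 0"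
  obtain G where G: "G holomorphic_on ball 0 1" "\<And>q. q \<in> ball 0 1 \<Longrightarrow> F q = q * G q"
    using q_expansion_factor[of F] F by (auto simp: q_expansion_def)
  have f_eq: "f \<tau> = nome \<tau> * G (nome \<tau>)" if "Im \<tau> > 0" for \<tau>
    using F(1) G(2)[OF nome_in_ball[OF that]] that by (simp add: q_expansion_def)
  define M where "M = (\<lambda>\<tau>. norm (f \<tau>) * Im \<tau> ^ n)"
  have M_T: "M (\<tau> + 1) = M \<tau>" if "Im \<tau> > 0" for \<tau>
    using q_expansion_plus_1[OF F(1) that] by (simp add: M_def)
  have M_S: "M (- 1 / \<tau>) = M \<tau>" if "Im \<tau> > 0" for \<tau>
  proof -
    have "\<tau> \<noteq> 0" using that by auto
    have "M (- 1 / \<tau>) = (norm \<tau> ^ (2 * n) * norm (f \<tau>)) * (Im \<tau> / norm \<tau> ^ 2) ^ n"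
      unfolding M_def Im_minus_inverse using n(1) that by (simp add: half_weight_def norm_mult norm_power)
    also have "\<dots> = M \<tau>" using \<open>\<tau> \<noteq> 0\<close> by (simp add: M_def power_divide power_mult [symmetric])
    finally show ?thesis .
  qed
  have red: "\<exists>\<tau>'. \<bar>Re \<tau>'\<bar> \<le> 1/2 \<and> Im \<tau>' \<ge> 17/20 \<and> M \<tau>' = M \<tau>" if "Im \<tau> > 0" for \<tau>
    using upper_half_plane_reduction[where M = M, OF _ _ that] M_T M_S by blast
  obtain \<tau>1 where t1: "\<bar>Re \<tau>1\<bar> \<le> 1/2" "Im \<tau>1 \<ge> 17/20" "M \<tau>1 = M \<tau>" using red[OF pos] by auto
  have M_pos: "M \<tau> > 0" using nz pos by (simp add: M_def)
  have small: "norm (nome \<tau>) \<le> exp (- 2 * pi * (17/20))" if "Im \<tau> \<ge> 17/20" for \<tau>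
    unfolding norm_nome using that by (simp add: mult_left_mono)
  have sub: "cball 0 (exp (- 2 * pi * (17/20))) \<subseteq> (ball 0 1 :: complex set)"
    by (rule cball_subset_ball_iff[THEN iffD2]) simp
  have "bounded (G ` cball 0 (exp (- 2 * pi * (17/20))))"
    by (intro compact_imp_bounded compact_continuous_image holomorphic_on_imp_continuous_on
          holomorphic_on_subset[OF G(1) sub]) auto
  then obtain B where B: "B > 0" "\<And>q. norm q \<le> exp (- 2 * pi * (17/20)) \<Longrightarrow> norm (G q) \<le> B"
    by (auto simp: bounded_pos)
  have M_le: "M \<tau> \<le> B * (Im \<tau> ^ n / exp (Im \<tau>))" if "Im \<tau> \<ge> 17/20" for \<tau>
  proof -
    have "M \<tau> = (exp (- 2 * pi * Im \<tau>) * norm (G (nome \<tau>))) * Im \<tau> ^ n"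
      using that by (simp add: M_def f_eq norm_mult norm_nome)
    also have "\<dots> \<le> (exp (- Im \<tau>) * B) * Im \<tau> ^ n"
    proof (intro mult_right_mono mult_mono)
      have "1 * Im \<tau> \<le> (2 * pi) * Im \<tau>" using that pi_ge_3 by (intro mult_right_mono) auto
      thus "exp (- 2 * pi * Im \<tau>) \<le> exp (- Im \<tau>)" by simp
    qed (use B that small[OF that] in auto)
    finally show ?thesis by (simp add: exp_minus field_simps)
  qed
  have "((\<lambda>y. B * (y ^ n / exp y)) \<longlongrightarrow> B * 0) at_top"
    by (intro tendsto_intros tendsto_power_div_exp_0)
  hence "eventually (\<lambda>y. B * (y ^ n / exp y) < M \<tau>) at_top"
    using M_pos by (auto dest: order_tendstoD(2))
  then obtain Y where Y: "\<And>y. y \<ge> Y \<Longrightarrow> B * (y ^ n / exp y) < M \<tau>"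
    by (auto simp: eventually_at_top_linorder)
  \<comment> \<open>beyond the height \<open>Y\<close> the function is smaller than \<open>M \<tau>\<close>, so a maximum over the compact set \<open>K\<close> is global\<close>
  define K where "K = cbox (Complex (-1/2) (17/20)) (Complex (1/2) (max Y (17/20)))"
  have K: "z \<in> K \<longleftrightarrow> \<bar>Re z\<bar> \<le> 1/2 \<and> Im z \<ge> 17/20 \<and> Im z \<le> max Y (17/20)" for z
    unfolding K_def by (auto simp: in_cbox_complex_iff abs_le_iff)
  have in_K: "z \<in> K" if "\<bar>Re z\<bar> \<le> 1/2" "Im z \<ge> 17/20" "M z \<ge> M \<tau>" for z
    using Y[of "Im z"] M_le[of z] that unfolding K by linarith
  have "f holomorphic_on {\<tau>. Im \<tau> > 0}"
    unfolding holomorphic_on_open[OF open_upper_half_plane]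
    using has_field_derivative_q_expansion[OF F(1)] by blast
  hence "continuous_on {\<tau>. Im \<tau> > 0} f" by (rule holomorphic_on_imp_continuous_on)
  moreover have "K \<subseteq> {\<tau>. Im \<tau> > 0}" by (auto simp: K)
  ultimately have "continuous_on K f" by (rule continuous_on_subset)
  hence "continuous_on K M"
    unfolding M_def
    by (intro continuous_on_mult continuous_on_norm continuous_on_power continuous_on_Im continuous_on_id)
  moreover have "compact K" by (simp add: K_def)
  moreover have "\<tau>1 \<in> K" using in_K t1 by simp
  ultimately obtain \<tau>0 where t0: "\<tau>0 \<in> K" "\<And>z. z \<in> K \<Longrightarrow> M z \<le> M \<tau>0"
    using continuous_attains_sup[of K M] by auto
  have t0_pos: "Im \<tau>0 \<ge> 17/20" using t0(1) by (simp add: K)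
  have M_max: "M z \<le> M \<tau>0" if "Im z > 0" for z
  proof (cases "M z \<ge> M \<tau>")
    case True
    obtain z' where z': "\<bar>Re z'\<bar> \<le> 1/2" "Im z' \<ge> 17/20" "M z' = M z"
      using red[OF \<open>Im z > 0\<close>] by auto
    with True have "z' \<in> K" by (intro in_K) auto
    thus ?thesis using t0(2) z' by metis
  next
    case False
    have "M \<tau> \<le> M \<tau>0" using t0(2)[OF \<open>\<tau>1 \<in> K\<close>] t1 by simp
    thus ?thesis using False by linarith
  qed
  define \<mu> where "\<mu> = M \<tau>0"
  have mu: "\<mu> > 0" using M_max[OF pos] M_pos by (simp add: \<mu>_def)
  define y0 where "y0 = Im \<tau>0"
  \<comment> \<open>any height with \<open>5/6 < y1 < 17/20\<close> would do, since \<open>\<pi> \<ge> 3\<close>\<close>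
  define y1 where "y1 = (21/25 :: real)"
  have y: "0 < y1" "y1 < y0" using t0_pos by (auto simp: y0_def y1_def)
  define r where "r = exp (- 2 * pi * y1)"
  have r: "0 < r" "r < 1" by (auto simp: r_def y1_def)
  have G_le: "norm (G q) \<le> \<mu> / y1 ^ n / r" if "norm q = r" for q
  proof -
    have "q \<noteq> 0" "norm q < 1" using that r by auto
    then obtain t where t: "Im t > 0" "nome t = q" by (rule nome_surj)
    have "exp (- 2 * pi * Im t) = exp (- 2 * pi * y1)" using that t norm_nome[of t] by (simp add: r_def)
    hence "Im t = y1" by simp
    hence "norm (f t) * y1 ^ n \<le> \<mu>" using M_max[OF t(1)] by (simp add: M_def \<mu>_def)
    moreover have "norm (f t) = r * norm (G q)" using f_eq[OF t(1)] t that by (simp add: norm_mult)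
    ultimately show ?thesis using r y by (simp add: field_simps)
  qed
  have "norm (G (nome \<tau>0)) \<le> \<mu> / y1 ^ n / r"
  proof (rule maximum_modulus_frontier[where S = "cball 0 r" and f = G])
    have "cball 0 r \<subseteq> (ball 0 1 :: complex set)" using r by auto
    thus "G holomorphic_on interior (cball 0 r)" "continuous_on (closure (cball 0 r)) G"
      by (auto intro!: holomorphic_on_imp_continuous_on holomorphic_on_subset[OF G(1)])
    show "nome \<tau>0 \<in> cball 0 r" using y by (simp add: norm_nome r_def y0_def)
  qed (use G_le r in auto)
  hence "exp (- 2 * pi * y0) * norm (G (nome \<tau>0)) * y0 ^ n \<le> exp (- 2 * pi * y0) * (\<mu> / y1 ^ n / r) * y0 ^ n"
    using y by (intro mult_right_mono mult_left_mono) auto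
  moreover have "\<mu> = exp (- 2 * pi * y0) * norm (G (nome \<tau>0)) * y0 ^ n"
    using t0_pos by (simp add: \<mu>_def M_def f_eq norm_mult norm_nome y0_def)
  ultimately have "\<mu> \<le> exp (- 2 * pi * y0) * (\<mu> / y1 ^ n / r) * y0 ^ n" by simp
  also have "\<dots> = \<mu> * (exp (- 2 * pi * (y0 - y1)) * (y0 / y1) ^ n)"
    by (simp add: r_def power_divide exp_diff exp_minus field_simps)
  finally have "1 \<le> exp (- 2 * pi * (y0 - y1)) * (y0 / y1) ^ n" using mu by simp
  hence "exp (2 * pi * (y0 - y1)) * 1 \<le> exp (2 * pi * (y0 - y1)) * (exp (- 2 * pi * (y0 - y1)) * (y0 / y1) ^ n)"
    by (intro mult_left_mono) auto
  hence "exp (2 * pi * (y0 - y1)) \<le> (y0 / y1) ^ n"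
    by (simp add: mult.assoc [symmetric] exp_add [symmetric])
  also have "y0 / y1 = 1 + (y0 - y1) / y1" using y by (simp add: field_simps)
  also have "(1 + (y0 - y1) / y1) ^ n \<le> exp ((y0 - y1) / y1) ^ n"
    using y by (intro power_mono exp_ge_add_one_self) auto
  also have "\<dots> = exp (n * ((y0 - y1) / y1))" by (rule exp_of_nat_mult[symmetric])
  finally have "2 * pi * (y0 - y1) \<le> n * ((y0 - y1) / y1)" by simp
  hence "(y0 - y1) * (2 * pi) \<le> (y0 - y1) * (n / y1)" by (simp add: mult_ac)
  moreover have "y0 - y1 > 0" using y by simp
  ultimately have "2 * pi \<le> n / y1" by (rule mult_left_le_imp_le)
  also have "n / y1 \<le> 5 / y1" using n y by (intro divide_right_mono) auto
  also have "\<dots> < 6" by (simp add: y1_def)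
  finally show False using pi_ge_3 by simp
qed

section \<open>Ramanujan's differential equations and the discriminant\<close>

text \<open>
  The Lambert series of \<open>\<sigma>\<^sub>k\<close> divided by \<open>q\<close>.  Its value at 0 is the first coefficient, which decides that
  the discriminant has a simple zero at the cusp.
\<close>

definition lambert_tail :: "nat \<Rightarrow> complex \<Rightarrow> complex" where
  "lambert_tail k q = suminf (\<lambda>n. of_nat (divisor_power_sum k (Suc n)) * q ^ n)"

lemma
  assumes "norm q < 1"
  shows lambert_tail_sums: "(\<lambda>n. of_nat (divisor_power_sum k (Suc n)) * q ^ n) sums lambert_tail k q"
    and lambert_tail_times: "suminf (\<lambda>n. of_nat (divisor_power_sum k (Suc n)) * q ^ Suc n) = q * lambert_tail k q"
proof -
  have le: "real (divisor_power_sum k (Suc n)) \<le> real (Suc n) ^ Suc k" for n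
    using norm_twisted_divisor_sum_le[of "Suc n" 0 0 k]
    by (simp add: twisted_divisor_sum_def divisor_power_sum_def nome_def flip: of_nat_power of_nat_sum)
  have *: "summable (\<lambda>n. of_nat (divisor_power_sum k (Suc n)) * q ^ Suc n)"
  proof (rule summable_comparison_test'[OF summable_power_times_geometric])
    show "norm (of_nat (divisor_power_sum k (Suc n)) * q ^ Suc n) \<le> real (Suc n) ^ Suc k * norm q ^ Suc n" for n
      unfolding norm_mult norm_power norm_of_nat by (intro mult_right_mono le) auto
  qed (use assms in auto)
  have "summable (\<lambda>n. of_nat (divisor_power_sum k (Suc n)) * q ^ n)"
  proof (cases "q = 0")
    case False
    have "summable (\<lambda>n. inverse q * (of_nat (divisor_power_sum k (Suc n)) * q ^ Suc n))"
      by (rule summable_mult[OF *])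
    thus ?thesis using False by (simp add: field_simps)
  qed (auto intro: summable_finite[of "{0}"])
  thus 1: "(\<lambda>n. of_nat (divisor_power_sum k (Suc n)) * q ^ n) sums lambert_tail k q"
    unfolding lambert_tail_def by (rule summable_sums)
  from sums_mult[OF this, of q]
  show "suminf (\<lambda>n. of_nat (divisor_power_sum k (Suc n)) * q ^ Suc n) = q * lambert_tail k q"
    by (simp add: sums_iff mult_ac)
qed

lemma lambert_tail_holomorphic: "lambert_tail k holomorphic_on ball 0 1"
  by (rule power_series_holomorphic[where a = "\<lambda>n. of_nat (divisor_power_sum k (Suc n))"])
     (use lambert_tail_sums in auto)

lemma lambert_tail_0: "lambert_tail k 0 = 1"
proof -
  have "{m::nat. m dvd Suc 0} = {1}" by auto
  thus ?thesis using lambert_tail_sums[of 0 k] powser_sums_zero_iff[of "\<lambda>n. of_nat (divisor_power_sum k (Suc n)) :: complex"]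
    by (simp add: divisor_power_sum_def)
qed

abbreviation c0 :: complex where "c0 \<equiv> 2 * of_real pi * \<i> / 12"

definition g1_q :: "complex \<Rightarrow> complex" where "g1_q q = c0 * (1 - 24 * (q * lambert_tail 1 q))"
definition g2_q :: "complex \<Rightarrow> complex" where "g2_q q = 12 * c0 ^ 2 * (1 + 240 * (q * lambert_tail 3 q))"
definition g3_q :: "complex \<Rightarrow> complex" where "g3_q q = 8 * c0 ^ 3 * (1 - 504 * (q * lambert_tail 5 q))"

lemma q_expansion_g1: "q_expansion g1 g1_q"
  and q_expansion_g2: "q_expansion g2 g2_q"
  and q_expansion_g3: "q_expansion g3 g3_q"
  unfolding q_expansion_def
  by (intro conjI allI impI;
      (unfold g1_q_def [abs_def] g2_q_def [abs_def] g3_q_def [abs_def],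
       intro holomorphic_intros lambert_tail_holomorphic)?;
      (simp only: g1_def g2_def g3_def eisenstein_E2_def eisenstein_E4_def eisenstein_E6_def
         g1_q_def g2_q_def g3_q_def lambert_tail_times norm_nome_less_1)?)+

text \<open>
  Differentiating a transformation law under \<open>\<tau> \<mapsto> -1/\<tau>\<close>.
\<close>

lemma deriv_inversion:
  assumes f: "q_expansion f F"
    and eq: "\<And>\<tau>. Im \<tau> > 0 \<Longrightarrow> f (- 1 / \<tau>) = r \<tau>"
    and r: "(r has_field_derivative r') (at \<tau>)" and pos: "Im \<tau> > 0"
  shows "deriv f (- 1 / \<tau>) = \<tau> ^ 2 * r'"
proof -
  have nz: "\<tau> \<noteq> 0" using pos by auto
  have "((\<lambda>\<tau>. - 1 / \<tau>) has_field_derivative 1 / \<tau> ^ 2) (at \<tau>)"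
    using nz by (auto intro!: derivative_eq_intros simp: power2_eq_square)
  hence "((\<lambda>\<tau>. f (- 1 / \<tau>)) has_field_derivative deriv f (- 1 / \<tau>) * (1 / \<tau> ^ 2)) (at \<tau>)"
    by (rule DERIV_chain2[where f = f and g = "\<lambda>\<tau>. - 1 / \<tau>", OF q_expansion_has_deriv[OF f Im_minus_inverse_pos[OF pos]]])
  moreover have "((\<lambda>\<tau>. f (- 1 / \<tau>)) has_field_derivative r') (at \<tau>)"
    by (rule has_field_derivative_transform_within_open[OF r open_upper_half_plane]) (use pos eq in auto)
  ultimately have "deriv f (- 1 / \<tau>) * (1 / \<tau> ^ 2) = r'" by (rule DERIV_unique)
  thus ?thesis using nz by (simp add: field_simps)
qed

lemma half_weight_g2: "half_weight 2 g2" and half_weight_g3: "half_weight 3 g3"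
  unfolding half_weight_def using g2_inversion g3_inversion by simp_all

lemma half_weight_diff: "half_weight n f \<Longrightarrow> half_weight n g \<Longrightarrow> half_weight n (\<lambda>\<tau>. f \<tau> - g \<tau>)"
  and half_weight_cmult: "half_weight n f \<Longrightarrow> half_weight n (\<lambda>\<tau>. c * f \<tau>)"
  by (auto simp: half_weight_def algebra_simps)

lemma half_weight_mult: "half_weight m f \<Longrightarrow> half_weight n g \<Longrightarrow> half_weight (m + n) (\<lambda>\<tau>. f \<tau> * g \<tau>)"
  by (simp add: half_weight_def power_add algebra_simps)

lemma half_weight_power: "half_weight m f \<Longrightarrow> half_weight (m * k) (\<lambda>\<tau>. f \<tau> ^ k)"
  by (simp add: half_weight_def power_mult_distrib power_mult [symmetric] algebra_simps)

lemma g1_has_deriv: "Im \<tau> > 0 \<Longrightarrow> (g1 has_field_derivative deriv g1 \<tau>) (at \<tau>)"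
  and g2_has_deriv: "Im \<tau> > 0 \<Longrightarrow> (g2 has_field_derivative deriv g2 \<tau>) (at \<tau>)"
  and g3_has_deriv: "Im \<tau> > 0 \<Longrightarrow> (g3 has_field_derivative deriv g3 \<tau>) (at \<tau>)"
  using q_expansion_has_deriv q_expansion_g1 q_expansion_g2 q_expansion_g3 by blast+

text \<open>
  The derivative of the quasimodular law for \<open>g\<^sub>1\<close> shows that \<open>g\<^sub>1\<^sup>2 - g\<^sub>1'\<close> is modular of weight 4.  Its value at the
  cusp agrees with that of \<open>g\<^sub>2/12\<close>, and there are no cusp forms of weight 4.
\<close>

lemma ramanujan_g1:
  assumes "Im \<tau> > 0"
  shows "(g1 has_field_derivative g1 \<tau> ^ 2 - g2 \<tau> / 12) (at \<tau>)"
proof -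
  define f where "f = (\<lambda>\<tau>. (g1 \<tau> ^ 2 - deriv g1 \<tau>) - (1 / 12) * g2 \<tau>)"
  have "half_weight 2 (\<lambda>\<tau>. g1 \<tau> ^ 2 - deriv g1 \<tau>)"
    unfolding half_weight_def
  proof (intro allI impI)
    fix \<tau> assume t: "Im \<tau> > 0"
    have "((\<lambda>\<tau>. \<tau> ^ 2 * g1 \<tau> + \<tau>) has_field_derivative (2 * \<tau> * g1 \<tau> + \<tau> ^ 2 * deriv g1 \<tau> + 1)) (at \<tau>)"
      using g1_has_deriv[OF t] by (auto intro!: derivative_eq_intros)
    from deriv_inversion[OF q_expansion_g1 g1_inversion this t]
    have "deriv g1 (- 1 / \<tau>) = \<tau> ^ 2 * (2 * \<tau> * g1 \<tau> + \<tau> ^ 2 * deriv g1 \<tau> + 1)" .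
    thus "g1 (- 1 / \<tau>) ^ 2 - deriv g1 (- 1 / \<tau>) = \<tau> ^ (2 * 2) * (g1 \<tau> ^ 2 - deriv g1 \<tau>)"
      unfolding g1_inversion[OF t] by (simp add: algebra_simps eval_nat_numeral)
  qed
  hence w: "half_weight 2 f" unfolding f_def
    by (rule half_weight_diff[OF _ half_weight_cmult[OF half_weight_g2]])
  have q: "q_expansion f (\<lambda>q. (g1_q q ^ 2 - 2 * pi * \<i> * q * deriv g1_q q) - (1/12) * g2_q q)"
    unfolding f_def
    by (intro q_expansion_diff q_expansion_power q_expansion_mult q_expansion_const
        q_expansion_deriv q_expansion_g1 q_expansion_g2)
  have "f \<tau> = 0"
    by (rule cusp_form_small_weight_eq_0[OF q _ w _ assms])
       (simp_all add: g1_q_def g2_q_def)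
  hence "deriv g1 \<tau> = g1 \<tau> ^ 2 - g2 \<tau> / 12" by (simp add: f_def algebra_simps)
  thus ?thesis using g1_has_deriv[OF assms] by simp
qed

text \<open>
  The correction by \<open>g\<^sub>1\<close> cancels the non-modular term that differentiation creates.
\<close>

lemma half_weight_Serre_derivative:
  assumes f: "q_expansion f F" and w: "half_weight n f" and n: "n > 0"
  shows "half_weight (Suc n) (\<lambda>\<tau>. of_nat (2 * n) * (g1 \<tau> * f \<tau>) - deriv f \<tau>)"
  unfolding half_weight_def
proof (intro allI impI)
  fix \<tau> assume t: "Im \<tau> > 0"
  have inv: "f (- 1 / \<tau>) = \<tau> ^ (2 * n) * f \<tau>" if "Im \<tau> > 0" for \<tau>
    using w that by (simp add: half_weight_def)
  have "((\<lambda>\<tau>. \<tau> ^ (2 * n) * f \<tau>) has_field_derivative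
      of_nat (2 * n) * \<tau> ^ (2 * n - 1) * f \<tau> + \<tau> ^ (2 * n) * deriv f \<tau>) (at \<tau>)"
    using q_expansion_has_deriv[OF f t] by (auto intro!: derivative_eq_intros)
  from deriv_inversion[OF f inv this t]
  have "deriv f (- 1 / \<tau>) =
      of_nat (2 * n) * (\<tau> * \<tau> * \<tau> ^ (2 * n - 1)) * f \<tau> + \<tau> ^ 2 * \<tau> ^ (2 * n) * deriv f \<tau>"
    by (simp add: algebra_simps power2_eq_square)
  also have "\<tau> * \<tau> * \<tau> ^ (2 * n - 1) = \<tau> * \<tau> ^ (2 * n)" using n by (cases n) auto
  finally show "of_nat (2 * n) * (g1 (- 1 / \<tau>) * f (- 1 / \<tau>)) - deriv f (- 1 / \<tau>) =
      \<tau> ^ (2 * Suc n) * (of_nat (2 * n) * (g1 \<tau> * f \<tau>) - deriv f \<tau>)"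
    unfolding g1_inversion[OF t] inv[OF t] by (simp add: algebra_simps power2_eq_square)
qed

lemma ramanujan_g2:
  assumes "Im \<tau> > 0"
  shows "(g2 has_field_derivative 4 * g1 \<tau> * g2 \<tau> - 6 * g3 \<tau>) (at \<tau>)"
proof -
  define f where "f = (\<lambda>\<tau>. (4 * (g1 \<tau> * g2 \<tau>) - deriv g2 \<tau>) - 6 * g3 \<tau>)"
  have "half_weight 3 (\<lambda>\<tau>. 4 * (g1 \<tau> * g2 \<tau>) - deriv g2 \<tau>)"
    using half_weight_Serre_derivative[OF q_expansion_g2 half_weight_g2] by simp
  hence w: "half_weight 3 f" unfolding f_def
    by (rule half_weight_diff[OF _ half_weight_cmult[OF half_weight_g3]])
  have q: "q_expansion f (\<lambda>q. (4 * (g1_q q * g2_q q) - 2 * pi * \<i> * q * deriv g2_q q) - 6 * g3_q q)"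
    unfolding f_def
    by (intro q_expansion_diff q_expansion_mult q_expansion_const
        q_expansion_deriv q_expansion_g1 q_expansion_g2 q_expansion_g3)
  have "f \<tau> = 0"
    by (rule cusp_form_small_weight_eq_0[OF q _ w _ assms])
       (simp_all add: g1_q_def g2_q_def g3_q_def eval_nat_numeral)
  thus ?thesis using g2_has_deriv[OF assms] by (simp add: f_def algebra_simps)
qed

lemma ramanujan_g3:
  assumes "Im \<tau> > 0"
  shows "(g3 has_field_derivative 6 * g1 \<tau> * g3 \<tau> - g2 \<tau> ^ 2 / 3) (at \<tau>)"
proof -
  define f where "f = (\<lambda>\<tau>. (6 * (g1 \<tau> * g3 \<tau>) - deriv g3 \<tau>) - (1/3) * g2 \<tau> ^ 2)"
  have "half_weight 4 (\<lambda>\<tau>. 6 * (g1 \<tau> * g3 \<tau>) - deriv g3 \<tau>)"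
    using half_weight_Serre_derivative[OF q_expansion_g3 half_weight_g3] by simp
  moreover have "half_weight 4 (\<lambda>\<tau>. g2 \<tau> ^ 2)" using half_weight_power[OF half_weight_g2, of 2] by simp
  ultimately have w: "half_weight 4 f" unfolding f_def
    by (rule half_weight_diff[OF _ half_weight_cmult])
  have q: "q_expansion f (\<lambda>q. (6 * (g1_q q * g3_q q) - 2 * pi * \<i> * q * deriv g3_q q) - (1/3) * g2_q q ^ 2)"
    unfolding f_def
    by (intro q_expansion_diff q_expansion_power q_expansion_mult q_expansion_const
        q_expansion_deriv q_expansion_g1 q_expansion_g2 q_expansion_g3)
  have "f \<tau> = 0"
    by (rule cusp_form_small_weight_eq_0[OF q _ w _ assms])
       (simp_all add: g1_q_def g2_q_def g3_q_def eval_nat_numeral)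
  thus ?thesis using g3_has_deriv[OF assms] by (simp add: f_def algebra_simps)
qed

definition discriminant :: "complex \<Rightarrow> complex" where
  "discriminant \<tau> = g2 \<tau> ^ 3 - 27 * g3 \<tau> ^ 2"

definition discriminant_q :: "complex \<Rightarrow> complex" where
  "discriminant_q q = g2_q q ^ 3 - 27 * g3_q q ^ 2"

lemma q_expansion_discriminant: "q_expansion discriminant discriminant_q"
  unfolding discriminant_def [abs_def] discriminant_q_def [abs_def]
  by (intro q_expansion_diff q_expansion_power q_expansion_mult q_expansion_const q_expansion_g2 q_expansion_g3)

lemma half_weight_discriminant: "half_weight 6 discriminant"
proof -
  have "half_weight 6 (\<lambda>\<tau>. g2 \<tau> ^ 3)" "half_weight 6 (\<lambda>\<tau>. g3 \<tau> ^ 2)"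
    using half_weight_power[OF half_weight_g2, of 3] half_weight_power[OF half_weight_g3, of 2] by simp_all
  thus ?thesis unfolding discriminant_def [abs_def] by (intro half_weight_diff half_weight_cmult)
qed

lemma discriminant_q_factor:
  obtains K where "K holomorphic_on ball 0 1" "\<And>q. discriminant_q q = q * K q" "K 0 \<noteq> 0"
proof -
  define L3 where "L3 = lambert_tail 3"
  define L5 where "L5 = lambert_tail 5"
  \<comment> \<open>the quotient \<open>((1 + 240 q L3)\<^sup>3 - (1 - 504 q L5)\<^sup>2) / q\<close>, times \<open>1728 c0\<^sup>6\<close>; its value at 0 is \<open>1728\<^sup>2 c0\<^sup>6\<close>\<close>
  define K where "K = (\<lambda>q. 1728 * c0 ^ 6 * (720 * L3 q + 172800 * q * L3 q ^ 2 + 13824000 * q ^ 2 * L3 q ^ 3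
      + 1008 * L5 q - 254016 * q * L5 q ^ 2))"
  have "K holomorphic_on ball 0 1"
    unfolding K_def L3_def L5_def by (intro holomorphic_intros lambert_tail_holomorphic)
  moreover have "discriminant_q q = q * K q" for q
    unfolding discriminant_q_def g2_q_def g3_q_def K_def L3_def L5_def
    by (simp only: power_mult_distrib) (simp add: algebra_simps eval_nat_numeral)
  moreover have "K 0 \<noteq> 0" by (simp add: K_def L3_def L5_def lambert_tail_0)
  ultimately show ?thesis using that by blast
qed

text \<open>
  Ramanujan's equations give \<open>\<Delta>' = 12 g\<^sub>1 \<Delta>\<close>, so \<open>\<Delta> exp(-A)\<close> is constant for a primitive \<open>A\<close> of \<open>12 g\<^sub>1\<close>.
  One zero would make \<open>\<Delta>\<close> vanish identically, but its expansion starts with a nonzero multiple of \<open>q\<close>.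
\<close>

lemma discriminant_nonzero:
  assumes "Im \<tau> > 0"
  shows "discriminant \<tau> \<noteq> 0"
proof
  assume zero: "discriminant \<tau> = 0"
  define H where "H = {\<tau>::complex. Im \<tau> > 0}"
  have H: "open H" "convex H" "connected H"
    unfolding H_def by (simp_all add: open_halfspace_Im_gt convex_halfspace_Im_gt convex_connected)
  have "(\<lambda>\<tau>. 12 * g1 \<tau>) holomorphic_on H"
    using ramanujan_g1 unfolding H_def
    by (intro holomorphic_intros) (auto simp: holomorphic_on_open[OF open_upper_half_plane])
  then obtain A where A: "\<And>\<tau>. \<tau> \<in> H \<Longrightarrow> (A has_field_derivative 12 * g1 \<tau>) (at \<tau> within H)"
    using holomorphic_convex_primitive'[OF H(2,1)] by blast
  have D: "(discriminant has_field_derivative 12 * g1 \<tau> * discriminant \<tau>) (at \<tau>)" if "\<tau> \<in> H" for \<tau>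
    unfolding discriminant_def [abs_def] using that ramanujan_g2[of \<tau>] ramanujan_g3[of \<tau>]
    by (auto simp: H_def intro!: derivative_eq_intros) (simp add: algebra_simps eval_nat_numeral)
  have "((\<lambda>\<tau>. discriminant \<tau> * exp (- A \<tau>)) has_field_derivative 0) (at \<tau> within H)" if "\<tau> \<in> H" for \<tau>
  proof -
    have "((\<lambda>\<tau>. exp (- A \<tau>)) has_field_derivative exp (- A \<tau>) * - (12 * g1 \<tau>)) (at \<tau> within H)"
      by (intro DERIV_chain2[OF DERIV_exp] DERIV_minus A that)
    from DERIV_mult[OF has_field_derivative_at_within[OF D[OF that]] this] show ?thesis
      by (simp add: algebra_simps)
  qed
  hence "\<exists>c. \<forall>\<tau>\<in>H. discriminant \<tau> * exp (- A \<tau>) = c"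
    by (rule has_field_derivative_zero_constant[OF H(2)])
  then obtain c where c: "\<And>\<tau>. \<tau> \<in> H \<Longrightarrow> discriminant \<tau> * exp (- A \<tau>) = c"
    by blast
  have "\<tau> \<in> H" using assms by (simp add: H_def)
  with c[of \<tau>] zero have "c = 0" by simp
  hence all0: "discriminant \<tau> = 0" if "Im \<tau> > 0" for \<tau> using c[of \<tau>] that by (simp add: H_def)
  obtain K where K: "K holomorphic_on ball 0 1" "\<And>q. discriminant_q q = q * K q" "K 0 \<noteq> 0"
    using discriminant_q_factor by blast
  have K0: "K q = 0" if "q \<in> ball 0 1 - {0}" for q
  proof -
    have "q \<noteq> 0" "norm q < 1" using that by auto
    then obtain t where "Im t > 0" "nome t = q" by (rule nome_surj)
    hence "discriminant_q q = 0" using all0[of t] q_expansion_discriminant by (auto simp: q_expansion_def)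
    thus ?thesis using K(2) that by auto
  qed
  have "K \<midarrow>0\<rightarrow> K 0"
    using holomorphic_on_imp_continuous_on[OF K(1)] by (simp add: continuous_on_eq_continuous_at isCont_def)
  moreover have "eventually (\<lambda>q. K q = 0) (at 0)"
    unfolding eventually_at_topological by (intro exI[of _ "ball 0 1"]) (use K0 in auto)
  hence "K \<midarrow>0\<rightarrow> 0" by (simp add: tendsto_eventually)
  ultimately show False using K(3) LIM_unique by blast
qed

section \<open>Modular forms of level one\<close>

text \<open>
  Polynomials in \<open>g\<^sub>2\<close> and \<open>g\<^sub>3\<close> that are homogeneous of weight \<open>n\<close> when \<open>g\<^sub>2, g\<^sub>3\<close> have weights 2 and 3.
\<close>

definition isobaric :: "nat \<Rightarrow> (complex \<Rightarrow> complex) \<Rightarrow> bool" where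
  "isobaric n f \<longleftrightarrow> (\<exists>c. \<forall>\<tau>. Im \<tau> > 0 \<longrightarrow>
     f \<tau> = (\<Sum>p | 2 * fst p + 3 * snd p = n. c p * g2 \<tau> ^ fst p * g3 \<tau> ^ snd p))"

lemma finite_weight_pairs: "finite {p :: nat \<times> nat. 2 * fst p + 3 * snd p = n}"
  by (rule finite_subset[of _ "{..n} \<times> {..n}"]) auto

lemma isobaric_cong:
  assumes "isobaric n f" "\<And>\<tau>. Im \<tau> > 0 \<Longrightarrow> g \<tau> = f \<tau>"
  shows "isobaric n g"
proof -
  obtain c where "\<forall>\<tau>. Im \<tau> > 0 \<longrightarrow>
     f \<tau> = (\<Sum>p | 2 * fst p + 3 * snd p = n. c p * g2 \<tau> ^ fst p * g3 \<tau> ^ snd p)"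
    using assms(1) unfolding isobaric_def by blast
  thus ?thesis unfolding isobaric_def by (intro exI[of _ c]) (simp add: assms(2))
qed

lemma isobaric_add:
  assumes "isobaric n f" "isobaric n g"
  shows "isobaric n (\<lambda>\<tau>. f \<tau> + g \<tau>)"
proof -
  obtain c d where "\<forall>\<tau>. Im \<tau> > 0 \<longrightarrow>
     f \<tau> = (\<Sum>p | 2 * fst p + 3 * snd p = n. c p * g2 \<tau> ^ fst p * g3 \<tau> ^ snd p)"
     "\<forall>\<tau>. Im \<tau> > 0 \<longrightarrow>
     g \<tau> = (\<Sum>p | 2 * fst p + 3 * snd p = n. d p * g2 \<tau> ^ fst p * g3 \<tau> ^ snd p)"
    using assms unfolding isobaric_def by blast
  thus ?thesis unfolding isobaric_def
    by (intro exI[of _ "\<lambda>p. c p + d p"]) (simp add: ring_distribs sum.distrib)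
qed

lemma isobaric_cmult:
  assumes "isobaric n f"
  shows "isobaric n (\<lambda>\<tau>. k * f \<tau>)"
proof -
  obtain c where "\<forall>\<tau>. Im \<tau> > 0 \<longrightarrow>
     f \<tau> = (\<Sum>p | 2 * fst p + 3 * snd p = n. c p * g2 \<tau> ^ fst p * g3 \<tau> ^ snd p)"
    using assms unfolding isobaric_def by blast
  thus ?thesis unfolding isobaric_def
    by (intro exI[of _ "\<lambda>p. k * c p"]) (simp add: sum_distrib_left mult_ac)
qed

lemma isobaric_monomial:
  assumes "2 * a + 3 * b = n"
  shows "isobaric n (\<lambda>\<tau>. g2 \<tau> ^ a * g3 \<tau> ^ b)"
  unfolding isobaric_def
proof (intro exI[of _ "\<lambda>p. if p = (a, b) then 1 else 0"] allI impI)
  fix \<tau>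
  have "(\<Sum>p | 2 * fst p + 3 * snd p = n. (if p = (a, b) then 1 else 0) * g2 \<tau> ^ fst p * g3 \<tau> ^ snd p) =
      (\<Sum>p | 2 * fst p + 3 * snd p = n. if p = (a, b) then g2 \<tau> ^ fst p * g3 \<tau> ^ snd p else 0)"
    by (intro sum.cong) auto
  also have "\<dots> = g2 \<tau> ^ a * g3 \<tau> ^ b"
    using assms by (subst sum.delta) (auto simp: finite_weight_pairs)
  finally show "g2 \<tau> ^ a * g3 \<tau> ^ b = 
     (\<Sum>p | 2 * fst p + 3 * snd p = n. (if p = (a, b) then 1 else 0) * g2 \<tau> ^ fst p * g3 \<tau> ^ snd p)" ..
qed

lemma isobaric_mult_monomial:
  assumes "isobaric n f" "m = n + 2 * a + 3 * b"
  shows "isobaric m (\<lambda>\<tau>. g2 \<tau> ^ a * g3 \<tau> ^ b * f \<tau>)"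
proof -
  obtain c where c: "\<And>\<tau>. Im \<tau> > 0 \<Longrightarrow>
     f \<tau> = (\<Sum>p | 2 * fst p + 3 * snd p = n. c p * g2 \<tau> ^ fst p * g3 \<tau> ^ snd p)"
    using assms unfolding isobaric_def by blast
  define s where "s = (\<lambda>p :: nat \<times> nat. (fst p + a, snd p + b))"
  define P where "P = (\<lambda>n. {p :: nat \<times> nat. 2 * fst p + 3 * snd p = n})"
  define c' where "c' = (\<lambda>p. if a \<le> fst p \<and> b \<le> snd p then c (fst p - a, snd p - b) else 0)"
  show ?thesis unfolding isobaric_def
  proof (intro exI[of _ c'] allI impI)
    fix \<tau> assume "Im \<tau> > 0"
    hence "g2 \<tau> ^ a * g3 \<tau> ^ b * f \<tau> = (\<Sum>p\<in>P n. c' (s p) * g2 \<tau> ^ fst (s p) * g3 \<tau> ^ snd (s p))"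
      by (simp add: c sum_distrib_left P_def c'_def s_def power_add mult_ac)
    also have "\<dots> = (\<Sum>p\<in>s ` P n. c' p * g2 \<tau> ^ fst p * g3 \<tau> ^ snd p)"
      by (subst sum.reindex) (auto simp: s_def inj_on_def)
    also have "\<dots> = (\<Sum>p\<in>P m. c' p * g2 \<tau> ^ fst p * g3 \<tau> ^ snd p)"
    proof (rule sum.mono_neutral_left)
      show "finite (P m)" by (simp add: P_def finite_weight_pairs)
      show "s ` P n \<subseteq> P m" using assms(2) by (auto simp: s_def P_def)
      show "\<forall>p\<in>P m - s ` P n. c' p * g2 \<tau> ^ fst p * g3 \<tau> ^ snd p = 0"
      proof
        fix p assume p: "p \<in> P m - s ` P n"
        have "\<not> (a \<le> fst p \<and> b \<le> snd p)"
        proof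
          assume ab: "a \<le> fst p \<and> b \<le> snd p"
          hence "p = s (fst p - a, snd p - b)" by (simp add: s_def)
          moreover have "(fst p - a, snd p - b) \<in> P n" using p ab assms(2) by (auto simp: P_def)
          ultimately show False using p by blast
        qed
        thus "c' p * g2 \<tau> ^ fst p * g3 \<tau> ^ snd p = 0" by (auto simp: c'_def)
      qed
    qed
    finally show "g2 \<tau> ^ a * g3 \<tau> ^ b * f \<tau> =
        (\<Sum>p | 2 * fst p + 3 * snd p = m. c' p * g2 \<tau> ^ fst p * g3 \<tau> ^ snd p)"
      by (simp add: P_def)
  qed
qed

lemma half_weight_monomial:
  "half_weight (2 * a + 3 * b) (\<lambda>\<tau>. g2 \<tau> ^ a * g3 \<tau> ^ b)"
  using half_weight_mult[OF half_weight_power[OF half_weight_g2, of a] half_weight_power[OF half_weight_g3, of b]]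
  by simp

lemma modular_form_cuspidal_part:
  assumes "q_expansion f F" "half_weight n f" "2 * a + 3 * b = n"
  obtains k G where "q_expansion (\<lambda>\<tau>. f \<tau> - k * (g2 \<tau> ^ a * g3 \<tau> ^ b)) G" "G 0 = 0"
    "half_weight n (\<lambda>\<tau>. f \<tau> - k * (g2 \<tau> ^ a * g3 \<tau> ^ b))"
    "k * (g2_q 0 ^ a * g3_q 0 ^ b) = F 0"
proof
  define e where "e = g2_q 0 ^ a * g3_q 0 ^ b"
  have "e \<noteq> 0" by (simp add: e_def g2_q_def g3_q_def)
  thus "F 0 / e * (g2_q 0 ^ a * g3_q 0 ^ b) = F 0" by (simp add: e_def)
  show "q_expansion (\<lambda>\<tau>. f \<tau> - F 0 / e * (g2 \<tau> ^ a * g3 \<tau> ^ b)) (\<lambda>q. F q - F 0 / e * (g2_q q ^ a * g3_q q ^ b))"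
    by (intro q_expansion_diff q_expansion_mult q_expansion_const q_expansion_power
        q_expansion_g2 q_expansion_g3 assms)
  show "F 0 - F 0 / e * (g2_q 0 ^ a * g3_q 0 ^ b) = 0" using \<open>e \<noteq> 0\<close> by (simp add: e_def)
  have "half_weight n (\<lambda>\<tau>. g2 \<tau> ^ a * g3 \<tau> ^ b)" using half_weight_monomial[of a b] assms(3) by simp
  thus "half_weight n (\<lambda>\<tau>. f \<tau> - F 0 / e * (g2 \<tau> ^ a * g3 \<tau> ^ b))"
    by (rule half_weight_diff[OF assms(2) half_weight_cmult])
qed

lemma modular_form_small_weight:
  assumes "q_expansion f F" "half_weight n f" "2 * a + 3 * b = n" "n \<le> 5"
  obtains k where "\<And>\<tau>. Im \<tau> > 0 \<Longrightarrow> f \<tau> = k * (g2 \<tau> ^ a * g3 \<tau> ^ b)" "k * (g2_q 0 ^ a * g3_q 0 ^ b) = F 0"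
proof -
  obtain k G where kG: "q_expansion (\<lambda>\<tau>. f \<tau> - k * (g2 \<tau> ^ a * g3 \<tau> ^ b)) G" "G 0 = 0"
    "half_weight n (\<lambda>\<tau>. f \<tau> - k * (g2 \<tau> ^ a * g3 \<tau> ^ b))" "k * (g2_q 0 ^ a * g3_q 0 ^ b) = F 0"
    by (rule modular_form_cuspidal_part[OF assms(1-3)])
  show ?thesis
  proof (rule that[of k])
    show "f \<tau> = k * (g2 \<tau> ^ a * g3 \<tau> ^ b)" if "Im \<tau> > 0" for \<tau>
      using cusp_form_small_weight_eq_0[OF kG(1-3) assms(4) that] by simp
  qed (rule kG(4))
qed

text \<open>
  The square and the cube of a form of weight 2 are multiples \<open>k2 g\<^sub>2\<close> and \<open>k3 g\<^sub>3\<close>.  Comparing sixth powers, and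
  their values at the cusp, gives \<open>k2\<^sup>3 \<Delta> = 0\<close>.
\<close>

lemma modular_form_half_weight_1_eq_0:
  assumes F: "q_expansion f F" and w: "half_weight 1 f" and pos: "Im \<tau> > 0"
  shows "f \<tau> = 0"
proof -
  have w2: "half_weight 2 (\<lambda>\<tau>. f \<tau> ^ 2)" and w3: "half_weight 3 (\<lambda>\<tau>. f \<tau> ^ 3)"
    using half_weight_power[OF w, of 2] half_weight_power[OF w, of 3] by simp_all
  obtain k2 where k2: "\<And>\<tau>. Im \<tau> > 0 \<Longrightarrow> f \<tau> ^ 2 = k2 * (g2 \<tau> ^ 1 * g3 \<tau> ^ 0)" "k2 * (g2_q 0 ^ 1 * g3_q 0 ^ 0) = F 0 ^ 2"
    by (rule modular_form_small_weight[OF q_expansion_power[OF F] w2, of 1 0]) auto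
  obtain k3 where k3: "\<And>\<tau>. Im \<tau> > 0 \<Longrightarrow> f \<tau> ^ 3 = k3 * (g2 \<tau> ^ 0 * g3 \<tau> ^ 1)" "k3 * (g2_q 0 ^ 0 * g3_q 0 ^ 1) = F 0 ^ 3"
    by (rule modular_form_small_weight[OF q_expansion_power[OF F] w3, of 0 1]) auto
  have "k2 ^ 3 * g2 \<tau> ^ 3 = k3 ^ 2 * g3 \<tau> ^ 2"
  proof -
    have "k2 ^ 3 * g2 \<tau> ^ 3 = (f \<tau> ^ 2) ^ 3" using k2(1)[OF pos] by (simp add: power_mult_distrib)
    also have "\<dots> = (f \<tau> ^ 3) ^ 2" by (simp flip: power_mult)
    also have "\<dots> = k3 ^ 2 * g3 \<tau> ^ 2" using k3(1)[OF pos] by (simp add: power_mult_distrib)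
    finally show ?thesis .
  qed
  moreover have "k3 ^ 2 = 27 * k2 ^ 3"
  proof -
    have "k2 ^ 3 * g2_q 0 ^ 3 = (F 0 ^ 2) ^ 3" using k2(2) by (simp flip: power_mult_distrib)
    also have "\<dots> = (F 0 ^ 3) ^ 2" by (simp flip: power_mult)
    also have "\<dots> = k3 ^ 2 * g3_q 0 ^ 2" using k3(2) by (simp flip: power_mult_distrib)
    finally have "(k3 ^ 2) * (64 * c0 ^ 6) = (27 * k2 ^ 3) * (64 * c0 ^ 6)"
      unfolding g2_q_def g3_q_def power_mult_distrib by (simp add: algebra_simps eval_nat_numeral)
    thus ?thesis by (subst (asm) mult_cancel_right) simp
  qed
  ultimately have "k2 ^ 3 * discriminant \<tau> = 0" by (simp add: discriminant_def algebra_simps)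
  hence "k2 = 0" using discriminant_nonzero[OF pos] by simp
  thus ?thesis using k2(1)[OF pos] by simp
qed

text \<open>
  Induction on the weight: subtracting a multiple of a monomial in \<open>g\<^sub>2, g\<^sub>3\<close> leaves a cusp form.  In small weight
  this is 0; otherwise it is divisible by the discriminant, which has no zero in the upper half plane and a simple zero at the
  cusp.  Weight 2 is the one weight without a monomial.
\<close>

theorem modular_form_isobaric:
  assumes "q_expansion f F" "half_weight n f"
  shows "isobaric n f"
  using assms
proof (induction n arbitrary: f F rule: less_induct)
  case (less n)
  show ?case
  proof (cases "n = 1")
    case True
    have "isobaric n (\<lambda>_. 0 :: complex)"
      unfolding isobaric_def by (intro exI[of _ "\<lambda>_. 0"]) simp
    thus ?thesis
    proof (rule isobaric_cong)
      show "f \<tau> = 0" if "Im \<tau> > 0" for \<tau>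
        by (rule modular_form_half_weight_1_eq_0[OF less.prems(1) _ that]) (use less.prems(2) True in simp)
    qed
  next
    case False
    have "\<exists>a b. 2 * a + 3 * b = n"
    proof (cases "even n")
      case True
      then obtain m where "n = 2 * m" by (rule evenE)
      thus ?thesis by (intro exI[of _ m] exI[of _ 0]) simp
    next
      case odd: False
      then obtain m where "n = 2 * m + 1" by (rule oddE)
      with False show ?thesis by (intro exI[of _ "m - 1"] exI[of _ 1]) (cases m; simp)
    qed
    then obtain a b where ab: "2 * a + 3 * b = n" by blast
    obtain k G where kG: "q_expansion (\<lambda>\<tau>. f \<tau> - k * (g2 \<tau> ^ a * g3 \<tau> ^ b)) G" "G 0 = 0"
      "half_weight n (\<lambda>\<tau>. f \<tau> - k * (g2 \<tau> ^ a * g3 \<tau> ^ b))" "k * (g2_q 0 ^ a * g3_q 0 ^ b) = F 0"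
      by (rule modular_form_cuspidal_part[OF less.prems ab])
    define f' where "f' = (\<lambda>\<tau>. f \<tau> - k * (g2 \<tau> ^ a * g3 \<tau> ^ b))"
    have "isobaric n f'"
    proof (cases "n \<le> 5")
      case True
      have "isobaric n (\<lambda>_. 0 :: complex)"
        unfolding isobaric_def by (intro exI[of _ "\<lambda>_. 0"]) simp
      thus ?thesis unfolding f'_def
        by (rule isobaric_cong) (rule cusp_form_small_weight_eq_0[OF kG(1-3) True])
    next
      case n: False
      obtain G1 where G1: "G1 holomorphic_on ball 0 1" "\<And>q. q \<in> ball 0 1 \<Longrightarrow> G q = q * G1 q"
        using q_expansion_factor[of G] kG by (auto simp: q_expansion_def)
      obtain K where K: "K holomorphic_on ball 0 1" "\<And>q. discriminant_q q = q * K q" "K 0 \<noteq> 0"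
        using discriminant_q_factor by blast
      have disc_K: "discriminant \<tau> = nome \<tau> * K (nome \<tau>)" if "Im \<tau> > 0" for \<tau>
        using q_expansion_discriminant K(2) that by (simp add: q_expansion_def)
      have K_nz: "K q \<noteq> 0" if q: "q \<in> ball 0 1" for q
      proof (cases "q = 0")
        case False
        hence "q \<noteq> 0" "norm q < 1" using q by auto
        then obtain t where "Im t > 0" "nome t = q" by (rule nome_surj)
        thus ?thesis using disc_K[of t] discriminant_nonzero[of t] by auto
      qed (use K in auto)
      define h where "h = (\<lambda>\<tau>. f' \<tau> / discriminant \<tau>)"
      have "q_expansion h (\<lambda>q. G1 q / K q)"
        unfolding q_expansion_def
      proof (intro conjI allI impI)
        show "(\<lambda>q. G1 q / K q) holomorphic_on ball 0 1"
          using K_nz by (intro holomorphic_intros G1(1) K(1)) auto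
        fix \<tau> assume t: "Im \<tau> > 0"
        have "f' \<tau> = nome \<tau> * G1 (nome \<tau>)"
          using kG(1) G1(2)[OF nome_in_ball[OF t]] t by (simp add: q_expansion_def f'_def)
        thus "h \<tau> = G1 (nome \<tau>) / K (nome \<tau>)" by (simp add: h_def disc_K[OF t])
      qed
      moreover have "half_weight (n - 6) h"
        unfolding half_weight_def
      proof (intro allI impI)
        fix \<tau> assume t: "Im \<tau> > 0"
        have nz: "\<tau> \<noteq> 0" using t by auto
        have "f' (- 1 / \<tau>) = \<tau> ^ (2 * n) * f' \<tau>"
          using kG(3) t by (simp add: half_weight_def f'_def)
        moreover have "discriminant (- 1 / \<tau>) = \<tau> ^ 12 * discriminant \<tau>"
          using half_weight_discriminant t by (simp add: half_weight_def)
        moreover have "2 * n = 2 * (n - 6) + 12" using n by simp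
        ultimately show "h (- 1 / \<tau>) = \<tau> ^ (2 * (n - 6)) * h \<tau>"
          using nz unfolding h_def by (simp add: power_add)
      qed
      ultimately have h: "isobaric (n - 6) h" using less.IH[of "n - 6" h] n by auto
      have "isobaric n (\<lambda>\<tau>. g2 \<tau> ^ 3 * g3 \<tau> ^ 0 * h \<tau> + (- 27) * (g2 \<tau> ^ 0 * g3 \<tau> ^ 2 * h \<tau>))"
        using n by (intro isobaric_add isobaric_cmult isobaric_mult_monomial[OF h]) auto
      thus ?thesis
      proof (rule isobaric_cong)
        fix \<tau> assume t: "Im \<tau> > 0"
        have "f' \<tau> = discriminant \<tau> * h \<tau>" using discriminant_nonzero[OF t] by (simp add: h_def)
        thus "f' \<tau> = g2 \<tau> ^ 3 * g3 \<tau> ^ 0 * h \<tau> + (- 27) * (g2 \<tau> ^ 0 * g3 \<tau> ^ 2 * h \<tau>)"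
          by (simp add: discriminant_def algebra_simps)
      qed
    qed
    hence "isobaric n (\<lambda>\<tau>. f' \<tau> + k * (g2 \<tau> ^ a * g3 \<tau> ^ b))"
      by (intro isobaric_add isobaric_cmult isobaric_monomial ab)
    thus ?thesis by (simp add: f'_def)
  qed
qed

text \<open>
  The function \<open>f\<close> descends to the punctured disc by local branches of the logarithm, and boundedness removes the
  singularity at 0.
\<close>

lemma periodic_bounded_imp_q_expansion:
  assumes holo: "f holomorphic_on {\<tau>. Im \<tau> > 0}"
    and per: "\<And>\<tau>. Im \<tau> > 0 \<Longrightarrow> f (\<tau> + 1) = f \<tau>"
    and bdd: "\<And>\<tau>. Im \<tau> \<ge> 1 \<Longrightarrow> norm (f \<tau>) \<le> B"
  shows "\<exists>F. q_expansion f F"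
proof -
  define F0 where "F0 = (\<lambda>q. f (Ln q / (2 * pi * \<i>)))"
  have F0: "F0 (nome \<tau>) = f \<tau>" if t: "Im \<tau> > 0" for \<tau>
  proof -
    define t' where "t' = Ln (nome \<tau>) / (2 * pi * \<i>)"
    have "nome t' = nome \<tau>" by (simp add: t'_def nome_def)
    hence "nome (t' - \<tau>) = 1" by (simp add: nome_diff)
    then obtain k :: int where "t' - \<tau> = of_int k" by (auto simp: nome_eq_1_iff)
    hence "t' = \<tau> + of_int k" by (simp add: algebra_simps)
    thus ?thesis using periodic_int_shift[of f, OF per t, of k] by (simp add: F0_def t'_def)
  qed
  have "F0 holomorphic_on (ball 0 1 - {0})"
    unfolding holomorphic_on_def
  proof
    fix q0 :: complex assume q0: "q0 \<in> ball 0 1 - {0}"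
    hence q0': "q0 \<noteq> 0" "norm q0 < 1" by auto
    obtain \<tau>0 where t0: "Im \<tau>0 > 0" "nome \<tau>0 = q0" by (rule nome_surj[OF q0'])
    \<comment> \<open>a branch of \<open>log q / (2\<pi>\<i>)\<close> that is holomorphic near \<open>q0\<close>; it may differ from the principal branch by an integer\<close>
    define g where "g = (\<lambda>q. \<tau>0 + Ln (q / q0) / (2 * pi * \<i>))"
    define U where "U = ball 0 1 - {0} - {q. q / q0 \<in> \<real>\<^sub>\<le>\<^sub>0}"
    have nome_g: "nome (g q) = q" if "q \<noteq> 0" for q
      using that t0 q0' by (simp add: g_def nome_add) (simp add: nome_def)
    have g_pos: "Im (g q) > 0" if "q \<in> U" for q
      using nome_g[of q] norm_nome_less_1[of "g q"] that by (auto simp: U_def)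
    have "closed {q. q / q0 \<in> \<real>\<^sub>\<le>\<^sub>0}"
      using continuous_closed_vimage[OF closed_nonpos_Reals_complex, of "\<lambda>q. q / q0"] q0'
      by (simp add: vimage_def continuous_intros)
    hence U: "open U" "q0 \<in> U" using q0 by (auto simp: U_def intro!: open_Diff)
    have "g holomorphic_on U" unfolding g_def using q0'
      by (intro holomorphic_intros) (auto simp: U_def)
    hence "f \<circ> g holomorphic_on U"
      by (rule holomorphic_on_compose) (rule holomorphic_on_subset[OF holo], use g_pos in auto)
    moreover have "F0 q = (f \<circ> g) q" if "q \<in> U" for q
      using F0[OF g_pos[OF that]] nome_g[of q] that by (simp add: U_def)
    ultimately have "F0 holomorphic_on U" by (metis holomorphic_transform)
    thus "F0 field_differentiable at q0 within ball 0 1 - {0}"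
      using U by (meson field_differentiable_at_within holomorphic_on_imp_differentiable_at)
  qed
  moreover have "\<exists>B. eventually (\<lambda>z. norm (F0 z) \<le> B) (at 0)"
  proof (intro exI)
    show "eventually (\<lambda>z. norm (F0 z) \<le> B) (at 0)"
      unfolding eventually_at_topological
    proof (intro exI[of _ "ball 0 (exp (- 2 * pi))"] conjI ballI impI)
      fix q :: complex assume q: "q \<in> ball 0 (exp (- 2 * pi))" "q \<noteq> 0"
      have "norm q < 1" using q by (auto intro: less_trans[of _ "exp (- 2 * pi)"])
      with q obtain t where t: "Im t > 0" "nome t = q" using nome_surj by metis
      have "exp (- 2 * pi * Im t) < exp (- 2 * pi)" using q t norm_nome[of t] by simp
      hence "Im t \<ge> 1" by simp
      thus "norm (F0 q) \<le> B" using bdd F0[OF t(1)] t(2) by metis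
    qed auto
  qed
  ultimately obtain F where F: "F holomorphic_on ball 0 1" "\<And>q. q \<in> ball 0 1 - {0} \<Longrightarrow> F q = F0 q"
    using holomorphic_on_extend_bounded[of F0 "ball 0 1" 0] by auto
  have "q_expansion f F"
    unfolding q_expansion_def using F F0 nome_in_ball by auto
  thus ?thesis by blast
qed

section \<open>Counting primitive triangular matrices\<close>

text \<open>
  The triple \<open>(a, b, e)\<close> stands for the matrix with rows \<open>(a, b)\<close> and \<open>(0, e)\<close>: these represent the
  primitive integer matrices of determinant \<open>d\<close> modulo \<open>SL\<^sub>2(\<int>)\<close> acting from the left.
\<close>

definition hecke_triples :: "nat \<Rightarrow> (nat \<times> nat \<times> nat) set" where
  "hecke_triples d = {(a, b, e). a * e = d \<and> b < e \<and> (\<forall>t. t dvd a \<and> t dvd b \<and> t dvd e \<longrightarrow> t = 1)}"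

lemma finite_hecke_triples:
  assumes "d > 0"
  shows "finite (hecke_triples d)"
proof (rule finite_subset)
  show "hecke_triples d \<subseteq> {..d} \<times> {..d} \<times> {..d}"
  proof
    fix x assume "x \<in> hecke_triples d"
    then obtain a b e where x: "x = (a, b, e)" "a * e = d" "b < e" by (auto simp: hecke_triples_def)
    have "a dvd d" "e dvd d" using x by auto
    hence "a \<le> d" "e \<le> d" using assms by (auto dest: dvd_imp_le)
    thus "x \<in> {..d} \<times> {..d} \<times> {..d}" using x by auto
  qed
qed auto

lemma gcd_times_gcd_coprime:
  fixes x u v :: nat
  assumes "coprime u v" "x dvd u * v"
  shows "gcd x u * gcd x v = x"
proof (rule dvd_antisym)
  have "coprime (gcd x u) (gcd x v)"
    using assms(1) by (meson coprime_divisors gcd_dvd2)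
  thus "gcd x u * gcd x v dvd x" by (intro divides_mult) auto
  obtain y z where "x = y * z" "y dvd u" "z dvd v" using assms(2) division_decomp[of x u v] by blast
  thus "x dvd gcd x u * gcd x v" by (auto intro!: mult_dvd_mono)
qed

text \<open>
  Taking the parts that divide \<open>u\<close> is the map to the local factor at \<open>u\<close>.
\<close>

lemma hecke_triple_gcd:
  assumes "coprime u v" "u > 0" "v > 0" "(a, b, e) \<in> hecke_triples (u * v)"
  shows "(gcd a u, b mod gcd e u, gcd e u) \<in> hecke_triples u"
proof -
  have abe: "a * e = u * v" "b < e" "\<And>t. t dvd a \<Longrightarrow> t dvd b \<Longrightarrow> t dvd e \<Longrightarrow> t = 1"
    using assms(4) by (auto simp: hecke_triples_def)
  have a: "gcd a u * gcd a v = a" and e: "gcd e u * gcd e v = e"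
    by (rule gcd_times_gcd_coprime[OF assms(1)]; metis abe(1) dvd_triv_left dvd_triv_right)+
  have *: "gcd a u * gcd e u dvd u" if "coprime u v" "a * e = u * v" for a e u v :: nat
  proof -
    have "gcd a u * gcd e u dvd u * v" unfolding that(2)[symmetric] by (intro mult_dvd_mono) auto
    moreover have "coprime (gcd a u * gcd e u) v"
      using that(1) by (metis coprime_divisors coprime_mult_left_iff dvd_refl gcd_dvd2)
    ultimately show ?thesis by (simp add: coprime_dvd_mult_left_iff)
  qed
  have 1: "gcd a u * gcd e u dvd u" using *[OF assms(1) abe(1)] .
  have 2: "gcd a v * gcd e v dvd v"
    using *[of v u a e] assms(1) abe(1) by (simp add: coprime_commute mult.commute)
  have "(gcd a u * gcd e u) * (gcd a v * gcd e v) = u * v"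
    using abe(1) by (subst (asm) a[symmetric], subst (asm) e[symmetric]) (simp add: mult_ac)
  moreover have "gcd a u * gcd e u \<le> u" "gcd a v * gcd e v \<le> v"
    using 1 2 assms by (auto intro: dvd_imp_le)
  ultimately have "gcd a u * gcd e u = u"
    using mult_less_le_imp_less[of "gcd a u * gcd e u" u "gcd a v * gcd e v" v] assms
    by (cases "gcd a u * gcd e u < u") auto
  moreover have "gcd e u > 0" using assms by simp
  moreover have "t = 1" if "t dvd gcd a u" "t dvd b mod gcd e u" "t dvd gcd e u" for t
  proof (rule abe(3))
    show "t dvd b" using that by (metis dvd_mod_iff)
  qed (use that in auto)
  ultimately show ?thesis by (auto simp: hecke_triples_def)
qed

text \<open>
  A triple for \<open>uv\<close> is determined by its parts at \<open>u\<close> and at \<open>v\<close>, the entry \<open>b\<close> by the Chinese remainder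
  theorem.
\<close>

lemma card_hecke_triples_mult_le:
  assumes "coprime u v" "u > 0" "v > 0"
  shows "card (hecke_triples (u * v)) \<le> card (hecke_triples u) * card (hecke_triples v)"
proof -
  define \<phi> where "\<phi> = (\<lambda>(a, b, e). ((gcd a u, b mod gcd e u, gcd e u), (gcd a v, b mod gcd e v, gcd e v)))"
  have "\<phi> ` hecke_triples (u * v) \<subseteq> hecke_triples u \<times> hecke_triples v"
    using hecke_triple_gcd[OF assms] hecke_triple_gcd[of v u] assms
    by (auto simp: \<phi>_def coprime_commute mult.commute)
  moreover have "inj_on \<phi> (hecke_triples (u * v))"
  proof (rule inj_onI)
    fix x y assume xy: "x \<in> hecke_triples (u * v)" "y \<in> hecke_triples (u * v)" "\<phi> x = \<phi> y"
    obtain a b e a' b' e' where x: "x = (a, b, e)" and y: "y = (a', b', e')" by (metis prod_cases3)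
    have abe: "a * e = u * v" "b < e" and abe': "a' * e' = u * v" "b' < e'"
      using xy x y by (auto simp: hecke_triples_def)
    have g: "gcd a u * gcd a v = a" "gcd e u * gcd e v = e" "gcd a' u * gcd a' v = a'" "gcd e' u * gcd e' v = e'"
      by (rule gcd_times_gcd_coprime[OF assms(1)]; metis abe(1) abe'(1) dvd_triv_left dvd_triv_right)+
    have eq: "gcd a u = gcd a' u" "gcd a v = gcd a' v" "gcd e u = gcd e' u" "gcd e v = gcd e' v"
      "[b = b'] (mod gcd e u)" "[b = b'] (mod gcd e v)"
      using xy(3) by (auto simp: \<phi>_def x y cong_def)
    have "a = a'" "e = e'" using g eq by metis+
    moreover have "coprime (gcd e u) (gcd e v)" using assms(1) by (meson coprime_divisors gcd_dvd2)
    hence "[b = b'] (mod e)" using coprime_cong_mult_nat[OF eq(5,6)] g(2) by simp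
    hence "b = b'" using abe abe' \<open>e = e'\<close> by (simp add: cong_def)
    ultimately show "x = y" by (simp add: x y)
  qed
  ultimately have "card (hecke_triples (u * v)) \<le> card (hecke_triples u \<times> hecke_triples v)"
    using assms by (intro card_inj_on_le) (auto simp: finite_hecke_triples)
  thus ?thesis by (simp add: card_cartesian_product)
qed

text \<open>
  Here \<open>a = p\<^sup>j\<close> and \<open>e = p\<^sup>k\<^sup>-\<^sup>j\<close>.  For \<open>j = 0\<close> all \<open>p\<^sup>k\<close> values of \<open>b\<close> occur.  For \<open>j > 0\<close> the map sends
  \<open>b\<close> to \<open>b p\<^sup>j\<^sup>-\<^sup>1 < p\<^sup>k\<^sup>-\<^sup>1\<close>; it is injective because \<open>p\<close> does not divide \<open>b\<close> when \<open>0 < j < k\<close>, so the \<open>p\<close>-adic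
  valuation of the image recovers \<open>j\<close>, while \<open>j = k\<close> yields 0.
\<close>

lemma card_hecke_triples_prime_power_le:
  assumes p: "prime p" and k: "k > 0"
  shows "card (hecke_triples (p ^ k)) \<le> p ^ k + p ^ (k - 1)"
proof -
  define \<phi> where "\<phi> = (\<lambda>(a, b, e::nat). if a = 1 then Inl b else Inr (b * (a div p)))"
  have p1: "p > 1" using p by (rule prime_gt_1_nat)
  have form: "\<exists>j. a = p ^ j \<and> e = p ^ (k - j) \<and> j \<le> k \<and> (j = k \<longrightarrow> b = 0) \<and> (0 < j \<and> j < k \<longrightarrow> \<not> p dvd b)"
    if "(a, b, e) \<in> hecke_triples (p ^ k)" for a b e
  proof -
    have abe: "a * e = p ^ k" "b < e" "\<And>t. t dvd a \<Longrightarrow> t dvd b \<Longrightarrow> t dvd e \<Longrightarrow> t = 1"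
      using that by (auto simp: hecke_triples_def)
    have "a dvd p ^ k" using abe(1) by (metis dvd_triv_left)
    then obtain j where j: "j \<le> k" "a = p ^ j" using p by (auto simp: divides_primepow_nat)
    have "p ^ j * e = p ^ j * p ^ (k - j)" using abe(1) j by (simp flip: power_add)
    hence e: "e = p ^ (k - j)" using p1 by simp
    have "\<not> p dvd b" if "0 < j" "j < k"
    proof
      assume "p dvd b"
      with abe(3)[of p] j e that have "p = 1" by auto
      thus False using p1 by simp
    qed
    thus ?thesis using j e abe(2) by auto
  qed
  have "\<phi> ` hecke_triples (p ^ k) \<subseteq> {..<p ^ k} <+> {..<p ^ (k - 1)}"
  proof (rule image_subsetI)
    fix x assume x: "x \<in> hecke_triples (p ^ k)"
    obtain a b e where abe: "x = (a, b, e)" by (metis prod_cases3)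
    obtain j where j: "a = p ^ j" "e = p ^ (k - j)" "j \<le> k" using form x abe by blast
    have b: "b < e" using x abe by (auto simp: hecke_triples_def)
    show "\<phi> x \<in> {..<p ^ k} <+> {..<p ^ (k - 1)}"
    proof (cases "j = 0")
      case False
      then obtain i where i: "j = Suc i" by (cases j) auto
      have "b * p ^ i < p ^ (k - j) * p ^ i" using b j p1 by simp
      also have "\<dots> = p ^ (k - 1)" using j i by (simp flip: power_add)
      finally show ?thesis using p1 by (auto simp: \<phi>_def abe j i)
    qed (use b j in \<open>auto simp: \<phi>_def abe\<close>)
  qed
  moreover have "inj_on \<phi> (hecke_triples (p ^ k))"
  proof (rule inj_onI)
    fix x y assume xy: "x \<in> hecke_triples (p ^ k)" "y \<in> hecke_triples (p ^ k)" "\<phi> x = \<phi> y"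
    obtain a b e a' b' e' where x: "x = (a, b, e)" and y: "y = (a', b', e')" by (metis prod_cases3)
    obtain j where j: "a = p ^ j" "e = p ^ (k - j)" "j \<le> k" "j = k \<longrightarrow> b = 0" "0 < j \<and> j < k \<longrightarrow> \<not> p dvd b"
      using form xy x by blast
    obtain j' where j': "a' = p ^ j'" "e' = p ^ (k - j')" "j' \<le> k" "j' = k \<longrightarrow> b' = 0" "0 < j' \<and> j' < k \<longrightarrow> \<not> p dvd b'"
      using form xy y by blast
    have pj: "p ^ i = 1 \<longleftrightarrow> i = 0" "p ^ i = Suc 0 \<longleftrightarrow> i = 0" for i using p1 by auto
    show "x = y"
    proof (cases "j = 0")
      case True
      hence "j' = 0" using xy(3) p1 by (auto simp: \<phi>_def x y j j' pj split: if_splits)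
      thus ?thesis using True xy(3) p1 by (auto simp: \<phi>_def x y j j')
    next
      case False
      hence "j' \<noteq> 0" using xy(3) p1 by (auto simp: \<phi>_def x y j j' pj split: if_splits)
      obtain i i' where i: "j = Suc i" "j' = Suc i'" using False \<open>j' \<noteq> 0\<close> by (metis not0_implies_Suc)
      have eq: "b * p ^ i = b' * p ^ i'"
        using xy(3) False \<open>j' \<noteq> 0\<close> p1 by (auto simp: \<phi>_def x y j j' pj i)
      have *: False if "i < i'" "b * p ^ i = b' * p ^ i'" "i' < k" "b = 0 \<longrightarrow> b' = 0" "\<not> p dvd b \<or> b = 0 \<and> \<not> p dvd b'" for i i' b b' :: nat
      proof -
        have pi: "p ^ i' = p ^ i * p ^ (i' - i)" using that by (simp flip: power_add)
        have "b * p ^ i = (b' * p ^ (i' - i)) * p ^ i" unfolding that(2) pi by (simp only: mult_ac)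
        hence "b = b' * p ^ (i' - i)" using p1 by auto
        moreover have "p dvd p ^ (i' - i)" using that by simp
        ultimately show False using that by auto
      qed
      have jj: "j = j'"
      proof (rule ccontr)
        assume ne: "j \<noteq> j'"
        show False
        proof (cases "j = k \<or> j' = k")
          case True
          hence "b = 0 \<and> j' < k \<or> b' = 0 \<and> j < k" using j j' ne by auto
          hence "b = 0 \<and> b' = 0" using eq p1 by auto
          thus False using True j j' ne False \<open>j' \<noteq> 0\<close> by auto
        next
          case nk: False
          hence "\<not> p dvd b" "\<not> p dvd b'" using j j' False \<open>j' \<noteq> 0\<close> by auto
          hence "b \<noteq> 0" "b' \<noteq> 0" by (metis dvd_0_right)+
          thus False using *[of i i' b b'] *[of i' i b' b] eq ne i j(3) j'(3) \<open>\<not> p dvd b\<close> \<open>\<not> p dvd b'\<close>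
            by (cases "i < i'") auto
        qed
      qed
      with eq i p1 have "b = b'" by simp
      with jj show ?thesis by (simp add: x y j j')
    qed
  qed
  ultimately have "card (hecke_triples (p ^ k)) \<le> card ({..<p ^ k} <+> {..<p ^ (k - 1)})"
    by (intro card_inj_on_le) auto
  thus ?thesis by (simp add: card_Plus)
qed

lemma dedekind_psi_prime_power_mult:
  assumes p: "prime p" "k > 0" "\<not> p dvd m" "m > 0"
  shows "dedekind_psi (p ^ k * m) = of_nat (p ^ k + p ^ (k - 1)) * dedekind_psi m"
proof -
  have eq: "{q. prime q \<and> q dvd p ^ k * m} = insert p {q. prime q \<and> q dvd m}"
  proof -
    have "q dvd p ^ k * m \<longleftrightarrow> q = p \<or> q dvd m" if "prime q" for q
    proof -
      have "q dvd p ^ k \<longleftrightarrow> q = p"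
        using p that by (auto simp: prime_dvd_power_iff dest: primes_dvd_imp_eq)
      thus ?thesis using that by (simp add: prime_dvd_mult_iff)
    qed
    thus ?thesis using p(1) by auto
  qed
  have fin: "finite {q. prime q \<and> q dvd m}"
    by (rule finite_subset[of _ "{..m}"]) (use p(4) in \<open>auto dest: dvd_imp_le\<close>)
  have p0: "of_nat p \<noteq> (0 :: rat)" using p(1) by auto
  have "p ^ k = p * p ^ (k - 1)" using p(2) by (cases k) auto
  hence pk: "of_nat (p ^ k) * (1 + 1 / of_nat p) = (of_nat (p ^ k + p ^ (k - 1)) :: rat)"
    using p0 by (simp add: field_simps)
  have "dedekind_psi (p ^ k * m) = of_nat (p ^ k) * of_nat m *
      ((1 + 1 / of_nat p) * (\<Prod>q | prime q \<and> q dvd m. 1 + 1 / of_nat q))"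
    unfolding dedekind_psi_def eq by (subst prod.insert) (use fin p in auto)
  also have "\<dots> = (of_nat (p ^ k) * (1 + 1 / of_nat p)) * dedekind_psi m"
    by (simp add: dedekind_psi_def)
  finally show ?thesis by (simp only: pk)
qed

text \<open>
  The lemma also records that \<open>\<psi>(d)\<close> is a natural number, by induction over the prime powers in \<open>d\<close>.
\<close>

theorem card_hecke_triples_le_psi:
  assumes "d > 0"
  shows "\<exists>\<Psi>. dedekind_psi d = of_nat \<Psi> \<and> card (hecke_triples d) \<le> \<Psi>"
  using assms
proof (induction d rule: less_induct)
  case (less d)
  show ?case
  proof (cases "d = 1")
    case True
    have "hecke_triples 1 \<subseteq> {(1, 0, 1)}" by (auto simp: hecke_triples_def)
    hence "card (hecke_triples 1) \<le> card {(1::nat, 0::nat, 1::nat)}" by (intro card_mono) auto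
    moreover have "{p::nat. prime p \<and> p dvd 1} = {}" by auto
    hence "dedekind_psi 1 = 1" unfolding dedekind_psi_def by (simp only: prod.empty of_nat_1 mult_1)
    ultimately show ?thesis using True by (intro exI[of _ 1]) auto
  next
    case False
    then obtain p where p: "prime p" "p dvd d" using less.prems by (metis prime_factor_nat)
    define k where "k = multiplicity p d"
    have "\<not> is_unit p" using p(1) by auto
    moreover have "d \<noteq> 0" using less.prems by simp
    ultimately obtain m where m: "d = p ^ k * m" "\<not> p dvd m"
      unfolding k_def by (metis multiplicity_decompose')
    have k: "k > 0" using p m by (cases k) auto
    have m0: "m > 0" using m less.prems by (cases m) auto
    have "p ^ k > 1" using p(1) k prime_gt_1_nat one_less_power by blast
    hence "m < d" using m m0 by simp
    from less.IH[OF this m0] obtain \<Psi> where Psi: "dedekind_psi m = of_nat \<Psi>" "card (hecke_triples m) \<le> \<Psi>" by blast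
    have cop: "coprime (p ^ k) m" using p(1) m(2) by (simp add: prime_imp_coprime)
    have "card (hecke_triples d) \<le> card (hecke_triples (p ^ k)) * card (hecke_triples m)"
      unfolding m(1) by (rule card_hecke_triples_mult_le[OF cop]) (use p m0 in \<open>auto simp: prime_gt_0_nat\<close>)
    also have "\<dots> \<le> (p ^ k + p ^ (k - 1)) * \<Psi>"
      by (intro mult_mono card_hecke_triples_prime_power_le Psi p k) auto
    finally show ?thesis
      using dedekind_psi_prime_power_mult[OF p(1) k m(2) m0] Psi m(1)
      by (intro exI[of _ "(p ^ k + p ^ (k - 1)) * \<Psi>"]) simp
  qed
qed

section \<open>The orbit of a function under the modular group\<close>

definition primitive_matrix :: "int \<Rightarrow> int \<Rightarrow> int \<Rightarrow> int \<Rightarrow> int \<Rightarrow> bool" where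
  "primitive_matrix d a b c e \<longleftrightarrow> a * e - b * c = d \<and>
     (\<forall>t. t dvd a \<and> t dvd b \<and> t dvd c \<and> t dvd e \<longrightarrow> t dvd 1)"

lemma primitive_matrix_left_S:
  "primitive_matrix d a b c e \<Longrightarrow> primitive_matrix d (- c) (- e) a b"
  by (auto simp: primitive_matrix_def algebra_simps)

lemma primitive_matrix_right_S:
  "primitive_matrix d a b c e \<Longrightarrow> primitive_matrix d b (- a) e (- c)"
  by (auto simp: primitive_matrix_def algebra_simps)

lemma primitive_matrix_left_T:
  assumes "primitive_matrix d a b c e"
  shows "primitive_matrix d (a + k * c) (b + k * e) c e"
proof -
  have "t dvd a" if "t dvd a + k * c" "t dvd c" for t
    using that by (metis dvd_add_left_iff dvd_mult)
  moreover have "t dvd b" if "t dvd b + k * e" "t dvd e" for t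
    using that by (metis dvd_add_left_iff dvd_mult)
  ultimately show ?thesis using assms unfolding primitive_matrix_def by (auto simp: algebra_simps)
qed

lemma primitive_matrix_right_T:
  assumes "primitive_matrix d a b c e"
  shows "primitive_matrix d a (a + b) c (c + e)"
proof -
  have "t dvd b" if "t dvd a + b" "t dvd a" for t
    using that by (metis dvd_add_right_iff)
  moreover have "t dvd e" if "t dvd c + e" "t dvd c" for t
    using that by (metis dvd_add_right_iff)
  ultimately show ?thesis using assms unfolding primitive_matrix_def by (auto simp: algebra_simps)
qed

text \<open>
  Elementary symmetric functions are invariant under permutations of the roots.
\<close>

lemma sum_subsets_reindex:
  fixes \<phi> :: "'a \<Rightarrow> 'b :: comm_semiring_1"
  assumes "inj_on h A" "h ` A = A"
  shows "(\<Sum>U | U \<subseteq> A \<and> card U = k. \<Prod>f\<in>U. \<phi> (h f)) = (\<Sum>U | U \<subseteq> A \<and> card U = k. \<Prod>f\<in>U. \<phi> f)"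
proof -
  have inj: "inj_on h U" if "U \<subseteq> A" for U using assms(1) that by (rule inj_on_subset)
  have bij: "bij_betw (image h) {U. U \<subseteq> A \<and> card U = k} {U. U \<subseteq> A \<and> card U = k}"
  proof (rule bij_betwI')
    fix U V assume "U \<in> {U. U \<subseteq> A \<and> card U = k}" "V \<in> {U. U \<subseteq> A \<and> card U = k}"
    thus "(h ` U = h ` V) = (U = V)" using assms(1) by (simp add: inj_on_image_eq_iff)
  next
    fix U assume U: "U \<in> {U. U \<subseteq> A \<and> card U = k}"
    hence "h ` U \<subseteq> A" "card (h ` U) = k" using assms inj by (auto simp: card_image)
    thus "h ` U \<in> {U. U \<subseteq> A \<and> card U = k}" by simp
  next
    fix V assume V: "V \<in> {U. U \<subseteq> A \<and> card U = k}"
    hence "V \<subseteq> h ` A" using assms by simp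
    then obtain U where "U \<subseteq> A" "V = h ` U" by (meson subset_imageE)
    thus "\<exists>U\<in>{U. U \<subseteq> A \<and> card U = k}. V = h ` U"
      using V inj by (auto simp: card_image)
  qed
  have "(\<Sum>U | U \<subseteq> A \<and> card U = k. \<Prod>f\<in>U. \<phi> (h f)) = (\<Sum>U | U \<subseteq> A \<and> card U = k. \<Prod>f\<in>h ` U. \<phi> f)"
    by (intro sum.cong refl) (auto simp: prod.reindex inj)
  also have "\<dots> = (\<Sum>U | U \<subseteq> A \<and> card U = k. \<Prod>f\<in>U. \<phi> f)"
    by (rule sum.reindex_bij_betw[OF bij])
  finally show ?thesis .
qed

text \<open>
  A polynomial vanishes at each of its roots; the inner sums are the signed elementary symmetric functions of the
  roots.
\<close>

lemma vieta_subset_sums: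
  fixes x :: "'a \<Rightarrow> complex"
  assumes "finite A" "g \<in> A"
  shows "(\<Sum>k\<le>card A. (\<Sum>U | U \<subseteq> A \<and> card U = k. \<Prod>f\<in>U. - x f) * x g ^ (card A - k)) = 0"
proof -
  have "0 = (\<Prod>f\<in>A. - x f + x g)" using assms by (intro prod_zero[symmetric]) auto
  also have "\<dots> = (\<Sum>U\<in>Pow A. (\<Prod>f\<in>U. - x f) * (\<Prod>f\<in>A - U. x g))" by (rule prod_add[OF assms(1)])
  also have "\<dots> = (\<Sum>U\<in>Pow A. (\<Prod>f\<in>U. - x f) * x g ^ (card A - card U))"
    using assms(1) by (intro sum.cong) (auto simp: card_Diff_subset finite_subset)
  also have "\<dots> = (\<Sum>k\<le>card A. \<Sum>U | U \<in> Pow A \<and> card U = k. (\<Prod>f\<in>U. - x f) * x g ^ (card A - card U))"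
    using assms(1) by (subst sum.group) (auto intro: card_mono)
  also have "\<dots> = (\<Sum>k\<le>card A. (\<Sum>U | U \<subseteq> A \<and> card U = k. \<Prod>f\<in>U. - x f) * x g ^ (card A - k))"
    by (simp add: sum_distrib_right)
  finally show ?thesis ..
qed

text \<open>
  The family \<open>T\<close> assigns a function to each primitive matrix \<open>(a, b; c, e)\<close> of determinant \<open>d\<close>, does not change under left
  multiplication by the generators \<open>S\<close> and \<open>T\<close> of the modular group, and is permuted by the slash action of weight \<open>2n\<close>, which
  multiplies the matrix from the right.  The Euclidean algorithm on the first column reduces every matrix to an upper triangular
  one, so the family consists of at most \<open>card (hecke_triples d)\<close> functions on the upper half plane.  The slash action permutes
  this finite set, hence its elementary symmetric functions are modular forms, and the polynomial with these roots is the
  relation.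
\<close>

theorem modular_orbit_relation:
  fixes T :: "int \<Rightarrow> int \<Rightarrow> int \<Rightarrow> int \<Rightarrow> complex \<Rightarrow> complex" and d n :: nat
  assumes d: "d > 0"
    and left_T: "\<And>a b c e \<tau>. primitive_matrix d a b c e \<Longrightarrow> Im \<tau> > 0 \<Longrightarrow> T (a + c) (b + e) c e \<tau> = T a b c e \<tau>"
    and left_S: "\<And>a b c e \<tau>. primitive_matrix d a b c e \<Longrightarrow> Im \<tau> > 0 \<Longrightarrow> T (- c) (- e) a b \<tau> = T a b c e \<tau>"
    and right_T: "\<And>a b c e \<tau>. primitive_matrix d a b c e \<Longrightarrow> Im \<tau> > 0 \<Longrightarrow> T a b c e (\<tau> + 1) = T a (a + b) c (c + e) \<tau>"
    and right_S: "\<And>a b c e \<tau>. primitive_matrix d a b c e \<Longrightarrow> Im \<tau> > 0 \<Longrightarrow>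
        T a b c e (- 1 / \<tau>) = \<tau> ^ (2 * n) * T b (- a) e (- c) \<tau>"
    and holo: "\<And>a b c e. primitive_matrix d a b c e \<Longrightarrow> T a b c e holomorphic_on {\<tau>. Im \<tau> > 0}"
    and bdd: "\<And>a b e. primitive_matrix d a b 0 e \<Longrightarrow> \<exists>B. \<forall>\<tau>. Im \<tau> \<ge> 1 \<longrightarrow> norm (T a b 0 e \<tau>) \<le> B"
  shows "\<exists>N s. N \<le> card (hecke_triples d) \<and> (\<forall>\<tau>. s 0 \<tau> = 1) \<and> (\<forall>k\<le>N. isobaric (n * k) (s k)) \<and>
     (\<forall>\<tau>. Im \<tau> > 0 \<longrightarrow> (\<Sum>k\<le>N. s k \<tau> * T d 0 0 1 \<tau> ^ (N - k)) = 0)"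
proof -
  \<comment> \<open>functions are set to 0 off the upper half plane, so that they are equal iff they agree on it, and can be counted\<close>
  define restr where "restr = (\<lambda>f \<tau>. if Im \<tau> > 0 then f \<tau> else (0 :: complex))"
  have restr_eq: "restr f = restr g" if "\<And>\<tau>. Im \<tau> > 0 \<Longrightarrow> f \<tau> = g \<tau>" for f g
    using that by (auto simp: restr_def)
  define \<F> where "\<F> = (\<lambda>(a, b, e). restr (T (int a) (int b) 0 (int e))) ` hecke_triples d"
  have fin: "finite \<F>" by (simp add: \<F>_def finite_hecke_triples d)
  have left_T_k: "T (a + k * c) (b + k * e) c e \<tau> = T a b c e \<tau>"
    if M: "primitive_matrix d a b c e" and t: "Im \<tau> > 0" for a b c e k \<tau>
  proof (induction k rule: int_induct[of _ 0])
    case (step1 k)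
    have "T (a + (k + 1) * c) (b + (k + 1) * e) c e \<tau> = T (a + k * c + c) (b + k * e + e) c e \<tau>"
      by (simp add: algebra_simps)
    also have "\<dots> = T (a + k * c) (b + k * e) c e \<tau>"
      by (rule left_T[OF primitive_matrix_left_T[OF M] t])
    finally show ?case using step1 by simp
  next
    case (step2 k)
    have "T (a + k * c) (b + k * e) c e \<tau> = T (a + (k - 1) * c + c) (b + (k - 1) * e + e) c e \<tau>"
      by (simp add: algebra_simps)
    also have "\<dots> = T (a + (k - 1) * c) (b + (k - 1) * e) c e \<tau>"
      by (rule left_T[OF primitive_matrix_left_T[OF M] t])
    finally show ?case using step2 by simp
  qed auto
  have neg: "T (- a) (- b) (- c) (- e) \<tau> = T a b c e \<tau>"
    if M: "primitive_matrix d a b c e" and t: "Im \<tau> > 0" for a b c e \<tau>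
    using left_S[OF M t] left_S[OF primitive_matrix_left_S[OF M] t] by simp
  have pos_case: "restr (T a b 0 e) \<in> \<F>" if M: "primitive_matrix d a b 0 e" and a: "a > 0" for a b e
  proof -
    have ae: "a * e = int d" using M by (simp add: primitive_matrix_def)
    have e: "e > 0" using ae a d by (metis of_nat_0_less_iff zero_less_mult_pos)
    define b' where "b' = b + (- (b div e)) * e"
    have b': "b' = b mod e" by (simp add: b'_def minus_div_mult_eq_mod)
    have "primitive_matrix d (a + (- (b div e)) * 0) b' 0 e"
      unfolding b'_def by (rule primitive_matrix_left_T[OF M])
    hence M': "primitive_matrix d a b' 0 e" by simp
    have "(nat a, nat b', nat e) \<in> hecke_triples d"
      unfolding hecke_triples_def
    proof (safe)
      show "nat a * nat e = d" using ae a e by (metis nat_int nat_mult_distrib less_imp_le)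
      show "nat b' < nat e" using e by (simp add: b')
      fix t assume t: "t dvd nat a" "t dvd nat b'" "t dvd nat e"
      have "b' \<ge> 0" using e by (simp add: b')
      have "int t dvd a" "int t dvd b'" "int t dvd e"
        using t a e \<open>b' \<ge> 0\<close> by (metis int_dvd_int_iff int_nat_eq less_imp_le)+
      hence "int t dvd 1" using M' by (auto simp: primitive_matrix_def)
      thus "t = 1" by simp
    qed
    moreover have "restr (T a b 0 e) = restr (T (int (nat a)) (int (nat b')) 0 (int (nat e)))"
    proof (rule restr_eq)
      fix \<tau> assume t: "Im \<tau> > 0"
      have "b' \<ge> 0" using e by (simp add: b')
      thus "T a b 0 e \<tau> = T (int (nat a)) (int (nat b')) 0 (int (nat e)) \<tau>"
        using left_T_k[OF M t, of "- (b div e)"] a e by (simp add: b'_def)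
    qed
    ultimately show ?thesis unfolding \<F>_def by (intro image_eqI) auto
  qed
  have reduce: "restr (T a b c e) \<in> \<F>" if "primitive_matrix d a b c e" for a b c e
    using that
  proof (induction "nat \<bar>c\<bar>" arbitrary: a b c e rule: less_induct)
    case less
    show ?case
    proof (cases "c = 0")
      case True
      have M: "primitive_matrix d a b 0 e" using less.prems True by simp
      hence "a * e = int d" by (simp add: primitive_matrix_def)
      hence "a \<noteq> 0" using d by auto
      show ?thesis
      proof (cases "a > 0")
        case False
        have M': "primitive_matrix d (- a) (- b) 0 (- e)"
          using M by (auto simp: primitive_matrix_def)
        have "restr (T a b 0 e) = restr (T (- a) (- b) 0 (- e))"
          by (rule restr_eq) (use neg[OF M] in simp)
        thus ?thesis using pos_case[OF M'] False \<open>a \<noteq> 0\<close> True by simp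
      qed (use pos_case[OF M] True in simp)
    next
      case False
      \<comment> \<open>one step of the Euclidean algorithm on the first column \<open>(a, c)\<close>\<close>
      define k where "k = - (a div c)"
      define a' where "a' = a + k * c"
      define b' where "b' = b + k * e"
      have a': "a' = a mod c" by (simp add: a'_def k_def minus_div_mult_eq_mod)
      have M': "primitive_matrix d a' b' c e"
        unfolding a'_def b'_def by (rule primitive_matrix_left_T[OF less.prems])
      have "\<bar>a'\<bar> < \<bar>c\<bar>" unfolding a' using False by (rule abs_mod_less)
      hence "restr (T (- c) (- e) a' b') \<in> \<F>"
        by (intro less.hyps primitive_matrix_left_S M') auto
      moreover have "restr (T a b c e) = restr (T (- c) (- e) a' b')"
        by (rule restr_eq) (use left_S[OF M'] left_T_k[OF less.prems, of _ k] in \<open>simp add: a'_def b'_def\<close>)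
      ultimately show ?thesis by simp
    qed
  qed
  have F_elem: "\<exists>a b e. primitive_matrix d a b 0 e \<and> f = restr (T a b 0 e)" if f: "f \<in> \<F>" for f
  proof -
    obtain a b e where abe: "(a, b, e) \<in> hecke_triples d" "f = restr (T (int a) (int b) 0 (int e))"
      using f by (auto simp: \<F>_def)
    have "primitive_matrix d (int a) (int b) 0 (int e)"
      unfolding primitive_matrix_def
    proof (intro conjI allI impI)
      show "int a * int e - int b * 0 = int d" using abe(1) by (auto simp: hecke_triples_def)
      fix t assume t: "t dvd int a \<and> t dvd int b \<and> t dvd 0 \<and> t dvd int e"
      hence "nat \<bar>t\<bar> dvd a" "nat \<bar>t\<bar> dvd b" "nat \<bar>t\<bar> dvd e" by (simp_all add: nat_abs_dvd_iff)
      hence "nat \<bar>t\<bar> = 1" using abe(1) by (auto simp: hecke_triples_def)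
      thus "t dvd 1" by (metis nat_abs_dvd_iff nat_dvd_1_iff_1 of_nat_1)
    qed
    thus ?thesis using abe(2) by blast
  qed
  \<comment> \<open>the slash action of \<open>\<tau> \<mapsto> -1/\<tau>\<close> and of \<open>\<tau> \<mapsto> \<tau> + 1\<close>\<close>
  define St where "St = (\<lambda>f. restr (\<lambda>\<tau>. f (- 1 / \<tau>) / \<tau> ^ (2 * n)))"
  define Tt where "Tt = (\<lambda>f. restr (\<lambda>\<tau>. f (\<tau> + 1) :: complex))"
  have F_off: "f \<tau> = 0" if "f \<in> \<F>" "\<not> Im \<tau> > 0" for f \<tau>
    using F_elem[OF that(1)] that(2) by (auto simp: restr_def)
  have St_app: "f (- 1 / \<tau>) = \<tau> ^ (2 * n) * St f \<tau>" if "Im \<tau> > 0" for f \<tau>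
  proof -
    have "\<tau> \<noteq> 0" using that by auto
    thus ?thesis using that by (simp add: St_def restr_def)
  qed
  have Tt_app: "f (\<tau> + 1) = Tt f \<tau>" if "Im \<tau> > 0" for f \<tau>
    using that by (simp add: Tt_def restr_def)
  have "St ` \<F> \<subseteq> \<F>"
  proof (rule image_subsetI)
    fix f assume "f \<in> \<F>"
    then obtain a b e where M: "primitive_matrix d a b 0 e" and f: "f = restr (T a b 0 e)" using F_elem by blast
    have "St f = restr (T b (- a) e (- 0))"
      unfolding St_def
    proof (rule restr_eq)
      fix \<tau> assume t: "Im \<tau> > 0"
      hence "\<tau> \<noteq> 0" by auto
      thus "f (- 1 / \<tau>) / \<tau> ^ (2 * n) = T b (- a) e (- 0) \<tau>"
        using right_S[OF M t] Im_minus_inverse_pos[OF t] by (simp add: f restr_def)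
    qed
    thus "St f \<in> \<F>" using reduce[OF primitive_matrix_right_S[OF M]] by simp
  qed
  moreover have inj_St: "inj_on St \<F>"
  proof (rule inj_onI)
    fix f g assume fg: "f \<in> \<F>" "g \<in> \<F>" "St f = St g"
    show "f = g"
    proof
      fix \<tau>
      show "f \<tau> = g \<tau>"
      proof (cases "Im \<tau> > 0")
        case True
        have "f (- 1 / (- 1 / \<tau>)) = g (- 1 / (- 1 / \<tau>))"
          using St_app[OF Im_minus_inverse_pos[OF True]] fg(3) by metis
        thus ?thesis by simp
      qed (use F_off[OF fg(1)] F_off[OF fg(2)] in simp)
    qed
  qed
  ultimately have St_img: "St ` \<F> = \<F>" using endo_inj_surj[OF fin] by blast
  have "Tt ` \<F> \<subseteq> \<F>"
  proof (rule image_subsetI)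
    fix f assume "f \<in> \<F>"
    then obtain a b e where M: "primitive_matrix d a b 0 e" and f: "f = restr (T a b 0 e)" using F_elem by blast
    have "Tt f = restr (T a (a + b) 0 (0 + e))"
      unfolding Tt_def by (rule restr_eq) (use right_T[OF M] in \<open>simp add: f restr_def\<close>)
    thus "Tt f \<in> \<F>" using reduce[OF primitive_matrix_right_T[OF M]] by simp
  qed
  moreover have inj_Tt: "inj_on Tt \<F>"
  proof (rule inj_onI)
    fix f g assume fg: "f \<in> \<F>" "g \<in> \<F>" "Tt f = Tt g"
    show "f = g"
    proof
      fix \<tau>
      show "f \<tau> = g \<tau>"
      proof (cases "Im \<tau> > 0")
        case True
        hence "f (\<tau> - 1 + 1) = g (\<tau> - 1 + 1)"
          using Tt_app[of "\<tau> - 1"] fg(3) by (metis diff_zero minus_complex.sel(2) one_complex.sel(2))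
        thus ?thesis by simp
      qed (use F_off[OF fg(1)] F_off[OF fg(2)] in simp)
    qed
  qed
  ultimately have Tt_img: "Tt ` \<F> = \<F>" using endo_inj_surj[OF fin] by blast
  define s where "s = (\<lambda>k \<tau>. \<Sum>U | U \<subseteq> \<F> \<and> card U = k. \<Prod>f\<in>U. - f \<tau>)"
  have finU: "finite {U. U \<subseteq> \<F> \<and> card U = k}" for k
    by (rule finite_subset[of _ "Pow \<F>"]) (use fin in auto)
  have s_isobaric: "isobaric (n * k) (s k)" for k
  proof -
    have "\<exists>F. q_expansion (s k) F"
    proof (rule ex_forward[OF _ ])
      have "\<exists>B. \<forall>\<tau>. Im \<tau> \<ge> 1 \<longrightarrow> norm (f \<tau>) \<le> B" if "f \<in> \<F>" for f
      proof -
        obtain a b e where M: "primitive_matrix d a b 0 e" and f: "f = restr (T a b 0 e)" using F_elem \<open>f \<in> \<F>\<close> by blast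
        obtain B where "\<forall>\<tau>. Im \<tau> \<ge> 1 \<longrightarrow> norm (T a b 0 e \<tau>) \<le> B" using bdd[OF M] by blast
        thus ?thesis by (intro exI[of _ B]) (auto simp: f restr_def)
      qed
      then obtain B where B: "\<And>f \<tau>. f \<in> \<F> \<Longrightarrow> Im \<tau> \<ge> 1 \<Longrightarrow> norm (f \<tau>) \<le> B f" by metis
      show "\<exists>F. q_expansion (s k) F"
      proof (rule periodic_bounded_imp_q_expansion)
        have "f holomorphic_on {\<tau>. Im \<tau> > 0}" if "f \<in> \<F>" for f
        proof -
          obtain a b e where M: "primitive_matrix d a b 0 e" and f: "f = restr (T a b 0 e)" using F_elem \<open>f \<in> \<F>\<close> by blast
          show ?thesis by (rule holomorphic_transform[OF holo[OF M]]) (simp add: f restr_def)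
        qed
        thus "s k holomorphic_on {\<tau>. Im \<tau> > 0}"
          unfolding s_def by (intro holomorphic_on_sum holomorphic_on_prod holomorphic_on_minus) auto
      next
        fix \<tau> :: complex assume t: "Im \<tau> > 0"
        show "s k (\<tau> + 1) = s k \<tau>"
          unfolding s_def Tt_app[OF t] by (rule sum_subsets_reindex[OF inj_Tt Tt_img, of "\<lambda>f. - f \<tau>"])
      next
        fix \<tau> :: complex assume t: "Im \<tau> \<ge> 1"
        show "norm (s k \<tau>) \<le> (\<Sum>U | U \<subseteq> \<F> \<and> card U = k. \<Prod>f\<in>U. B f)"
          unfolding s_def
        proof (rule sum_norm_le)
          fix U assume U: "U \<in> {U. U \<subseteq> \<F> \<and> card U = k}"
          have "norm (\<Prod>f\<in>U. - f \<tau>) = (\<Prod>f\<in>U. norm (f \<tau>))" by (simp flip: prod_norm)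
          also have "\<dots> \<le> (\<Prod>f\<in>U. B f)" using B t U by (intro prod_mono) auto
          finally show "norm (\<Prod>f\<in>U. - f \<tau>) \<le> (\<Prod>f\<in>U. B f)" .
        qed
      qed
    qed
    moreover have "half_weight (n * k) (s k)"
      unfolding half_weight_def
    proof (intro allI impI)
      fix \<tau> :: complex assume t: "Im \<tau> > 0"
      have "s k (- 1 / \<tau>) = (\<Sum>U | U \<subseteq> \<F> \<and> card U = k. \<Prod>f\<in>U. \<tau> ^ (2 * n) * - St f \<tau>)"
        unfolding s_def St_app[OF t] by simp
      also have "\<dots> = (\<Sum>U | U \<subseteq> \<F> \<and> card U = k. \<tau> ^ (2 * (n * k)) * (\<Prod>f\<in>U. - St f \<tau>))"
      proof (intro sum.cong refl)
        fix U assume "U \<in> {U. U \<subseteq> \<F> \<and> card U = k}"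
        hence "(\<tau> ^ (2 * n)) ^ card U = \<tau> ^ (2 * (n * k))" by (simp flip: power_mult add: mult.assoc)
        thus "(\<Prod>f\<in>U. \<tau> ^ (2 * n) * - St f \<tau>) = \<tau> ^ (2 * (n * k)) * (\<Prod>f\<in>U. - St f \<tau>)"
          by (simp only: prod.distrib prod_constant)
      qed
      also have "\<dots> = \<tau> ^ (2 * (n * k)) * (\<Sum>U | U \<subseteq> \<F> \<and> card U = k. \<Prod>f\<in>U. - St f \<tau>)"
        by (simp add: sum_distrib_left)
      also have "(\<Sum>U | U \<subseteq> \<F> \<and> card U = k. \<Prod>f\<in>U. - St f \<tau>) = s k \<tau>"
        unfolding s_def by (rule sum_subsets_reindex[OF inj_St St_img, of "\<lambda>f. - f \<tau>"])
      finally show "s k (- 1 / \<tau>) = \<tau> ^ (2 * (n * k)) * s k \<tau>" .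
    qed
    ultimately show ?thesis using modular_form_isobaric by blast
  qed
  have M1: "primitive_matrix d d 0 0 1" by (auto simp: primitive_matrix_def)
  show ?thesis
  proof (intro exI[of _ "card \<F>"] exI[of _ s] conjI allI impI)
    show "card \<F> \<le> card (hecke_triples d)"
      unfolding \<F>_def by (rule card_image_le) (rule finite_hecke_triples[OF d])
    fix \<tau> :: complex
    have "{U. U \<subseteq> \<F> \<and> card U = 0} = {{}}" using fin by (auto dest: finite_subset)
    thus "s 0 \<tau> = 1" by (simp add: s_def)
    assume t: "Im \<tau> > 0"
    show "(\<Sum>k\<le>card \<F>. s k \<tau> * T d 0 0 1 \<tau> ^ (card \<F> - k)) = 0"
      using vieta_subset_sums[OF fin reduce[OF M1], of "\<lambda>f. f \<tau>"] t by (simp add: s_def restr_def)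
  qed (rule s_isobaric)
qed

section \<open>The modular equation\<close>

definition mobius :: "int \<Rightarrow> int \<Rightarrow> int \<Rightarrow> int \<Rightarrow> complex \<Rightarrow> complex" where
  "mobius a b c e \<tau> = (of_int a * \<tau> + of_int b) / (of_int c * \<tau> + of_int e)"

lemma linear_form_nonzero:
  assumes "Im \<tau> > 0" "c \<noteq> 0 \<or> e \<noteq> 0"
  shows "of_int c * \<tau> + of_int e \<noteq> (0 :: complex)"
proof
  assume *: "of_int c * \<tau> + of_int e = (0 :: complex)"
  from arg_cong[OF this, of Im] assms(1) have "c = 0" by simp
  with * assms(2) show False by simp
qed

lemma primitive_matrix_rows_nonzero:
  assumes "primitive_matrix (int d) a b c e" "d > 0"
  shows "a \<noteq> 0 \<or> b \<noteq> 0" "c \<noteq> 0 \<or> e \<noteq> 0"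
  using assms by (auto simp: primitive_matrix_def)

lemma Im_mobius_pos:
  assumes M: "primitive_matrix (int d) a b c e" and d: "d > 0" and t: "Im \<tau> > 0"
  shows "Im (mobius a b c e \<tau>) > 0"
proof -
  define D where "D = of_int c * \<tau> + of_int e"
  have "D \<noteq> 0" unfolding D_def by (rule linear_form_nonzero[OF t primitive_matrix_rows_nonzero(2)[OF M d]])
  have det: "real_of_int a * real_of_int e - real_of_int b * real_of_int c = real d"
    using M by (metis primitive_matrix_def of_int_diff of_int_mult of_int_of_nat_eq)
  have "Im (mobius a b c e \<tau>) =
     (real_of_int a * Im \<tau> * (real_of_int c * Re \<tau> + real_of_int e)
        - (real_of_int a * Re \<tau> + real_of_int b) * (real_of_int c * Im \<tau>)) / (norm D) ^ 2"
    by (simp add: mobius_def D_def Im_divide cmod_power2)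
  also have "real_of_int a * Im \<tau> * (real_of_int c * Re \<tau> + real_of_int e)
        - (real_of_int a * Re \<tau> + real_of_int b) * (real_of_int c * Im \<tau>) =
      (real_of_int a * real_of_int e - real_of_int b * real_of_int c) * Im \<tau>"
    by (simp add: algebra_simps)
  finally show ?thesis using \<open>D \<noteq> 0\<close> t d by (simp add: det)
qed

lemma holomorphic_mobius:
  assumes M: "primitive_matrix (int d) a b c e" and d: "d > 0"
  shows "mobius a b c e holomorphic_on {\<tau>. Im \<tau> > 0}"
  unfolding mobius_def [abs_def]
  using linear_form_nonzero[OF _ primitive_matrix_rows_nonzero(2)[OF M d]]
  by (intro holomorphic_intros) auto

lemma q_expansion_holomorphic:
  assumes "q_expansion g G"
  shows "g holomorphic_on {\<tau>. Im \<tau> > 0}"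
  unfolding holomorphic_on_open[OF open_upper_half_plane]
  using has_field_derivative_q_expansion[OF assms] by blast

lemma holomorphic_q_expansion_mobius:
  assumes g: "q_expansion g G" and M: "primitive_matrix (int d) a b c e" and d: "d > 0"
  shows "(\<lambda>\<tau>. g (mobius a b c e \<tau>)) holomorphic_on {\<tau>. Im \<tau> > 0}"
proof -
  have "g \<circ> mobius a b c e holomorphic_on {\<tau>. Im \<tau> > 0}"
    by (rule holomorphic_on_compose_gen[OF holomorphic_mobius[OF M d] q_expansion_holomorphic[OF g]])
       (use Im_mobius_pos[OF M d] in auto)
  thus ?thesis by (simp add: o_def)
qed

lemma q_expansion_bounded:
  assumes "q_expansion g G" "y > 0"
  shows "\<exists>B. \<forall>\<tau>. Im \<tau> \<ge> y \<longrightarrow> norm (g \<tau>) \<le> B"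
proof -
  define r where "r = exp (- 2 * pi * y)"
  have "r < 1" using assms(2) by (simp add: r_def)
  hence "cball 0 r \<subseteq> (ball 0 1 :: complex set)" by auto
  hence "bounded (G ` cball 0 r)" using assms(1)
    by (intro compact_imp_bounded compact_continuous_image holomorphic_on_imp_continuous_on)
       (auto simp: q_expansion_def elim!: holomorphic_on_subset)
  then obtain B where B: "\<And>q. norm q \<le> r \<Longrightarrow> norm (G q) \<le> B"
    unfolding bounded_iff by (metis imageI mem_cball_0)
  have "norm (g \<tau>) \<le> B" if "Im \<tau> \<ge> y" for \<tau>
  proof -
    have "norm (nome \<tau>) \<le> r" unfolding norm_nome r_def using that by simp
    thus ?thesis using B assms that by (simp add: q_expansion_def)
  qed
  thus ?thesis by blast
qed

lemma bounded_q_expansion_mobius: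
  assumes g: "q_expansion g G" and M: "primitive_matrix (int d) a b 0 e" and d: "d > 0"
  shows "\<exists>B. \<forall>\<tau>. Im \<tau> \<ge> 1 \<longrightarrow> norm (g (mobius a b 0 e \<tau>)) \<le> B"
proof -
  have ae: "real_of_int a * real_of_int e = real d"
    using M by (metis primitive_matrix_def diff_0_right mult_zero_right of_int_mult of_int_of_nat_eq)
  have e: "real_of_int e \<noteq> 0" using ae d by auto
  have "Im (mobius a b 0 e \<tau>) \<ge> d / real_of_int e ^ 2" if "Im \<tau> \<ge> 1" for \<tau>
  proof -
    have "Im (mobius a b 0 e \<tau>) = real_of_int a / real_of_int e * Im \<tau>"
      by (simp add: mobius_def Im_divide power2_eq_square)
    also have "real_of_int a / real_of_int e = d / real_of_int e ^ 2"
      using e by (simp add: ae[symmetric] power2_eq_square)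
    also have "\<dots> * 1 \<le> \<dots> * Im \<tau>" using that by (intro mult_left_mono) auto
    finally show ?thesis by simp
  qed
  moreover have "d / real_of_int e ^ 2 > 0" using d e by simp
  ultimately show ?thesis using q_expansion_bounded[OF g] by meson
qed

lemma mobius_left_T:
  assumes "of_int c * \<tau> + of_int e \<noteq> (0::complex)"
  shows "mobius (a + c) (b + e) c e \<tau> = mobius a b c e \<tau> + 1"
  using assms by (simp add: mobius_def field_simps)

lemma mobius_left_S:
  assumes "of_int c * \<tau> + of_int e \<noteq> (0::complex)" "of_int a * \<tau> + of_int b \<noteq> (0::complex)"
  shows "mobius (- c) (- e) a b \<tau> = - 1 / mobius a b c e \<tau>"
proof -
  have "- of_int c * \<tau> - of_int e = - (of_int c * \<tau> + of_int e)" by simp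
  thus ?thesis using assms by (simp add: mobius_def)
qed

lemma mobius_right_T: "mobius a b c e (\<tau> + 1) = mobius a (a + b) c (c + e) \<tau>"
  by (simp add: mobius_def algebra_simps)

lemma mobius_right_S:
  assumes "\<tau> \<noteq> 0"
  shows "mobius a b c e (- 1 / \<tau>) = mobius b (- a) e (- c) \<tau>"
proof -
  have "mobius a b c e (- 1 / \<tau>) = (\<tau> * (of_int a * (- 1 / \<tau>) + of_int b)) / (\<tau> * (of_int c * (- 1 / \<tau>) + of_int e))"
    unfolding mobius_def using assms by (subst mult_divide_mult_cancel_left) auto
  also have "\<tau> * (of_int a * (- 1 / \<tau>) + of_int b) = of_int b * \<tau> + of_int (- a)"
    using assms by (simp add: algebra_simps)
  also have "\<tau> * (of_int c * (- 1 / \<tau>) + of_int e) = of_int e * \<tau> + of_int (- c)"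
    using assms by (simp add: algebra_simps)
  finally show ?thesis by (simp only: mobius_def)
qed

lemma linear_form_right_T:
  "of_int c * (\<tau> + 1) + of_int e = of_int c * \<tau> + (of_int (c + e) :: complex)"
  by (simp add: algebra_simps)

lemma linear_form_right_S:
  assumes "\<tau> \<noteq> (0::complex)"
  shows "of_int c * (- 1 / \<tau>) + of_int e = (of_int e * \<tau> + of_int (- c)) / \<tau>"
  using assms by (simp add: field_simps)

text \<open>
  The conjugates of \<open>d\<^sup>n g(d\<tau>)\<close> are \<open>(d/(c\<tau> + e)\<^sup>2)\<^sup>n g(M\<tau>)\<close>; modularity of \<open>g\<close> is invariance under left
  multiplication.
\<close>

lemma modular_form_orbit_relation:
  assumes g: "q_expansion g G" "half_weight n g" and d: "d > 0"
  shows "\<exists>N s. N \<le> card (hecke_triples d) \<and> (\<forall>\<tau>. s 0 \<tau> = 1) \<and> (\<forall>k\<le>N. isobaric (n * k) (s k)) \<and>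
     (\<forall>\<tau>. Im \<tau> > 0 \<longrightarrow> (\<Sum>k\<le>N. s k \<tau> * (of_nat d ^ n * g (of_nat d * \<tau>)) ^ (N - k)) = 0)"
proof -
  define T where "T = (\<lambda>a b c e \<tau>. (of_nat d / (of_int c * \<tau> + of_int e) ^ 2) ^ n * g (mobius a b c e \<tau>))"
  have "\<exists>N s. N \<le> card (hecke_triples d) \<and> (\<forall>\<tau>. s 0 \<tau> = 1) \<and> (\<forall>k\<le>N. isobaric (n * k) (s k)) \<and>
     (\<forall>\<tau>. Im \<tau> > 0 \<longrightarrow> (\<Sum>k\<le>N. s k \<tau> * T d 0 0 1 \<tau> ^ (N - k)) = 0)"
  proof (rule modular_orbit_relation[where T = T and n = n and d = d, OF d])
    fix a b c e \<tau> assume M: "primitive_matrix (int d) a b c e" and t: "Im \<tau> > 0"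
    note nz = linear_form_nonzero[OF t primitive_matrix_rows_nonzero(1)[OF M d]]
      linear_form_nonzero[OF t primitive_matrix_rows_nonzero(2)[OF M d]]
    have t0: "\<tau> \<noteq> 0" using t by auto
    note pos = Im_mobius_pos[OF M d t]
    show "T (a + c) (b + e) c e \<tau> = T a b c e \<tau>"
      using q_expansion_plus_1[OF g(1) pos] nz by (simp add: T_def mobius_left_T)
    have "T (- c) (- e) a b \<tau> = (of_nat d / (of_int a * \<tau> + of_int b) ^ 2) ^ n * (mobius a b c e \<tau> ^ (2 * n) * g (mobius a b c e \<tau>))"
      using g(2) pos nz by (simp add: T_def mobius_left_S half_weight_def)
    also have "\<dots> = (of_nat d / (of_int a * \<tau> + of_int b) ^ 2 * mobius a b c e \<tau> ^ 2) ^ n * g (mobius a b c e \<tau>)"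
      by (simp only: power_mult_distrib power_mult mult.assoc)
    also have "of_nat d / (of_int a * \<tau> + of_int b) ^ 2 * mobius a b c e \<tau> ^ 2 = of_nat d / (of_int c * \<tau> + of_int e) ^ 2"
      using nz by (simp add: mobius_def power_divide)
    finally show "T (- c) (- e) a b \<tau> = T a b c e \<tau>" by (simp add: T_def)
    show "T a b c e (\<tau> + 1) = T a (a + b) c (c + e) \<tau>"
      unfolding T_def mobius_right_T linear_form_right_T ..
    have "T a b c e (- 1 / \<tau>) = (\<tau> ^ 2 * (of_nat d / (of_int e * \<tau> + of_int (- c)) ^ 2)) ^ n * g (mobius b (- a) e (- c) \<tau>)"
      unfolding T_def mobius_right_S[OF t0] linear_form_right_S[OF t0] by (simp add: power_divide mult.commute)
    thus "T a b c e (- 1 / \<tau>) = \<tau> ^ (2 * n) * T b (- a) e (- c) \<tau>"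
      by (simp only: T_def power_mult_distrib power_mult mult.assoc)
  next
    fix a b c e assume M: "primitive_matrix (int d) a b c e"
    show "T a b c e holomorphic_on {\<tau>. Im \<tau> > 0}"
      unfolding T_def using linear_form_nonzero[OF _ primitive_matrix_rows_nonzero(2)[OF M d]]
      by (intro holomorphic_intros holomorphic_q_expansion_mobius[OF g(1) M d]) auto
  next
    fix a b e assume M: "primitive_matrix (int d) a b 0 e"
    obtain B where B: "\<And>\<tau>. Im \<tau> \<ge> 1 \<Longrightarrow> norm (g (mobius a b 0 e \<tau>)) \<le> B"
      using bounded_q_expansion_mobius[OF g(1) M d] by blast
    show "\<exists>B. \<forall>\<tau>. Im \<tau> \<ge> 1 \<longrightarrow> norm (T a b 0 e \<tau>) \<le> B"
      by (rule exI[of _ "norm ((of_nat d / (of_int e :: complex) ^ 2) ^ n) * B"])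
         (auto simp: T_def norm_mult intro!: mult_left_mono B)
  qed
  moreover have "T d 0 0 1 = (\<lambda>\<tau>. of_nat d ^ n * g (of_nat d * \<tau>))"
    by (auto simp: T_def mobius_def)
  ultimately show ?thesis by simp
qed

text \<open>
  For the quasimodular \<open>g\<^sub>1\<close> the term \<open>c/(c\<tau> + e)\<close> restores invariance under left multiplication.  The
  functions \<open>h\<close> are then permuted by the slash action only up to the same error term as \<open>g\<^sub>1\<close>, and it cancels in the difference
  \<open>g\<^sub>1 - h\<close>.
\<close>

lemma quasimodular_orbit_relation:
  assumes d: "d > 0"
  shows "\<exists>N s. N \<le> card (hecke_triples d) \<and> (\<forall>\<tau>. s 0 \<tau> = 1) \<and> (\<forall>k\<le>N. isobaric (1 * k) (s k)) \<and>
     (\<forall>\<tau>. Im \<tau> > 0 \<longrightarrow> (\<Sum>k\<le>N. s k \<tau> * (g1 \<tau> - of_nat d * g1 (of_nat d * \<tau>)) ^ (N - k)) = 0)"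
proof -
  define h where "h = (\<lambda>a b c e \<tau>. of_nat d / (of_int c * \<tau> + of_int e) ^ 2 * g1 (mobius a b c e \<tau>)
     - of_int c / (of_int c * \<tau> + of_int e))"
  define T where "T = (\<lambda>a b c e \<tau>. g1 \<tau> - h a b c e \<tau>)"
  have "\<exists>N s. N \<le> card (hecke_triples d) \<and> (\<forall>\<tau>. s 0 \<tau> = 1) \<and> (\<forall>k\<le>N. isobaric (1 * k) (s k)) \<and>
     (\<forall>\<tau>. Im \<tau> > 0 \<longrightarrow> (\<Sum>k\<le>N. s k \<tau> * T d 0 0 1 \<tau> ^ (N - k)) = 0)"
  proof (rule modular_orbit_relation[where T = T and n = 1 and d = d, OF d])
    fix a b c e \<tau> assume M: "primitive_matrix (int d) a b c e" and t: "Im \<tau> > 0"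
    note nz = linear_form_nonzero[OF t primitive_matrix_rows_nonzero(1)[OF M d]]
      linear_form_nonzero[OF t primitive_matrix_rows_nonzero(2)[OF M d]]
    have t0: "\<tau> \<noteq> 0" using t by auto
    note pos = Im_mobius_pos[OF M d t]
    show "T (a + c) (b + e) c e \<tau> = T a b c e \<tau>"
      using q_expansion_plus_1[OF q_expansion_g1 pos] nz by (simp add: T_def h_def mobius_left_T)
    define A where "A = of_int a * \<tau> + of_int b"
    define C where "C = of_int c * \<tau> + of_int e"
    define w where "w = g1 (A / C)"
    have AC: "A \<noteq> 0" "C \<noteq> 0" using nz by (auto simp: A_def C_def)
    have mob: "mobius a b c e \<tau> = A / C" by (simp add: mobius_def A_def C_def)
    have det: "of_nat d = of_int a * C - of_int c * A"
    proof -
      have "of_nat d = (of_int (a * e - b * c) :: complex)" using M by (simp add: primitive_matrix_def)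
      thus ?thesis by (simp add: A_def C_def algebra_simps)
    qed
    have "h (- c) (- e) a b \<tau> = of_nat d / A ^ 2 * ((A / C) ^ 2 * w + A / C) - of_int a / A"
      using g1_inversion[OF pos] nz by (simp add: h_def mobius_left_S mob A_def [symmetric] w_def)
    also have "\<dots> = of_nat d / C ^ 2 * w + (of_nat d - of_int a * C) / (A * C)"
      using AC by (simp add: field_simps power2_eq_square)
    also have "\<dots> = of_nat d / C ^ 2 * w - of_int c / C"
      using AC unfolding det by (simp add: field_simps)
    finally show "T (- c) (- e) a b \<tau> = T a b c e \<tau>"
      by (simp add: T_def) (simp add: h_def mob C_def [symmetric] w_def)
    have "h a b c e (\<tau> + 1) = h a (a + b) c (c + e) \<tau>"
      unfolding h_def mobius_right_T linear_form_right_T ..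
    thus "T a b c e (\<tau> + 1) = T a (a + b) c (c + e) \<tau>"
      using q_expansion_plus_1[OF q_expansion_g1 t] by (simp add: T_def)
    define D where "D = of_int e * \<tau> + of_int (- c)"
    have D: "D \<noteq> 0" unfolding D_def
      by (rule linear_form_nonzero[OF t]) (use primitive_matrix_rows_nonzero(2)[OF M d] in auto)
    define v where "v = g1 (mobius b (- a) e (- c) \<tau>)"
    have "h a b c e (- 1 / \<tau>) = of_nat d / (D / \<tau>) ^ 2 * v - of_int c / (D / \<tau>)"
      unfolding h_def mobius_right_S[OF t0] linear_form_right_S[OF t0] D_def v_def ..
    hence h1: "h a b c e (- 1 / \<tau>) = \<tau> ^ 2 * (of_nat d / D ^ 2 * v) - \<tau> * of_int c / D"
      by (simp add: power_divide mult_ac)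
    have h2: "h b (- a) e (- c) \<tau> = of_nat d / D ^ 2 * v - of_int e / D"
      unfolding h_def D_def v_def ..
    have "\<tau> * D = \<tau> ^ 2 * of_int e - \<tau> * of_int c"
      by (simp add: D_def algebra_simps power2_eq_square)
    hence "\<tau> = (\<tau> ^ 2 * of_int e - \<tau> * of_int c) / D"
      using D by (metis nonzero_mult_div_cancel_right)
    hence "\<tau> ^ 2 * of_int e / D - \<tau> * of_int c / D = \<tau>" by (simp only: diff_divide_distrib)
    hence h_S: "h a b c e (- 1 / \<tau>) = \<tau> ^ 2 * h b (- a) e (- c) \<tau> + \<tau>"
      unfolding h1 h2 right_diff_distrib by (simp add: algebra_simps)
    show "T a b c e (- 1 / \<tau>) = \<tau> ^ (2 * 1) * T b (- a) e (- c) \<tau>"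
      unfolding T_def h_S g1_inversion[OF t] by (simp add: algebra_simps power2_eq_square)
  next
    fix a b c e assume M: "primitive_matrix (int d) a b c e"
    show "T a b c e holomorphic_on {\<tau>. Im \<tau> > 0}"
      unfolding T_def h_def using linear_form_nonzero[OF _ primitive_matrix_rows_nonzero(2)[OF M d]]
      by (intro holomorphic_intros holomorphic_q_expansion_mobius[OF q_expansion_g1 M d]
            q_expansion_holomorphic[OF q_expansion_g1]) auto
  next
    fix a b e assume M: "primitive_matrix (int d) a b 0 e"
    obtain B where B: "\<And>\<tau>. Im \<tau> \<ge> 1 \<Longrightarrow> norm (g1 (mobius a b 0 e \<tau>)) \<le> B"
      using bounded_q_expansion_mobius[OF q_expansion_g1 M d] by blast
    obtain B' where B': "\<And>\<tau>. Im \<tau> \<ge> 1 \<Longrightarrow> norm (g1 \<tau>) \<le> B'"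
      using q_expansion_bounded[OF q_expansion_g1, of 1] by auto
    define k where "k = norm (of_nat d / (of_int e :: complex) ^ 2)"
    show "\<exists>B. \<forall>\<tau>. Im \<tau> \<ge> 1 \<longrightarrow> norm (T a b 0 e \<tau>) \<le> B"
    proof (intro exI[of _ "B' + k * B"] allI impI)
      fix \<tau> :: complex assume t: "Im \<tau> \<ge> 1"
      have "norm (T a b 0 e \<tau>) \<le> norm (g1 \<tau>) + norm (h a b 0 e \<tau>)"
        unfolding T_def by (rule norm_triangle_ineq4)
      also have "norm (h a b 0 e \<tau>) = k * norm (g1 (mobius a b 0 e \<tau>))"
        by (simp add: h_def k_def norm_mult norm_divide)
      also have "norm (g1 \<tau>) + k * norm (g1 (mobius a b 0 e \<tau>)) \<le> B' + k * B"
        using t by (intro add_mono mult_left_mono B B') (auto simp: k_def)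
      finally show "norm (T a b 0 e \<tau>) \<le> B' + k * B" .
    qed
  qed
  moreover have "T d 0 0 1 = (\<lambda>\<tau>. g1 \<tau> - of_nat d * g1 (of_nat d * \<tau>))"
    by (auto simp: T_def h_def mobius_def)
  ultimately show ?thesis by simp
qed

text \<open>
  The coordinate \<open>y\<^sub>i\<close> of the parametrisation.
\<close>

definition conjugate_param :: "nat \<Rightarrow> nat \<Rightarrow> complex \<Rightarrow> complex" where
  "conjugate_param d i \<tau> = modular_param d \<tau> (if i = 1 then Y1 else if i = 2 then Aff Y2 else Aff Y3)"

theorem modular_equation:
  assumes d: "d > 0" and i: "i \<in> {1, 2, 3}"
  shows "\<exists>N s. N \<le> card (hecke_triples d) \<and> (\<forall>\<tau>. s 0 \<tau> = 1) \<and> (\<forall>k\<le>N. isobaric (i * k) (s k)) \<and>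
     (\<forall>\<tau>. Im \<tau> > 0 \<longrightarrow> (\<Sum>k\<le>N. s k \<tau> * conjugate_param d i \<tau> ^ (N - k)) = 0)"
proof -
  consider "i = 1" | "i = 2" | "i = 3" using i by auto
  thus ?thesis
  proof cases
    case 1
    have "conjugate_param d i = (\<lambda>\<tau>. g1 \<tau> - of_nat d * g1 (of_nat d * \<tau>))"
      by (simp add: conjugate_param_def [abs_def] 1)
    thus ?thesis using quasimodular_orbit_relation[OF d] by (simp only: 1)
  next
    case 2
    have "conjugate_param d i = (\<lambda>\<tau>. of_nat d ^ 2 * g2 (of_nat d * \<tau>))"
      by (simp add: conjugate_param_def [abs_def] 2)
    thus ?thesis using modular_form_orbit_relation[OF q_expansion_g2 half_weight_g2 d] by (simp only: 2)
  next
    case 3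
    have eq: "conjugate_param d i = (\<lambda>\<tau>. of_nat d ^ 3 * (- 1 * g3 (of_nat d * \<tau>)))"
      by (simp add: conjugate_param_def [abs_def] 3)
    show ?thesis unfolding eq unfolding 3
      by (rule modular_form_orbit_relation[OF q_expansion_mult[OF q_expansion_const q_expansion_g3]
            half_weight_cmult[OF half_weight_g3] d])
  qed
qed

section \<open>Evaluation of polynomials\<close>

text \<open>
  The value of a monomial, given by its exponent vector.
\<close>

definition mono_eval :: "('v \<Rightarrow> 'b::comm_semiring_1) \<Rightarrow> ('v \<Rightarrow>\<^sub>0 nat) \<Rightarrow> 'b" where
  "mono_eval z m = (\<Prod>v\<in>Poly_Mapping.keys m. z v ^ Poly_Mapping.lookup m v)"

lemma mono_eval_superset:
  assumes "finite S" "Poly_Mapping.keys m \<subseteq> S"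
  shows "mono_eval z m = (\<Prod>v\<in>S. z v ^ Poly_Mapping.lookup m v)"
  unfolding mono_eval_def using assms
  by (intro prod.mono_neutral_left) (auto simp: in_keys_iff)

lemma mono_eval_add: "mono_eval z (m + n) = mono_eval z m * mono_eval z n"
proof -
  define S where "S = Poly_Mapping.keys m \<union> Poly_Mapping.keys n"
  have "finite S" "Poly_Mapping.keys m \<subseteq> S" "Poly_Mapping.keys n \<subseteq> S" "Poly_Mapping.keys (m + n) \<subseteq> S"
    using Poly_Mapping.keys_add[of m n] by (auto simp: S_def)
  thus ?thesis by (simp add: mono_eval_superset[of S] lookup_add power_add prod.distrib)
qed

lemma mono_eval_single: "mono_eval z (Poly_Mapping.single v k) = z v ^ k"
  by (simp add: mono_eval_def)

lemma mono_eval_0 [simp]: "mono_eval z 0 = 1"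
  by (simp add: mono_eval_def)

lemma peval_superset:
  assumes "finite A" "Poly_Mapping.keys p \<subseteq> A" "h 0 = 0"
  shows "peval h z p = (\<Sum>m\<in>A. h (Poly_Mapping.lookup p m) * mono_eval z m)"
  unfolding peval_def mono_eval_def [symmetric] using assms
  by (intro sum.mono_neutral_left) (auto simp: in_keys_iff)

lemma peval_single:
  assumes "h 0 = 0"
  shows "peval h z (Poly_Mapping.single m c) = h c * mono_eval z m"
  using assms by (subst peval_superset[of "{m}"]) auto

lemma peval_add:
  assumes "h 0 = 0" "\<And>a b. h (a + b) = h a + h b"
  shows "peval h z (p + q) = peval h z p + peval h z q"
proof -
  define A where "A = Poly_Mapping.keys p \<union> Poly_Mapping.keys q"
  have "finite A" "Poly_Mapping.keys p \<subseteq> A" "Poly_Mapping.keys q \<subseteq> A" "Poly_Mapping.keys (p + q) \<subseteq> A"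
    using Poly_Mapping.keys_add[of p q] by (auto simp: A_def)
  thus ?thesis
    by (simp add: peval_superset[of A] assms lookup_add ring_distribs sum.distrib)
qed

lemma peval_0 [simp]: "peval h z 0 = 0"
  by (simp add: peval_def)

lemma peval_sum:
  assumes "h 0 = 0" "\<And>a b. h (a + b) = h a + h b"
  shows "peval h z (sum f A) = (\<Sum>x\<in>A. peval h z (f x))"
  by (induction A rule: infinite_finite_induct) (simp_all add: peval_add assms)

lemma sum_single_lookup:
  fixes p :: "'a \<Rightarrow>\<^sub>0 'b :: comm_monoid_add"
  shows "(\<Sum>m\<in>Poly_Mapping.keys p. Poly_Mapping.single m (Poly_Mapping.lookup p m)) = p"
proof (rule poly_mapping_eqI)
  fix k
  have "Poly_Mapping.lookup (\<Sum>m\<in>Poly_Mapping.keys p. Poly_Mapping.single m (Poly_Mapping.lookup p m)) k =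
      (\<Sum>m\<in>Poly_Mapping.keys p. if m = k then Poly_Mapping.lookup p m else 0)"
    by (simp add: lookup_sum lookup_single when_def)
  also have "\<dots> = Poly_Mapping.lookup p k"
    by (subst sum.delta) (auto simp: in_keys_iff)
  finally show "Poly_Mapping.lookup (\<Sum>m\<in>Poly_Mapping.keys p. Poly_Mapping.single m (Poly_Mapping.lookup p m)) k =
      Poly_Mapping.lookup p k" .
qed

lemma peval_mult:
  assumes "h 0 = 0" "\<And>a b. h (a + b) = h a + h b" "\<And>a b. h (a * b) = h a * h b"
  shows "peval h z (p * q) = peval h z p * peval h z q"
proof -
  have "p * q = (\<Sum>m\<in>Poly_Mapping.keys p. Poly_Mapping.single m (Poly_Mapping.lookup p m)) *
                (\<Sum>n\<in>Poly_Mapping.keys q. Poly_Mapping.single n (Poly_Mapping.lookup q n))"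
    by (simp only: sum_single_lookup)
  also have "\<dots> = (\<Sum>m\<in>Poly_Mapping.keys p. \<Sum>n\<in>Poly_Mapping.keys q.
      Poly_Mapping.single (m + n) (Poly_Mapping.lookup p m * Poly_Mapping.lookup q n))"
    by (simp add: sum_product mult_single)
  finally have "peval h z (p * q) = (\<Sum>m\<in>Poly_Mapping.keys p. \<Sum>n\<in>Poly_Mapping.keys q.
      (h (Poly_Mapping.lookup p m) * mono_eval z m) * (h (Poly_Mapping.lookup q n) * mono_eval z n))"
    by (simp add: peval_sum peval_single mono_eval_add assms mult_ac)
  also have "\<dots> = peval h z p * peval h z q"
    by (simp add: peval_def mono_eval_def [symmetric] sum_product)
  finally show ?thesis .
qed

interpretation peval: comm_ring_hom "peval (of_rat :: rat \<Rightarrow> 'b :: field_char_0) z"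
proof
  have "peval of_rat z (Poly_Mapping.single 0 1) = (1 :: 'b)"
    by (subst peval_single) auto
  thus "peval of_rat z 1 = (1 :: 'b)" unfolding single_one .
qed (simp_all add: peval_add peval_mult of_rat_add of_rat_mult)

lemma peval_pvar [simp]: "peval (of_rat :: rat \<Rightarrow> 'b :: field_char_0) z (pvar v) = z v"
  by (simp add: pvar_def peval_single mono_eval_single)

lemma peval_pconst [simp]: "peval (of_rat :: rat \<Rightarrow> 'b :: field_char_0) z (pconst c) = of_rat c"
  by (simp add: pconst_def peval_single)

lemma peval_power [simp]: "peval (of_rat :: rat \<Rightarrow> 'b :: field_char_0) z (p ^ n) = peval of_rat z p ^ n"
  by (induction n) (simp_all add: peval.hom_mult)

lemma peval_of_nat [simp]: "peval (of_rat :: rat \<Rightarrow> 'b :: field_char_0) z (of_nat n) = of_nat n"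
  by (induction n) (simp_all add: peval.hom_add)

lemma peval_numeral [simp]: "peval (of_rat :: rat \<Rightarrow> 'b :: field_char_0) z (numeral n) = numeral n"
  using peval_of_nat[of z "numeral n"] by simp

lemma UNIV_coord: "(UNIV :: coord set) = {X2, X3, Y2, Y3}"
  by (auto intro: coord.exhaust)

lemma mono_eval_coord:
  "mono_eval z m = z X2 ^ Poly_Mapping.lookup m X2 * z X3 ^ Poly_Mapping.lookup m X3 *
     z Y2 ^ Poly_Mapping.lookup m Y2 * z Y3 ^ Poly_Mapping.lookup m Y3"
proof -
  have "Poly_Mapping.keys m \<subseteq> {X2, X3, Y2, Y3}" using UNIV_coord by blast
  thus ?thesis by (subst mono_eval_superset[of "{X2, X3, Y2, Y3}"]) (simp_all add: mult_ac)
qed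

lemma peval_partial_deriv:
  "peval of_rat z (partial_deriv v p) = (\<Sum>m\<in>Poly_Mapping.keys p.
      of_rat (Poly_Mapping.lookup p m) *
      (of_nat (Poly_Mapping.lookup m v) * mono_eval z (m - Poly_Mapping.single v 1)) :: 'b :: field_char_0)"
  unfolding partial_deriv_def
  by (simp add: peval_sum of_rat_add peval_single of_rat_mult mult_ac)

text \<open>
  The chain rule along a curve \<open>\<gamma>\<close>.
\<close>

lemma has_field_derivative_peval:
  fixes \<gamma> :: "complex \<Rightarrow> coord \<Rightarrow> complex"
  assumes "\<And>v. ((\<lambda>t. \<gamma> t v) has_field_derivative \<gamma>' v) (at t)"
  shows "((\<lambda>t. peval of_rat (\<gamma> t) p) has_field_derivative
     (\<gamma>' X2 * peval of_rat (\<gamma> t) (partial_deriv X2 p) + \<gamma>' X3 * peval of_rat (\<gamma> t) (partial_deriv X3 p)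
    + \<gamma>' Y2 * peval of_rat (\<gamma> t) (partial_deriv Y2 p) + \<gamma>' Y3 * peval of_rat (\<gamma> t) (partial_deriv Y3 p))) (at t)"
proof -
  define D where "D = (\<lambda>m v. of_nat (Poly_Mapping.lookup m v) * mono_eval (\<gamma> t) (m - Poly_Mapping.single v 1))"
  have mono: "((\<lambda>t. mono_eval (\<gamma> t) m) has_field_derivative
     (\<gamma>' X2 * D m X2 + \<gamma>' X3 * D m X3 + \<gamma>' Y2 * D m Y2 + \<gamma>' Y3 * D m Y3)) (at t)" for m
    unfolding mono_eval_coord D_def lookup_minus lookup_single
    by (rule derivative_eq_intros assms refl)+ (simp add: algebra_simps)
  have "((\<lambda>t. \<Sum>m\<in>Poly_Mapping.keys p. of_rat (Poly_Mapping.lookup p m) * mono_eval (\<gamma> t) m) has_field_derivative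
     (\<Sum>m\<in>Poly_Mapping.keys p. of_rat (Poly_Mapping.lookup p m) *
       (\<gamma>' X2 * D m X2 + \<gamma>' X3 * D m X3 + \<gamma>' Y2 * D m Y2 + \<gamma>' Y3 * D m Y3))) (at t)"
    by (intro DERIV_sum DERIV_cmult mono)
  also have "(\<Sum>m\<in>Poly_Mapping.keys p. of_rat (Poly_Mapping.lookup p m) *
       (\<gamma>' X2 * D m X2 + \<gamma>' X3 * D m X3 + \<gamma>' Y2 * D m Y2 + \<gamma>' Y3 * D m Y3)) =
     \<gamma>' X2 * peval of_rat (\<gamma> t) (partial_deriv X2 p) + \<gamma>' X3 * peval of_rat (\<gamma> t) (partial_deriv X3 p)
    + \<gamma>' Y2 * peval of_rat (\<gamma> t) (partial_deriv Y2 p) + \<gamma>' Y3 * peval of_rat (\<gamma> t) (partial_deriv Y3 p)"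
    unfolding peval_partial_deriv D_def by (simp add: sum_distrib_left ring_distribs sum.distrib mult_ac)
  finally show ?thesis by (simp add: peval_def mono_eval_def [symmetric])
qed

lemma det_eq_0_if_kernel:
  fixes A :: "'a :: field mat"
  assumes "A \<in> carrier_mat n n" "j0 < n" "w j0 \<noteq> 0"
    and "\<And>r. r < n \<Longrightarrow> (\<Sum>j<n. A $$ (r, j) * w j) = 0"
  shows "Determinant.det A = 0"
proof -
  have "Matrix.vec n w \<noteq> 0\<^sub>v n"
  proof
    assume "Matrix.vec n w = 0\<^sub>v n"
    hence "vec_index (Matrix.vec n w) j0 = vec_index (0\<^sub>v n) j0" by simp
    thus False using assms by simp
  qed
  moreover have "A *\<^sub>v Matrix.vec n w = 0\<^sub>v n"
    using assms(1,4) by (intro eq_vecI) (auto simp: scalar_prod_def atLeast0LessThan)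
  ultimately show ?thesis using det_0_iff_vec_prod_zero_field[OF assms(1)] by (metis vec_carrier)
qed

lemma peval_J_poly_eq_0:
  assumes "j0 < length \<alpha>" "w j0 \<noteq> (0 :: complex)"
    and "\<And>r. (\<Sum>j<length \<alpha>. w j * peval of_rat z ((vfield ^^ r) (\<alpha> ! j))) = 0"
  shows "peval of_rat z (J_poly \<alpha>) = 0"
proof -
  have "peval of_rat z (J_poly \<alpha>) = Determinant.det (map_mat (peval of_rat z) (B_matrix \<alpha>))"
    by (simp add: J_poly_def peval.hom_det)
  also have "\<dots> = 0"
    by (rule det_eq_0_if_kernel[of _ "length \<alpha>" j0 w])
       (use assms in \<open>auto simp: B_matrix_def mult.commute\<close>)
  finally show ?thesis .
qed

section \<open>Homogenisation\<close>

lemma UNIV_hcoord: "(UNIV :: hcoord set) = {Aff X2, Aff X3, Aff Y2, Aff Y3, Y1}"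
proof -
  have "v \<in> {Aff X2, Aff X3, Aff Y2, Aff Y3, Y1}" for v
  proof (cases v)
    case (Aff c)
    thus ?thesis by (cases c) auto
  qed auto
  thus ?thesis by blast
qed

lemma mono_eval_hcoord:
  "mono_eval z m = z (Aff X2) ^ Poly_Mapping.lookup m (Aff X2) * z (Aff X3) ^ Poly_Mapping.lookup m (Aff X3) *
     z (Aff Y2) ^ Poly_Mapping.lookup m (Aff Y2) * z (Aff Y3) ^ Poly_Mapping.lookup m (Aff Y3) *
     z Y1 ^ Poly_Mapping.lookup m Y1"
proof -
  have "Poly_Mapping.keys m \<subseteq> {Aff X2, Aff X3, Aff Y2, Aff Y3, Y1}" using UNIV_hcoord by blast
  thus ?thesis
    by (subst mono_eval_superset[of "{Aff X2, Aff X3, Aff Y2, Aff Y3, Y1}"]) (simp_all add: mult_ac)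
qed

lemma weight_sum_hcoord:
  "(\<Sum>v\<in>Poly_Mapping.keys m. weight v * Poly_Mapping.lookup m v) =
     2 * Poly_Mapping.lookup m (Aff X2) + 3 * Poly_Mapping.lookup m (Aff X3) +
     2 * Poly_Mapping.lookup m (Aff Y2) + 3 * Poly_Mapping.lookup m (Aff Y3) + Poly_Mapping.lookup m Y1"
proof -
  have "(\<Sum>v\<in>Poly_Mapping.keys m. weight v * Poly_Mapping.lookup m v) =
      (\<Sum>v\<in>{Aff X2, Aff X3, Aff Y2, Aff Y3, Y1}. weight v * Poly_Mapping.lookup m v)"
  proof (rule sum.mono_neutral_left)
    show "Poly_Mapping.keys m \<subseteq> {Aff X2, Aff X3, Aff Y2, Aff Y3, Y1}" using UNIV_hcoord by blast
  qed (auto simp: in_keys_iff)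
  thus ?thesis by simp
qed

lemma peval_wscale:
  assumes "weighted_homogeneous n f"
  shows "peval id (wscale t z) f = t ^ n * peval id z f"
proof -
  have "mono_eval (wscale t z) m = t ^ n * mono_eval z m" if "m \<in> Poly_Mapping.keys f" for m
  proof -
    have "n = (\<Sum>v\<in>Poly_Mapping.keys m. weight v * Poly_Mapping.lookup m v)"
      using assms that by (simp add: weighted_homogeneous_def)
    thus ?thesis
      by (simp add: mono_eval_def wscale_def power_mult_distrib prod.distrib power_mult power_sum)
  qed
  thus ?thesis by (simp add: peval_def mono_eval_def [symmetric] sum_distrib_left mult_ac)
qed

definition coord_weight :: "(coord \<Rightarrow>\<^sub>0 nat) \<Rightarrow> nat" where
  "coord_weight m = 2 * Poly_Mapping.lookup m X2 + 3 * Poly_Mapping.lookup m X3 +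
     2 * Poly_Mapping.lookup m Y2 + 3 * Poly_Mapping.lookup m Y3"

text \<open>
  The missing weight is filled up with \<open>y\<^sub>1\<close>.
\<close>

definition homogenise_exponent :: "nat \<Rightarrow> (coord \<Rightarrow>\<^sub>0 nat) \<Rightarrow> (hcoord \<Rightarrow>\<^sub>0 nat)" where
  "homogenise_exponent N m =
     Poly_Mapping.single (Aff X2) (Poly_Mapping.lookup m X2) + Poly_Mapping.single (Aff X3) (Poly_Mapping.lookup m X3)
   + Poly_Mapping.single (Aff Y2) (Poly_Mapping.lookup m Y2) + Poly_Mapping.single (Aff Y3) (Poly_Mapping.lookup m Y3)
   + Poly_Mapping.single Y1 (N - coord_weight m)"

definition homogenise :: "nat \<Rightarrow> (coord, rat) mpoly \<Rightarrow> (hcoord, complex) mpoly" where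
  "homogenise N p = (\<Sum>m\<in>Poly_Mapping.keys p.
     Poly_Mapping.single (homogenise_exponent N m) (of_rat (Poly_Mapping.lookup p m)))"

lemma weighted_homogeneous_homogenise:
  assumes "\<And>m. m \<in> Poly_Mapping.keys p \<Longrightarrow> coord_weight m \<le> N"
  shows "weighted_homogeneous N (homogenise N p)"
  unfolding weighted_homogeneous_def
proof
  fix e assume "e \<in> Poly_Mapping.keys (homogenise N p)"
  then obtain m where m: "m \<in> Poly_Mapping.keys p" "e = homogenise_exponent N m"
    unfolding homogenise_def using Poly_Mapping.keys_sum by (fastforce split: if_splits)
  thus "(\<Sum>v\<in>Poly_Mapping.keys e. weight v * Poly_Mapping.lookup e v) = N"
    using assms[OF m(1)] unfolding weight_sum_hcoord
    by (simp add: homogenise_exponent_def lookup_add lookup_single coord_weight_def)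
qed

lemma peval_homogenise:
  "peval id Z (homogenise N p) = (\<Sum>m\<in>Poly_Mapping.keys p. of_rat (Poly_Mapping.lookup p m) *
     (mono_eval (\<lambda>v. Z (Aff v)) m * Z Y1 ^ (N - coord_weight m)))"
  unfolding homogenise_def
  by (simp add: peval_sum peval_single mono_eval_hcoord mono_eval_coord homogenise_exponent_def lookup_add lookup_single)

lemma peval_homogenise_chart:
  "peval id (case_hcoord a 1) (homogenise N p) = peval of_rat a p"
  unfolding peval_homogenise by (simp add: peval_def mono_eval_def)

text \<open>
  If \<open>N\<close> exceeds all weights, every monomial keeps a factor \<open>y\<^sub>1\<close>.  This is what allows parameter values with
  \<open>y\<^sub>1 = 0\<close> to be ignored; for \<open>d = 1\<close> these are all values.
\<close>

lemma peval_homogenise_at_infinity: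
  assumes "\<And>m. m \<in> Poly_Mapping.keys p \<Longrightarrow> coord_weight m < N" "Z Y1 = 0"
  shows "peval id Z (homogenise N p) = 0"
  unfolding peval_homogenise using assms by (intro sum.neutral) auto

lemma peval_homogenise_finite:
  assumes "\<And>m. m \<in> Poly_Mapping.keys p \<Longrightarrow> coord_weight m \<le> N" "Z Y1 \<noteq> 0"
  shows "peval id Z (homogenise N p) = Z Y1 ^ N * peval of_rat (\<lambda>v. Z (Aff v) / Z Y1 ^ weight (Aff v)) p"
proof -
  have "mono_eval (\<lambda>v. Z (Aff v)) m * Z Y1 ^ (N - coord_weight m) =
      Z Y1 ^ N * mono_eval (\<lambda>v. Z (Aff v) / Z Y1 ^ weight (Aff v)) m" if "m \<in> Poly_Mapping.keys p" for m
  proof -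
    have "Z Y1 ^ N = Z Y1 ^ (N - coord_weight m) * Z Y1 ^ coord_weight m"
      using assms(1)[OF that] by (simp flip: power_add)
    thus ?thesis using assms(2)
      by (simp add: mono_eval_coord coord_weight_def power_divide power_add power_mult power_mult_distrib)
  qed
  thus ?thesis unfolding peval_homogenise
    by (simp add: peval_def mono_eval_def [symmetric] sum_distrib_left mult_ac)
qed

lemma wproj_point_in_zeros:
  assumes "z \<in> punctured_space" "weighted_homogeneous n f" "peval id z f = 0"
  shows "wproj_point z \<in> wproj_zeros {f}"
proof -
  have "wproj_point z \<in> wproj_space"
    unfolding wproj_space_def wproj_point_def by (rule quotientI[OF assms(1)])
  thus ?thesis using assms
    by (auto simp: wproj_zeros_def wproj_point_def wproj_rel_def peval_wscale)
qed

text \<open>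
  The homogenised polynomial is weighted homogeneous and vanishes on the parametrisation, so its zero set is one
  of the closed sets that define the closure.  The parametrisation has to avoid the origin: otherwise the image would not
  be contained in the weighted projective space.
\<close>

theorem S0_affine_vanishing:
  assumes punctured: "\<And>\<tau>. Im \<tau> > 0 \<Longrightarrow> modular_param d \<tau> \<in> punctured_space"
    and zero: "\<And>\<tau>. Im \<tau> > 0 \<Longrightarrow> modular_param d \<tau> Y1 \<noteq> 0 \<Longrightarrow>
       peval of_rat (\<lambda>v. modular_param d \<tau> (Aff v) / modular_param d \<tau> Y1 ^ weight (Aff v)) p = 0"
    and a: "a \<in> S0_affine d"
  shows "peval of_rat a p = 0"
proof -
  \<comment> \<open>a strict bound for the weights, which leaves a spare factor \<open>y\<^sub>1\<close>\<close>
  define N where "N = Suc (\<Sum>m\<in>Poly_Mapping.keys p. coord_weight m)"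
  have N: "coord_weight m < N" if "m \<in> Poly_Mapping.keys p" for m
    unfolding N_def less_Suc_eq_le using that by (intro member_le_sum) auto
  define F where "F = homogenise N p"
  have F: "weighted_homogeneous N F"
    unfolding F_def using N by (intro weighted_homogeneous_homogenise) (auto intro: less_imp_le)
  have "{wproj_point (modular_param d \<tau>) | \<tau>. Im \<tau> > 0} \<subseteq> wproj_zeros {F}"
  proof safe
    fix \<tau> :: complex assume t: "Im \<tau> > 0"
    have "peval id (modular_param d \<tau>) F = 0"
    proof (cases "modular_param d \<tau> Y1 = 0")
      case True
      thus ?thesis unfolding F_def using N by (intro peval_homogenise_at_infinity) auto
    next
      case False
      show ?thesis unfolding F_def
        by (subst peval_homogenise_finite) (use N False zero[OF t False] in \<open>auto intro: less_imp_le\<close>)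
    qed
    thus "wproj_point (modular_param d \<tau>) \<in> wproj_zeros {F}"
      by (rule wproj_point_in_zeros[OF punctured[OF t] F])
  qed
  moreover have "wproj_closed (wproj_zeros {F})"
    unfolding wproj_closed_def by (rule exI[of _ "{F}"]) (use F in auto)
  ultimately have "S0 d \<subseteq> wproj_zeros {F}" unfolding S0_def by (rule hull_minimal)
  hence "chart a \<in> wproj_zeros {F}" using a by (auto simp: S0_affine_def)
  moreover have "case_hcoord a 1 \<in> chart a"
  proof -
    have "case_hcoord a 1 \<in> punctured_space" by (auto simp: punctured_space_def intro!: exI[of _ Y1])
    moreover have "wscale 1 (case_hcoord a 1) = case_hcoord a 1" by (simp add: wscale_def)
    ultimately show ?thesis by (auto simp: chart_def wproj_point_def wproj_rel_def intro!: exI[of _ 1])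
  qed
  ultimately have "peval id (case_hcoord a 1) F = 0" by (auto simp: wproj_zeros_def)
  thus ?thesis by (simp add: F_def peval_homogenise_chart)
qed

section \<open>The curve, the vector field and the determinant\<close>

definition curve_param :: "nat \<Rightarrow> complex \<Rightarrow> coord \<Rightarrow> complex" where
  "curve_param d \<tau> v = modular_param d \<tau> (Aff v) / modular_param d \<tau> Y1 ^ weight (Aff v)"

text \<open>
  The quotient rule for \<open>a\<^sub>2/y\<^sup>2, a\<^sub>3/y\<^sup>3, b\<^sub>2/y\<^sup>2, -b\<^sub>3/y\<^sup>3\<close> when both \<open>(a\<^sub>1, a\<^sub>2, a\<^sub>3)\<close> and \<open>(b\<^sub>1, b\<^sub>2, b\<^sub>3)\<close> solve
  Ramanujan's equations and \<open>y = a\<^sub>1 - b\<^sub>1\<close>; the right-hand sides are \<open>y\<close> times the components of the vector field.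
\<close>

lemma tangency_identities:
  fixes y :: complex
  assumes "y \<noteq> 0"
  shows "((4 * (b1 + y) * a2 - 6 * a3) * y ^ 2 - a2 * (2 * y * (y * (2 * b1 + y) - (a2 - b2) / 12))) / (y ^ 2 * y ^ 2) =
      y * (2 * (a2 / y ^ 2) - 6 * (a3 / y ^ 3) + 1 / 6 * (a2 / y ^ 2 - b2 / y ^ 2) * (a2 / y ^ 2))"
    "((6 * (b1 + y) * a3 - a2 ^ 2 / 3) * y ^ 3 - a3 * (3 * y ^ 2 * (y * (2 * b1 + y) - (a2 - b2) / 12))) / (y ^ 3 * y ^ 3) =
      y * (3 * (a3 / y ^ 3) - 1 / 3 * (a2 / y ^ 2) ^ 2 + 1 / 4 * (a2 / y ^ 2 - b2 / y ^ 2) * (a3 / y ^ 3))"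
    "((4 * b1 * b2 - 6 * b3) * y ^ 2 - b2 * (2 * y * (y * (2 * b1 + y) - (a2 - b2) / 12))) / (y ^ 2 * y ^ 2) =
      - y * (2 * (b2 / y ^ 2) - 6 * (- b3 / y ^ 3) + 1 / 6 * (b2 / y ^ 2 - a2 / y ^ 2) * (b2 / y ^ 2))"
    "(- (6 * b1 * b3 - b2 ^ 2 / 3) * y ^ 3 - (- b3) * (3 * y ^ 2 * (y * (2 * b1 + y) - (a2 - b2) / 12))) / (y ^ 3 * y ^ 3) =
      - y * (3 * (- b3 / y ^ 3) - 1 / 3 * (b2 / y ^ 2) ^ 2 + 1 / 4 * (b2 / y ^ 2 - a2 / y ^ 2) * (- b3 / y ^ 3))"
  using assms by (simp_all add: divide_simps) (simp_all add: algebra_simps eval_nat_numeral)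

text \<open>
  Both \<open>g\<^sub>i(\<tau>)\<close> and \<open>d\<^sup>i g\<^sub>i(d\<tau>)\<close> solve Ramanujan's equations, so \<open>tangency_identities\<close> applies.
\<close>

lemma vfield_tangent_to_curve:
  assumes d: "d > 0" and t: "Im \<tau> > 0" and nz: "modular_param d \<tau> Y1 \<noteq> 0"
  shows "((\<lambda>t. peval of_rat (curve_param d t) p) has_field_derivative
     modular_param d \<tau> Y1 * peval of_rat (curve_param d \<tau>) (vfield p)) (at \<tau>)"
proof -
  define A1 where "A1 = g1"
  define A2 where "A2 = g2"
  define A3 where "A3 = g3"
  define B1 where "B1 = (\<lambda>t. of_nat d * g1 (of_nat d * t))"
  define B2 where "B2 = (\<lambda>t. of_nat d ^ 2 * g2 (of_nat d * t))"
  define B3 where "B3 = (\<lambda>t. of_nat d ^ 3 * g3 (of_nat d * t))"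
  define Y where "Y = (\<lambda>t. A1 t - B1 t)"
  have dt: "Im (of_nat d * \<tau>) > 0" using t d by simp
  have lin: "((\<lambda>t. of_nat d * t) has_field_derivative of_nat d) (at \<tau>)"
    by (auto intro!: derivative_eq_intros)
  have A: "(A1 has_field_derivative A1 \<tau> ^ 2 - A2 \<tau> / 12) (at \<tau>)"
    "(A2 has_field_derivative 4 * A1 \<tau> * A2 \<tau> - 6 * A3 \<tau>) (at \<tau>)"
    "(A3 has_field_derivative 6 * A1 \<tau> * A3 \<tau> - A2 \<tau> ^ 2 / 3) (at \<tau>)"
    unfolding A1_def A2_def A3_def by (rule ramanujan_g1 ramanujan_g2 ramanujan_g3, rule t)+
  note chain = DERIV_chain2[where g = "\<lambda>t. of_nat d * t" and x = \<tau> and s = UNIV, OF _ lin]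
  have B: "(B1 has_field_derivative B1 \<tau> ^ 2 - B2 \<tau> / 12) (at \<tau>)"
    "(B2 has_field_derivative 4 * B1 \<tau> * B2 \<tau> - 6 * B3 \<tau>) (at \<tau>)"
    "(B3 has_field_derivative 6 * B1 \<tau> * B3 \<tau> - B2 \<tau> ^ 2 / 3) (at \<tau>)"
    unfolding B1_def B2_def B3_def
    using DERIV_cmult[OF chain[OF ramanujan_g1[OF dt]], of "of_nat d"]
      DERIV_cmult[OF chain[OF ramanujan_g2[OF dt]], of "of_nat d ^ 2"]
      DERIV_cmult[OF chain[OF ramanujan_g3[OF dt]], of "of_nat d ^ 3"]
    by (simp_all add: algebra_simps eval_nat_numeral)
  define y b1 where "y = Y \<tau>" and "b1 = B1 \<tau>"
  have y: "y \<noteq> 0" using nz by (simp add: y_def Y_def A1_def B1_def)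
  have a1: "A1 \<tau> = b1 + y" by (simp add: y_def Y_def b1_def)
  have "(Y has_field_derivative (A1 \<tau> ^ 2 - A2 \<tau> / 12) - (B1 \<tau> ^ 2 - B2 \<tau> / 12)) (at \<tau>)"
    unfolding Y_def by (intro DERIV_diff A B)
  also have "(A1 \<tau> ^ 2 - A2 \<tau> / 12) - (B1 \<tau> ^ 2 - B2 \<tau> / 12) = y * (2 * b1 + y) - (A2 \<tau> - B2 \<tau>) / 12"
    unfolding a1 b1_def [symmetric] by (simp add: algebra_simps power2_eq_square diff_divide_distrib)
  finally have Y': "(Y has_field_derivative y * (2 * b1 + y) - (A2 \<tau> - B2 \<tau>) / 12) (at \<tau>)" .
  have Y2': "((\<lambda>t. Y t ^ 2) has_field_derivative 2 * y * (y * (2 * b1 + y) - (A2 \<tau> - B2 \<tau>) / 12)) (at \<tau>)"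
    using DERIV_power[OF Y', of 2] by (simp add: y_def mult_ac)
  have Y3': "((\<lambda>t. Y t ^ 3) has_field_derivative 3 * y ^ 2 * (y * (2 * b1 + y) - (A2 \<tau> - B2 \<tau>) / 12)) (at \<tau>)"
    using DERIV_power[OF Y', of 3] by (simp add: y_def mult_ac)
  have nz2: "Y \<tau> ^ 2 \<noteq> 0" and nz3: "Y \<tau> ^ 3 \<noteq> 0" using y by (simp_all add: y_def)
  define z where "z = curve_param d \<tau>"
  have params: "(\<lambda>t. curve_param d t X2) = (\<lambda>t. A2 t / Y t ^ 2)" "(\<lambda>t. curve_param d t X3) = (\<lambda>t. A3 t / Y t ^ 3)"
    "(\<lambda>t. curve_param d t Y2) = (\<lambda>t. B2 t / Y t ^ 2)" "(\<lambda>t. curve_param d t Y3) = (\<lambda>t. - B3 t / Y t ^ 3)"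
    by (simp_all add: curve_param_def Y_def A1_def A2_def A3_def B1_def B2_def B3_def)
  have z: "z X2 = A2 \<tau> / y ^ 2" "z X3 = A3 \<tau> / y ^ 3" "z Y2 = B2 \<tau> / y ^ 2" "z Y3 = - B3 \<tau> / y ^ 3"
    using params[THEN fun_cong, of \<tau>] by (simp_all add: z_def y_def)
  define D where "D = (\<lambda>v. case v of
      X2 \<Rightarrow> y * (2 * z X2 - 6 * z X3 + 1 / 6 * (z X2 - z Y2) * z X2)
    | X3 \<Rightarrow> y * (3 * z X3 - 1 / 3 * z X2 ^ 2 + 1 / 4 * (z X2 - z Y2) * z X3)
    | Y2 \<Rightarrow> - y * (2 * z Y2 - 6 * z Y3 + 1 / 6 * (z Y2 - z X2) * z Y2)
    | Y3 \<Rightarrow> - y * (3 * z Y3 - 1 / 3 * z Y2 ^ 2 + 1 / 4 * (z Y2 - z X2) * z Y3))"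
  have "((\<lambda>t. curve_param d t v) has_field_derivative D v) (at \<tau>)" for v
  proof (cases v)
    case X2
    show ?thesis
      using DERIV_divide[OF A(2) Y2' nz2] unfolding X2 params D_def coord.case z
        a1 y_def[symmetric] tangency_identities(1)[OF y] .
  next
    case X3
    show ?thesis
      using DERIV_divide[OF A(3) Y3' nz3] unfolding X3 params D_def coord.case z
        a1 y_def[symmetric] tangency_identities(2)[OF y] .
  next
    case Y2
    show ?thesis
      using DERIV_divide[OF B(2) Y2' nz2] unfolding Y2 params D_def coord.case z
        b1_def[symmetric] y_def[symmetric] tangency_identities(3)[OF y] .
  next
    case Y3
    show ?thesis
      using DERIV_divide[OF DERIV_minus[OF B(3)] Y3' nz3]
      unfolding Y3 params D_def coord.case z
        b1_def[symmetric] y_def[symmetric] tangency_identities(4)[OF y] .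
  qed
  from has_field_derivative_peval[OF this, where p = p]
  have "((\<lambda>t. peval of_rat (curve_param d t) p) has_field_derivative
      (D X2 * peval of_rat z (partial_deriv X2 p) + D X3 * peval of_rat z (partial_deriv X3 p)
       + D Y2 * peval of_rat z (partial_deriv Y2 p) + D Y3 * peval of_rat z (partial_deriv Y3 p))) (at \<tau>)"
    unfolding z_def .
  also have "D X2 * peval of_rat z (partial_deriv X2 p) + D X3 * peval of_rat z (partial_deriv X3 p)
       + D Y2 * peval of_rat z (partial_deriv Y2 p) + D Y3 * peval of_rat z (partial_deriv Y3 p) =
       y * peval of_rat z (vfield p)"
    unfolding vfield_def
    by (simp add: D_def peval.hom_add peval.hom_minus peval.hom_mult of_rat_divide) (simp add: algebra_simps)
  also have "y = modular_param d \<tau> Y1" by (simp add: y_def Y_def A1_def B1_def)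
  finally show ?thesis by (simp only: z_def)
qed

lemma modular_param_punctured:
  assumes "Im \<tau> > 0"
  shows "modular_param d \<tau> \<in> punctured_space"
proof -
  have "g2 \<tau> \<noteq> 0 \<or> g3 \<tau> \<noteq> 0"
    using discriminant_nonzero[OF assms] by (auto simp: discriminant_def)
  hence "modular_param d \<tau> (Aff X2) \<noteq> 0 \<or> modular_param d \<tau> (Aff X3) \<noteq> 0" by simp
  thus ?thesis unfolding punctured_space_def by blast
qed

text \<open>
  The index \<open>k\<close> is the degree of the symmetric function that the monomial \<open>x\<^sub>2\<^sup>a x\<^sub>3\<^sup>b\<close>, with \<open>p = (a, b)\<close>, comes
  from.
\<close>

definition relation_monomial :: "nat \<Rightarrow> nat \<Rightarrow> nat \<times> nat \<times> nat \<Rightarrow> (coord, rat) mpoly" where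
  "relation_monomial i \<Psi> = (\<lambda>(k, p). y_coord i ^ (\<Psi> - k) * x2 ^ fst p * x3 ^ snd p)"

definition relation_index :: "nat \<Rightarrow> nat \<Rightarrow> (nat \<times> nat \<times> nat) set" where
  "relation_index i N = (SIGMA k:{..N}. {p. 2 * fst p + 3 * snd p = i * k})"

text \<open>
  The modular equation, multiplied by the power of \<open>y\<^sub>i\<close> that brings it to degree \<open>\<Psi>\<close> in \<open>y\<^sub>i\<close> and divided by
  \<open>y\<^sub>1\<close> to the power \<open>i\<Psi>\<close>.
\<close>

lemma polynomial_relation_on_curve:
  assumes d: "d > 0" and i: "i \<in> {1, 2, 3}" and Psi: "card (hecke_triples d) \<le> \<Psi>"
  obtains N c where "N \<le> \<Psi>" "c (0, 0, 0) = 1"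
    "\<And>\<tau>. Im \<tau> > 0 \<Longrightarrow> modular_param d \<tau> Y1 \<noteq> 0 \<Longrightarrow>
       (\<Sum>x\<in>relation_index i N. c x * peval of_rat (curve_param d \<tau>) (relation_monomial i \<Psi> x)) = (0 :: complex)"
proof -
  obtain N s where N: "N \<le> card (hecke_triples d)" and s0: "\<forall>\<tau>. s 0 \<tau> = 1"
    and s: "\<forall>k\<le>N. isobaric (i * k) (s k)"
    and rel: "\<forall>\<tau>. Im \<tau> > 0 \<longrightarrow> (\<Sum>k\<le>N. s k \<tau> * conjugate_param d i \<tau> ^ (N - k)) = 0"
    using modular_equation[OF d i] by (elim exE conjE)
  have "\<forall>k\<in>{..N}. \<exists>c. \<forall>\<tau>. Im \<tau> > 0 \<longrightarrow>
     s k \<tau> = (\<Sum>p | 2 * fst p + 3 * snd p = i * k. c p * g2 \<tau> ^ fst p * g3 \<tau> ^ snd p)"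
    using s unfolding isobaric_def by blast
  from bchoice[OF this] obtain C where "\<forall>k\<in>{..N}. \<forall>\<tau>. Im \<tau> > 0 \<longrightarrow>
     s k \<tau> = (\<Sum>p | 2 * fst p + 3 * snd p = i * k. C k p * g2 \<tau> ^ fst p * g3 \<tau> ^ snd p)"
    by (elim exE)
  hence C: "\<And>k \<tau>. k \<le> N \<Longrightarrow> Im \<tau> > 0 \<Longrightarrow>
     s k \<tau> = (\<Sum>p | 2 * fst p + 3 * snd p = i * k. C k p * g2 \<tau> ^ fst p * g3 \<tau> ^ snd p)"
    by simp
  define c where "c = (\<lambda>(k, p). C k p)"
  define I where "I = relation_index i N"
  note I_defs = I_def relation_index_def
  have P0: "{p :: nat \<times> nat. 2 * fst p + 3 * snd p = i * 0} = {(0, 0)}" by auto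
  have "c (0, 0, 0) = 1"
    using C[of 0 \<i>, unfolded P0] s0 by (simp add: c_def)
  moreover have "(\<Sum>x\<in>I. c x * peval of_rat (curve_param d \<tau>) (relation_monomial i \<Psi> x)) = 0"
    if t: "Im \<tau> > 0" and nz: "modular_param d \<tau> Y1 \<noteq> 0" for \<tau>
  proof -
    define y where "y = modular_param d \<tau> Y1"
    define w where "w = conjugate_param d i \<tau>"
    have y: "y \<noteq> 0" using nz by (simp add: y_def)
    have w_eq: "peval of_rat (curve_param d \<tau>) (y_coord i) = w / y ^ i"
      using i nz by (auto simp: y_coord_def w_def conjugate_param_def curve_param_def y_def)
    have term_eq: "peval of_rat (curve_param d \<tau>) (relation_monomial i \<Psi> (k, p)) =
       w ^ (\<Psi> - N) / y ^ (i * \<Psi>) * (g2 \<tau> ^ fst p * g3 \<tau> ^ snd p * w ^ (N - k))"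
      if kp: "(k, p) \<in> I" for k p
    proof -
      have k: "k \<le> N" "k \<le> \<Psi>" and p: "2 * fst p + 3 * snd p = i * k"
        using kp N Psi by (auto simp: I_defs)
      \<comment> \<open>the power of \<open>w\<close> that completes the degree \<open>N\<close> to \<open>\<Psi>\<close> is the same in all terms\<close>
    have e1: "\<Psi> - k = (\<Psi> - N) + (N - k)" using k N Psi by simp
      have e2: "i * \<Psi> = i * (\<Psi> - k) + 2 * fst p + 3 * snd p"
        using k p by (simp add: add.assoc flip: distrib_left)
      have "peval of_rat (curve_param d \<tau>) (relation_monomial i \<Psi> (k, p)) =
          (w / y ^ i) ^ (\<Psi> - k) * (g2 \<tau> / y ^ 2) ^ fst p * (g3 \<tau> / y ^ 3) ^ snd p"
        by (simp add: relation_monomial_def peval.hom_mult w_eq) (simp add: curve_param_def y_def)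
      also have "\<dots> = w ^ (\<Psi> - k) * g2 \<tau> ^ fst p * g3 \<tau> ^ snd p / y ^ (i * \<Psi>)"
        unfolding e2 by (simp add: power_divide power_add power_mult)
      also have "w ^ (\<Psi> - k) = w ^ (\<Psi> - N) * w ^ (N - k)" unfolding e1 by (rule power_add)
      finally show ?thesis by simp
    qed
    have "(\<Sum>x\<in>I. c x * peval of_rat (curve_param d \<tau>) (relation_monomial i \<Psi> x)) =
      (\<Sum>(k, p)\<in>I. w ^ (\<Psi> - N) / y ^ (i * \<Psi>) * (C k p * g2 \<tau> ^ fst p * g3 \<tau> ^ snd p * w ^ (N - k)))"
      by (intro sum.cong refl) (auto simp: term_eq c_def)
    also have "\<dots> = w ^ (\<Psi> - N) / y ^ (i * \<Psi>) *
        (\<Sum>(k, p)\<in>I. C k p * g2 \<tau> ^ fst p * g3 \<tau> ^ snd p * w ^ (N - k))"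
      by (simp add: sum_distrib_left case_prod_unfold)
    also have "(\<Sum>(k, p)\<in>I. C k p * g2 \<tau> ^ fst p * g3 \<tau> ^ snd p * w ^ (N - k)) =
        (\<Sum>k\<le>N. s k \<tau> * w ^ (N - k))"
      unfolding I_defs by (subst sum.Sigma [symmetric])
        (auto simp: finite_weight_pairs C t sum_distrib_right)
    also have "\<dots> = 0" unfolding w_def using rel t by blast
    finally show ?thesis by simp
  qed
  moreover have "N \<le> \<Psi>" using N Psi by simp
  ultimately show ?thesis using that unfolding I_def by blast
qed

text \<open>
  The leading monomial \<open>y\<^sub>i\<^sup>\<Psi>\<close> is separated from the others by its value at \<open>x\<^sub>2 = x\<^sub>3 = 0\<close>, \<open>y\<^sub>2 = y\<^sub>3 = 1\<close>.
\<close>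

lemma relation_monomial_top_unique:
  assumes "relation_monomial i \<Psi> (k, p) = relation_monomial i \<Psi> (0, 0, 0)"
    and "2 * fst p + 3 * snd p = i * k" "i \<noteq> 0"
  shows "(k, p) = (0, 0, 0)"
proof -
  define z :: "coord \<Rightarrow> complex" where "z = (\<lambda>v. if v = Y2 \<or> v = Y3 then 1 else 0)"
  have "peval of_rat z (relation_monomial i \<Psi> (k, p)) = peval of_rat z (relation_monomial i \<Psi> (0, 0, 0))"
    by (simp only: assms(1))
  hence "(0 :: complex) ^ fst p * 0 ^ snd p = 1"
    by (simp add: relation_monomial_def peval.hom_mult y_coord_def z_def split: if_splits)
  hence "fst p = 0" "snd p = 0" by (auto simp: power_0_left split: if_splits)
  with assms(2,3) show ?thesis by (simp add: prod_eq_iff)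
qed

text \<open>
  Collecting the coefficients of the relation over equal monomials gives the kernel vector, whose entry at
  \<open>y\<^sub>i\<^sup>\<Psi>\<close> is 1.  Each derivative along the curve multiplies by \<open>y\<^sub>1 \<noteq> 0\<close> and applies the derivation once.
\<close>

lemma J_poly_vanishes_on_parametrisation:
  assumes d: "d > 0" and i: "i \<in> {1, 2, 3}" and dist: "distinct \<alpha>" and set: "set \<alpha> = weighted_monomials d i"
    and t: "Im \<tau> > 0" and nz: "modular_param d \<tau> Y1 \<noteq> 0"
  shows "peval of_rat (curve_param d \<tau>) (J_poly \<alpha>) = 0"
proof -
  obtain \<Psi> where Psi: "dedekind_psi d = of_nat \<Psi>" "card (hecke_triples d) \<le> \<Psi>"
    using card_hecke_triples_le_psi[OF d] by blast
  obtain N c where N: "N \<le> \<Psi>" and c0: "c (0, 0, 0) = 1"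
    and rel: "\<And>\<tau>. Im \<tau> > 0 \<Longrightarrow> modular_param d \<tau> Y1 \<noteq> 0 \<Longrightarrow>
       (\<Sum>x\<in>relation_index i N. c x * peval of_rat (curve_param d \<tau>) (relation_monomial i \<Psi> x)) = (0 :: complex)"
    by (rule polynomial_relation_on_curve[OF d i Psi(2)]) (rule that)
  define I where "I = relation_index i N"
  note I_defs = I_def relation_index_def
  have finI: "finite I" by (simp add: I_defs finite_weight_pairs)
  have mono_in: "relation_monomial i \<Psi> x \<in> set \<alpha>" if "x \<in> I" for x
  proof -
    obtain k p where kp: "x = (k, p)" by (cases x)
    hence x: "x = (k, p)" "k \<le> N" "2 * fst p + 3 * snd p = i * k"
      using \<open>x \<in> I\<close> by (auto simp: I_defs)
    have "i * (\<Psi> - k) + 2 * fst p + 3 * snd p = i * \<Psi>"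
      using x N by (simp add: add.assoc flip: distrib_left)
    hence "of_nat i * dedekind_psi d = of_nat (i * (\<Psi> - k) + 2 * fst p + 3 * snd p)"
      by (simp only: Psi(1) of_nat_mult)
    thus ?thesis unfolding set weighted_monomials_def x(1) relation_monomial_def prod.case by blast
  qed
  \<comment> \<open>the kernel vector, as a function on monomials\<close>
  define w where "w = (\<lambda>\<mu>. \<Sum>x | x \<in> I \<and> relation_monomial i \<Psi> x = \<mu>. c x)"
  have top: "(0, 0, 0) \<in> I" by (simp add: I_defs)
  then obtain j0 where j0: "j0 < length \<alpha>" "\<alpha> ! j0 = relation_monomial i \<Psi> (0, 0, 0)"
    using mono_in by (metis in_set_conv_nth)
  have "{x. x \<in> I \<and> relation_monomial i \<Psi> x = relation_monomial i \<Psi> (0, 0, 0)} = {(0, 0, 0)}"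
    using top relation_monomial_top_unique[of i \<Psi>] i by (fastforce simp: I_defs)
  hence w_top: "w (\<alpha> ! j0) \<noteq> 0" by (simp add: w_def j0 c0)
  have sum_eq: "(\<Sum>j<length \<alpha>. w (\<alpha> ! j) * \<phi> (\<alpha> ! j)) = (\<Sum>x\<in>I. c x * \<phi> (relation_monomial i \<Psi> x))"
    for \<phi> :: "(coord, rat) mpoly \<Rightarrow> complex"
  proof -
    have "(\<Sum>j<length \<alpha>. w (\<alpha> ! j) * \<phi> (\<alpha> ! j)) = (\<Sum>\<mu>\<in>set \<alpha>. w \<mu> * \<phi> \<mu>)"
      by (rule sum.reindex_bij_betw[OF bij_betw_nth[OF dist refl refl], of "\<lambda>\<mu>. w \<mu> * \<phi> \<mu>"])
    also have "\<dots> = (\<Sum>\<mu>\<in>set \<alpha>. \<Sum>x | x \<in> I \<and> relation_monomial i \<Psi> x = \<mu>. c x * \<phi> (relation_monomial i \<Psi> x))"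
      by (auto simp: w_def sum_distrib_right intro!: sum.cong)
    also have "\<dots> = (\<Sum>x\<in>I. c x * \<phi> (relation_monomial i \<Psi> x))"
      by (rule sum.group) (use finI mono_in in auto)
    finally show ?thesis .
  qed
  define U where "U = {\<tau>. Im \<tau> > 0 \<and> modular_param d \<tau> Y1 \<noteq> 0}"
  have "open U"
  proof -
    have "continuous_on {\<tau>. Im \<tau> > 0} (\<lambda>\<tau>. modular_param d \<tau> Y1)"
    proof -
      have "continuous_on {\<tau>. Im \<tau> > 0} g1"
        by (intro holomorphic_on_imp_continuous_on q_expansion_holomorphic[OF q_expansion_g1])
      moreover have "continuous_on {\<tau>. Im \<tau> > 0} (\<lambda>\<tau>. g1 (of_nat d * \<tau>))"
        by (rule continuous_on_compose2[OF calculation]) (use d in \<open>auto intro!: continuous_intros\<close>)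
      ultimately show ?thesis by (auto intro!: continuous_intros)
    qed
    hence "open ({\<tau>. Im \<tau> > 0} \<inter> (\<lambda>\<tau>. modular_param d \<tau> Y1) -` (- {0}))"
      by (intro continuous_open_preimage open_upper_half_plane) auto
    moreover have "{\<tau>. Im \<tau> > 0} \<inter> (\<lambda>\<tau>. modular_param d \<tau> Y1) -` (- {0}) = U" by (auto simp: U_def)
    ultimately show ?thesis by simp
  qed
  have kernel: "(\<Sum>j<length \<alpha>. w (\<alpha> ! j) * peval of_rat (curve_param d \<tau>) ((vfield ^^ r) (\<alpha> ! j))) = 0"
    if "\<tau> \<in> U" for r \<tau>
    using that
  proof (induction r arbitrary: \<tau>)
    case 0
    thus ?case using rel[of \<tau>] sum_eq[of "peval of_rat (curve_param d \<tau>)"] by (simp add: U_def I_def)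
  next
    case (Suc r)
    define f where "f = (\<lambda>t. \<Sum>j<length \<alpha>. w (\<alpha> ! j) * peval of_rat (curve_param d t) ((vfield ^^ r) (\<alpha> ! j)))"
    define y where "y = modular_param d \<tau> Y1"
    have y: "y \<noteq> 0" and t: "Im \<tau> > 0" using Suc.prems by (auto simp: y_def U_def)
    have "(f has_field_derivative (\<Sum>j<length \<alpha>. w (\<alpha> ! j) *
        (y * peval of_rat (curve_param d \<tau>) (vfield ((vfield ^^ r) (\<alpha> ! j)))))) (at \<tau>)"
      unfolding f_def y_def
      by (intro DERIV_sum DERIV_cmult vfield_tangent_to_curve d t) (use y in \<open>simp add: y_def\<close>)
    moreover have "(f has_field_derivative 0) (at \<tau>)"
      by (rule has_field_derivative_transform_within_open[OF DERIV_const \<open>open U\<close> Suc.prems])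
         (simp add: f_def Suc.IH)
    ultimately have "(\<Sum>j<length \<alpha>. w (\<alpha> ! j) *
        (y * peval of_rat (curve_param d \<tau>) (vfield ((vfield ^^ r) (\<alpha> ! j))))) = 0"
      by (rule DERIV_unique)
    hence "y * (\<Sum>j<length \<alpha>. w (\<alpha> ! j) * peval of_rat (curve_param d \<tau>) ((vfield ^^ Suc r) (\<alpha> ! j))) = 0"
      by (simp add: sum_distrib_left mult_ac)
    thus ?case using y by simp
  qed
  show ?thesis
    by (rule peval_J_poly_eq_0[OF j0(1), of "\<lambda>j. w (\<alpha> ! j)"]) (use w_top kernel t nz in \<open>auto simp: U_def\<close>)
qed

theorem theorem2:
  fixes d i :: nat
    and \<alpha> :: "(coord, rat) mpoly list"
    and a :: "coord \<Rightarrow> complex"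
  assumes "d \<ge> 1"
    and "i \<in> {1, 2, 3}"
    and "distinct \<alpha>" and "set \<alpha> = weighted_monomials d i"
    and "a \<in> S0_affine d"
  shows "peval of_rat a (J_poly \<alpha>) = 0"
proof (rule S0_affine_vanishing[OF modular_param_punctured _ assms(5)])
  fix \<tau> :: complex
  assume "Im \<tau> > 0" "modular_param d \<tau> Y1 \<noteq> 0"
  with assms(1-4) have "peval of_rat (curve_param d \<tau>) (J_poly \<alpha>) = 0"
    by (intro J_poly_vanishes_on_parametrisation) auto
  thus "peval of_rat (\<lambda>v. modular_param d \<tau> (Aff v) / modular_param d \<tau> Y1 ^ weight (Aff v)) (J_poly \<alpha>) = 0"
    by (simp add: curve_param_def [abs_def])
qed

end
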